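(* Let $H$ be a fixed graph that contains a connected component that is not a path. Then, unless the Exponential Time Hypothesis fails, there is no algorithm that, given an instance $(G,\sigma)$ of \textsc{Colorful $H$-Subgraph Hitting} and a tree decomposition of $G$ of width $t$, solves $(G,\sigma)$ in time $2^{o(t)}\cdot|V(G)|^{\mathcal{O}(1)}$.
   Context: An $H$-coloring of a graph $G$ is a function $\sigma:V(G)\to V(H)$. A $\sigma$-$H$-subgraph of $G$ is an injective map $\pi:V(H)\to V(G)$ with $\pi(a)\pi(b)\in E(G)$ whenever $ab\in E(H)$ and $\sigma(\pi(a))=a$ for all $a\in V(H)$; $X\subseteq V(G)$ hits it if $X\cap\pi(V(H))\ne\emptyset$. \textsc{Colorful $H$-Subgraph Hitting}: given $G$ and an $H$-coloring $\sigma$, compute the minimum size of a set $X\subseteq V(G)$ hitting all $\sigma$-$H$-subgraphs of $G$. The Exponential Time Hypothesis (ETH) asserts that there is $\delta>0$ such that $3$-SAT on $n$ variables cannot be solved in time $\mathcal{O}(2^{\delta n})$. *)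

theory Defs
  imports Complex_Main "HOL-Library.Landau_Symbols"
begin

section \<open>Graphs and tree decompositions\<close>

record 'a graph =
  verts :: "'a set"
  edges :: "'a set set"

definition simple_graph :: "'a graph \<Rightarrow> bool" where
  "simple_graph G \<longleftrightarrow> finite (verts G) \<and>
     edges G \<subseteq> {{u, v} | u v. u \<in> verts G \<and> v \<in> verts G \<and> u \<noteq> v}"

definition adjacency :: "'a graph \<Rightarrow> ('a \<times> 'a) set" where
  "adjacency G = {(u, v). {u, v} \<in> edges G}"

definition induced_subgraph :: "'a graph \<Rightarrow> 'a set \<Rightarrow> 'a graph" where
  "induced_subgraph G X = \<lparr>verts = X, edges = {e \<in> edges G. e \<subseteq> X}\<rparr>"

definition connected_graph :: "'a graph \<Rightarrow> bool" where
  "connected_graph G \<longleftrightarrow> verts G \<noteq> {} \<and>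
     (\<forall>u\<in>verts G. \<forall>v\<in>verts G. (u, v) \<in> (adjacency G)\<^sup>*)"

definition components :: "'a graph \<Rightarrow> 'a graph set" where
  "components G =
     {induced_subgraph G {v \<in> verts G. (u, v) \<in> (adjacency G)\<^sup>*} | u. u \<in> verts G}"

text \<open>A one-vertex graph counts as a path.\<close>

definition path_graph :: "'a graph \<Rightarrow> bool" where
  "path_graph P \<longleftrightarrow> (\<exists>vs. vs \<noteq> [] \<and> distinct vs \<and> verts P = set vs \<and>
     edges P = {{vs ! i, vs ! Suc i} | i. Suc i < length vs})"

definition cycle_in :: "'a graph \<Rightarrow> 'a list \<Rightarrow> bool" where
  "cycle_in G vs \<longleftrightarrow> 3 \<le> length vs \<and> distinct vs \<and> set vs \<subseteq> verts G \<and>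
     (\<forall>i < length vs. {vs ! i, vs ! (Suc i mod length vs)} \<in> edges G)"

definition tree :: "'a graph \<Rightarrow> bool" where
  "tree T \<longleftrightarrow> simple_graph T \<and> connected_graph T \<and> (\<nexists>vs. cycle_in T vs)"

text \<open>Connected graphs are nonempty by definition, so the last conjunct also says that every
  vertex lies in some bag.\<close>

definition tree_decomposition :: "'a graph \<Rightarrow> 'b graph \<Rightarrow> ('b \<Rightarrow> 'a set) \<Rightarrow> bool" where
  "tree_decomposition G T \<beta> \<longleftrightarrow> tree T \<and>
     (\<forall>x\<in>verts T. \<beta> x \<subseteq> verts G) \<and>
     (\<forall>e\<in>edges G. \<exists>x\<in>verts T. e \<subseteq> \<beta> x) \<and>
     (\<forall>v\<in>verts G. connected_graph (induced_subgraph T {x \<in> verts T. v \<in> \<beta> x}))"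

text \<open>For a nonempty graph the largest bag is nonempty, so the subtraction does not truncate.\<close>

definition width :: "'b graph \<Rightarrow> ('b \<Rightarrow> 'a set) \<Rightarrow> nat" where
  "width T \<beta> = Max ((\<lambda>x. card (\<beta> x)) ` verts T) - 1"


section \<open>Colorful subgraph hitting\<close>

definition coloring :: "'h graph \<Rightarrow> 'a graph \<Rightarrow> ('a \<Rightarrow> 'h) \<Rightarrow> bool" where
  "coloring H G \<sigma> \<longleftrightarrow> \<sigma> ` verts G \<subseteq> verts H"

definition colorful_subgraph :: "'h graph \<Rightarrow> 'a graph \<Rightarrow> ('a \<Rightarrow> 'h) \<Rightarrow> ('h \<Rightarrow> 'a) \<Rightarrow> bool" where
  "colorful_subgraph H G \<sigma> \<pi> \<longleftrightarrow>
     \<pi> ` verts H \<subseteq> verts G \<and> inj_on \<pi> (verts H) \<and>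
     (\<forall>a b. {a, b} \<in> edges H \<longrightarrow> {\<pi> a, \<pi> b} \<in> edges G) \<and>
     (\<forall>a\<in>verts H. \<sigma> (\<pi> a) = a)"

definition hitting_set :: "'h graph \<Rightarrow> 'a graph \<Rightarrow> ('a \<Rightarrow> 'h) \<Rightarrow> 'a set \<Rightarrow> bool" where
  "hitting_set H G \<sigma> X \<longleftrightarrow> X \<subseteq> verts G \<and>
     (\<forall>\<pi>. colorful_subgraph H G \<sigma> \<pi> \<longrightarrow> X \<inter> \<pi> ` verts H \<noteq> {})"

definition min_hitting :: "'h graph \<Rightarrow> 'a graph \<Rightarrow> ('a \<Rightarrow> 'h) \<Rightarrow> nat" where
  "min_hitting H G \<sigma> = (LEAST k. \<exists>X. hitting_set H G \<sigma> X \<and> card X = k)"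


section \<open>Algorithms and running time\<close>

text \<open>
  The model of computation is N. D. Jones's WHILE language: finitely many variables holding
  binary trees, with unit cost for every assignment and every test. Tests only distinguish
  the leaf from a node; there is no unit-cost comparison of trees. Trees can therefore be kept
  as shared pointer structures, each step allocates only a number of cells that is bounded for
  the given program, and the model simulates and is simulated by Turing machines with polynomial
  overhead. The running times below are insensitive to such an overhead: the bound
  \<open>2\<^sup>o\<^sup>(\<^sup>t\<^sup>) n\<^sup>O\<^sup>(\<^sup>1\<^sup>)\<close> is closed under polynomials, and for the exponential time
  hypothesis a different \<open>\<delta>\<close> can be chosen.
\<close>

datatype data = Leaf | Node data data

datatype expr = Var nat | Const data | Pair expr expr | Left expr | Right expr

datatype prog =
    Skip
  | Assign nat expr
  | Seq prog prog
  | If expr prog prog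
  | While expr prog

type_synonym state = "nat \<Rightarrow> data"

fun left :: "data \<Rightarrow> data" where
  "left Leaf = Leaf"
| "left (Node x y) = x"

fun right :: "data \<Rightarrow> data" where
  "right Leaf = Leaf"
| "right (Node x y) = y"

fun eval_expr :: "expr \<Rightarrow> state \<Rightarrow> data" where
  "eval_expr (Var i) s = s i"
| "eval_expr (Const d) s = d"
| "eval_expr (Pair e f) s = Node (eval_expr e s) (eval_expr f s)"
| "eval_expr (Left e) s = left (eval_expr e s)"
| "eval_expr (Right e) s = right (eval_expr e s)"

text \<open>\<open>exec p s n s'\<close>: started in state \<open>s\<close>, program \<open>p\<close> halts after \<open>n\<close> steps in state \<open>s'\<close>.\<close>

inductive exec :: "prog \<Rightarrow> state \<Rightarrow> nat \<Rightarrow> state \<Rightarrow> bool" where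
  Skip: "exec Skip s 1 s"
| Assign: "exec (Assign i e) s 1 (s(i := eval_expr e s))"
| Seq: "exec p s m s' \<Longrightarrow> exec q s' n s'' \<Longrightarrow> exec (Seq p q) s (m + n) s''"
| IfTrue: "eval_expr e s \<noteq> Leaf \<Longrightarrow> exec p s n s' \<Longrightarrow> exec (If e p q) s (1 + n) s'"
| IfFalse: "eval_expr e s = Leaf \<Longrightarrow> exec q s n s' \<Longrightarrow> exec (If e p q) s (1 + n) s'"
| WhileFalse: "eval_expr e s = Leaf \<Longrightarrow> exec (While e p) s 1 s"
| WhileTrue: "eval_expr e s \<noteq> Leaf \<Longrightarrow> exec p s m s' \<Longrightarrow> exec (While e p) s' n s'' \<Longrightarrow>
    exec (While e p) s (1 + m + n) s''"

text \<open>Input and output are passed in variable 0; all other variables initially hold the leaf.\<close>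

definition computes_in :: "prog \<Rightarrow> data \<Rightarrow> data \<Rightarrow> nat \<Rightarrow> bool" where
  "computes_in p x y n \<longleftrightarrow> (\<exists>s. exec p ((\<lambda>_. Leaf)(0 := x)) n s \<and> s 0 = y)"


section \<open>Encodings\<close>

fun enc_list :: "data list \<Rightarrow> data" where
  "enc_list [] = Leaf"
| "enc_list (x # xs) = Node x (enc_list xs)"

definition enc_bool :: "bool \<Rightarrow> data" where
  "enc_bool b = (if b then Node Leaf Leaf else Leaf)"

text \<open>Numbers are written in unary. All numbers that are encoded below are bounded by the number
  of vertices, tree nodes or variables (or are colors, i.e. constants), so this costs only a
  polynomial factor over binary.\<close>

definition enc_nat :: "nat \<Rightarrow> data" where
  "enc_nat n = enc_list (replicate n Leaf)"

text \<open>Subsets of \<open>{..<n}\<close> are given by characteristic vectors, graphs on \<open>{..<n}\<close> by adjacency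
  matrices.\<close>

definition enc_set :: "nat \<Rightarrow> nat set \<Rightarrow> data" where
  "enc_set n X = enc_list (map (\<lambda>v. enc_bool (v \<in> X)) [0..<n])"

definition enc_graph :: "nat graph \<Rightarrow> data" where
  "enc_graph G = (let n = card (verts G) in
     enc_list (map (\<lambda>u. enc_set n {v. {u, v} \<in> edges G}) [0..<n]))"

definition enc_instance ::
    "nat graph \<Rightarrow> (nat \<Rightarrow> nat) \<Rightarrow> nat graph \<Rightarrow> (nat \<Rightarrow> nat set) \<Rightarrow> data" where
  "enc_instance G \<sigma> T \<beta> = enc_list
     [enc_graph G,
      enc_list (map (\<lambda>v. enc_nat (\<sigma> v)) [0..<card (verts G)]),
      enc_graph T,
      enc_list (map (\<lambda>x. enc_set (card (verts G)) (\<beta> x)) [0..<card (verts T)])]"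


section \<open>The exponential time hypothesis\<close>

text \<open>The literal \<open>(i, True)\<close> is the variable \<open>i\<close>, and \<open>(i, False)\<close> is its negation.\<close>

type_synonym literal = "nat \<times> bool"
type_synonym cnf = "literal list list"

text \<open>Clauses must not be repeated: otherwise the length of a formula would not be bounded in
  terms of its number of variables, and the hypothesis would hold for trivial reasons.\<close>

definition cnf3 :: "nat \<Rightarrow> cnf \<Rightarrow> bool" where
  "cnf3 n \<phi> \<longleftrightarrow> distinct \<phi> \<and> (\<forall>C\<in>set \<phi>. length C \<le> 3 \<and> (\<forall>(i, b)\<in>set C. i < n))"

definition satisfiable :: "cnf \<Rightarrow> bool" where
  "satisfiable \<phi> \<longleftrightarrow> (\<exists>\<alpha> :: nat \<Rightarrow> bool. \<forall>C\<in>set \<phi>. \<exists>(i, b)\<in>set C. \<alpha> i = b)"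

definition enc_literal :: "literal \<Rightarrow> data" where
  "enc_literal l = Node (enc_nat (fst l)) (enc_bool (snd l))"

definition enc_cnf :: "nat \<Rightarrow> cnf \<Rightarrow> data" where
  "enc_cnf n \<phi> = Node (enc_nat n) (enc_list (map (\<lambda>C. enc_list (map enc_literal C)) \<phi>))"

definition solves_3SAT_in :: "prog \<Rightarrow> (nat \<Rightarrow> real) \<Rightarrow> bool" where
  "solves_3SAT_in p f \<longleftrightarrow> (\<forall>n \<phi>. cnf3 n \<phi> \<longrightarrow>
     (\<exists>m. computes_in p (enc_cnf n \<phi>) (enc_bool (satisfiable \<phi>)) m \<and> real m \<le> f n))"

definition ETH :: bool where
  "ETH \<longleftrightarrow> (\<exists>\<delta>::real > 0.
     \<nexists>p f. f \<in> O(\<lambda>n. 2 powr (\<delta> * real n)) \<and> solves_3SAT_in p f)"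


section \<open>Solving the hitting problem on a given tree decomposition\<close>

text \<open>Graphs are presented with vertex set \<open>{..<n}\<close>. The input graph has at least one vertex, so
  that the width is a natural number and the bound \<open>n ^ c\<close> is positive.

  Running times on tree decompositions are measured against the size of the graph alone, which
  presupposes a decomposition of polynomial size. As usual we take it to have at most as many
  nodes as the graph has vertices, which is always possible at the same width by merging nodes
  whose bag is contained in a neighboring bag. An algorithm thus has to be correct and fast only
  on these inputs; since the lower bound excludes such algorithms, it also excludes those that
  achieve the time bound on all tree decompositions.\<close>

definition hitting_input ::
    "nat graph \<Rightarrow> nat graph \<Rightarrow> (nat \<Rightarrow> nat) \<Rightarrow> nat graph \<Rightarrow> (nat \<Rightarrow> nat set) \<Rightarrow> bool" where
  "hitting_input H G \<sigma> T \<beta> \<longleftrightarrow>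
     simple_graph G \<and> verts G \<noteq> {} \<and> verts G = {..<card (verts G)} \<and> coloring H G \<sigma> \<and>
     tree_decomposition G T \<beta> \<and> verts T = {..<card (verts T)} \<and>
     card (verts T) \<le> card (verts G)"

definition solves_hitting_in :: "nat graph \<Rightarrow> prog \<Rightarrow> (nat \<Rightarrow> nat \<Rightarrow> real) \<Rightarrow> bool" where
  "solves_hitting_in H p f \<longleftrightarrow> (\<forall>G \<sigma> T \<beta>. hitting_input H G \<sigma> T \<beta> \<longrightarrow>
     (\<exists>m. computes_in p (enc_instance G \<sigma> T \<beta>) (enc_nat (min_hitting H G \<sigma>)) m \<and>
          real m \<le> f (width T \<beta>) (card (verts G))))"

end

theory Submission
  imports Defs "HOL-Real_Asymp.Real_Asymp"
begin

text \<open>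
  If a connected graph is not a path, it has three vertices \<open>a\<close>, \<open>b\<close>, \<open>c\<close> none of which
  separates the other two. They let colorful hitting simulate vertex cover on graphs that are
  properly colored with \<open>a\<close>, \<open>b\<close>, \<open>c\<close>: for every edge \<open>uv\<close>, add more private copies of \<open>H\<close>
  than the budget allows to hit, with \<open>u\<close> and \<open>v\<close> in the place of the two vertices of their
  colors. Walking through \<open>H\<close> shows that every colorful copy, also one that mixes gadgets,
  contains both ends of some edge.

  3-SAT reduces to such vertex cover instances as usual, except that the two literals of a
  variable become the sides of a 6-cycle (\<open>K\<^sub>3\<^sub>,\<^sub>3\<close> minus a perfect matching), so that every
  side contains all three colors, and each clause becomes a triangle. Putting all literal
  vertices into every bag gives a path decomposition of width \<open>6n + O(1)\<close>, however many
  clauses there are; hence no sparsification is needed.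
\<close>

text \<open>An edge is simulated by placing its ends at two different vertices of H, so they need
  different colors. A triangle vertex can thus face only literal vertices of the two other colors,
  and a literal with a single vertex would be invisible to the triangle vertex of its own color. The
  6-cycle gives every literal all three colors; its only covers with three vertices are its two
  sides, so a vertex of any color shows the truth value.

  A hitting set could also hit a gadget in a private vertex; one copy more than the budget makes
  this useless. A private copy touches the rest only in its two ends, so it can have a bag of its
  own. The vertices of H outside the triple, also in other components, just ride along in the
  private copies.

  The reduction has to be a WHILE program, without unit-cost comparison of trees. It is therefore
  composed of functions on trees, for which polynomial time is proved structurally. Vertices are
  named by trees; their numbers are positions in a list, which the program never computes.\<close>

section \<open>Polynomial time on a stack\<close>

text \<open>Variable 0 holds a stack, of which \<open>f\<close> transforms the top entry. Composite programs park
  values below the top, so no other variable is needed.\<close>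

definition ptime :: "(data \<Rightarrow> data) \<Rightarrow> bool" where
  "ptime f \<longleftrightarrow> (\<exists>p c. \<forall>x. size (f x) \<le> (size x + 2) ^ c \<and>
     (\<forall>s r. \<exists>t \<le> (size x + 2) ^ c. exec p (s(0 := Node x r)) t (s(0 := Node (f x) r))))"

section \<open>Sizes of trees and polynomial bounds\<close>

lemma size_left: "size (left x) \<le> size x"
  by (cases x) auto

lemma size_right: "size (right x) \<le> size x"
  by (cases x) auto

text \<open>The base \<open>n + 2\<close> is at least 2 even for n = 0, so constant factors and sums
  are absorbed by a larger exponent and a single number describes the bound.\<close>

definition polybd :: "(nat \<Rightarrow> nat) \<Rightarrow> bool" where
  "polybd b \<longleftrightarrow> (\<exists>c. \<forall>n. b n \<le> (n + 2) ^ c)"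

lemma polybdI: "(\<And>n. b n \<le> (n + 2) ^ c) \<Longrightarrow> polybd b"
  unfolding polybd_def by blast

lemma polybd_mono: "polybd b \<Longrightarrow> (\<And>n. b' n \<le> b n) \<Longrightarrow> polybd b'"
  unfolding polybd_def by (meson order_trans)

lemma polybd_const: "polybd (\<lambda>n. k)"
proof (rule polybdI)
  fix n :: nat
  have "k \<le> 2 ^ k"
    by (simp add: less_imp_le)
  also have "(2::nat) ^ k \<le> (n + 2) ^ k"
    by (simp add: power_mono)
  finally show "k \<le> (n + 2) ^ k" .
qed

lemma polybd_id: "polybd (\<lambda>n. n)"
  by (rule polybdI[of _ 1]) simp

lemma polybd_add: assumes "polybd b" "polybd b'" shows "polybd (\<lambda>n. b n + b' n)"
proof -
  obtain c c' where c: "b n \<le> (n + 2) ^ c" "b' n \<le> (n + 2) ^ c'" for n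
    using assms unfolding polybd_def by blast
  have "b n + b' n \<le> (n + 2) ^ (c + c' + 1)" for n
  proof -
    have "b n \<le> (n + 2) ^ (c + c')" "b' n \<le> (n + 2) ^ (c + c')"
      using c[of n] by (meson le_add1 le_add2 order_trans power_increasing One_nat_def Suc_leI zero_less_Suc trans_le_add2 one_le_numeral)+
    then have "b n + b' n \<le> 2 * (n + 2) ^ (c + c')" by simp
    also have "\<dots> \<le> (n + 2) * (n + 2) ^ (c + c')" by (rule mult_right_mono) simp_all
    finally show ?thesis by simp
  qed
  then show ?thesis by (rule polybdI)
qed

lemma polybd_mult: assumes "polybd b" "polybd b'" shows "polybd (\<lambda>n. b n * b' n)"
proof -
  obtain c c' where c: "b n \<le> (n + 2) ^ c" "b' n \<le> (n + 2) ^ c'" for n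
    using assms unfolding polybd_def by blast
  have "b n * b' n \<le> (n + 2) ^ (c + c')" for n
    using mult_mono[OF c] by (simp add: power_add)
  then show ?thesis by (rule polybdI)
qed

lemma polybd_power: "polybd b \<Longrightarrow> polybd (\<lambda>n. b n ^ k)"
  by (induction k) (auto intro: polybd_const polybd_mult)

lemma polybd_Suc: "polybd b \<Longrightarrow> polybd (\<lambda>n. Suc (b n))"
  using polybd_add[OF _ polybd_const[of 1]] by simp

lemmas polybd_intros = polybd_Suc polybd_Suc[OF polybd_id] polybd_const polybd_id polybd_add polybd_mult polybd_power

lemma polybd_comp:
  assumes "polybd b" "mono b" "polybd b'"
  shows "polybd (\<lambda>n. b (b' n))"
proof -
  obtain c where c: "b n \<le> (n + 2) ^ c" for n
    using assms(1) unfolding polybd_def by blast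
  show ?thesis
    by (rule polybd_mono[of "\<lambda>n. (b' n + 2) ^ c"]) (intro polybd_intros assms c)+
qed

lemma ptimeI:
  assumes "polybd b" "\<And>x. size (f x) \<le> b (size x)"
    and "\<And>x s r. \<exists>t \<le> b (size x). exec p (s(0 := Node x r)) t (s(0 := Node (f x) r))"
  shows "ptime f"
proof -
  obtain c where "b n \<le> (n + 2) ^ c" for n
    using assms(1) unfolding polybd_def by blast
  then show ?thesis
    using assms(2,3) unfolding ptime_def by (meson order_trans)
qed

text \<open>The bound is handed out in monotone form, so that it can be evaluated at an upper bound
  for the size of an intermediate result.\<close>

lemma ptimeE:
  assumes "ptime f"
  obtains p b where "polybd b" "mono b" "\<And>x. size (f x) \<le> b (size x)"
    "\<And>x s r. \<exists>t \<le> b (size x). exec p (s(0 := Node x r)) t (s(0 := Node (f x) r))"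
proof -
  obtain p c where *: "\<And>x. size (f x) \<le> (size x + 2) ^ c"
    "\<And>x s r. \<exists>t \<le> (size x + 2) ^ c. exec p (s(0 := Node x r)) t (s(0 := Node (f x) r))"
    using assms unfolding ptime_def by blast
  have "mono (\<lambda>n::nat. (n + 2) ^ c)" by (auto intro!: monoI power_mono)
  then show ?thesis using that[of "\<lambda>n. (n + 2) ^ c"] * polybdI[of "\<lambda>n. (n + 2) ^ c" c] by auto
qed

text \<open>Size is a separate part of \<open>ptime\<close> because time does not bound it well:
  assigning \<open>Pair (Var 0) (Var 0)\<close> doubles a tree in a single step.\<close>

lemma ptime_size: "ptime f \<Longrightarrow> \<exists>b. polybd b \<and> mono b \<and> (\<forall>x. size (f x) \<le> b (size x))"
  by (meson ptimeE)

section \<open>Closure of polynomial time under composition, pairing, branching and loops\<close>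

lemma exec_assign:
  "s' = s(i := eval_expr e s) \<Longrightarrow> exec (Assign i e) s (Suc 0) s'"
  using exec.Assign by simp

lemma ptime_id: "ptime (\<lambda>x. x)"
  by (rule ptimeI[of "\<lambda>n. n + 1" _ Skip]) (auto intro!: polybd_intros exec.Skip exI[of _ 1])

lemma ptime_const: "ptime (\<lambda>x. d)"
  by (rule ptimeI[of "\<lambda>n. size d + 1" _ "Assign 0 (Pair (Const d) (Right (Var 0)))"])
    (auto intro!: polybd_intros exec_assign exI[of _ 1])

lemma ptime_comp: assumes "ptime f" "ptime g" shows "ptime (\<lambda>x. f (g x))"
proof -
  obtain p b where f: "polybd b" "mono b" "\<And>x. size (f x) \<le> b (size x)"
    "\<And>x s r. \<exists>t \<le> b (size x). exec p (s(0 := Node x r)) t (s(0 := Node (f x) r))"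
    using assms(1) by (rule ptimeE) blast
  obtain q b' where g: "polybd b'" "mono b'" "\<And>x. size (g x) \<le> b' (size x)"
    "\<And>x s r. \<exists>t \<le> b' (size x). exec q (s(0 := Node x r)) t (s(0 := Node (g x) r))"
    using assms(2) by (rule ptimeE) blast
  have le: "b (size (g x)) \<le> b (b' (size x))" for x
    using f(2) g(3) by (simp add: monoD)
  show ?thesis
  proof (rule ptimeI[of "\<lambda>n. b' n + b (b' n)" _ "Seq q p"])
    have "polybd (\<lambda>n. b (b' n))"
      by (rule polybd_comp[OF f(1,2) g(1)])
    then show "polybd (\<lambda>n. b' n + b (b' n))"
      by (intro polybd_intros g)
    show "size (f (g x)) \<le> b' (size x) + b (b' (size x))" for x
      using f(3)[of "g x"] le[of x] by linarith
    fix x s r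
    obtain t where t: "t \<le> b' (size x)" "exec q (s(0 := Node x r)) t (s(0 := Node (g x) r))"
      using g(4) by blast
    obtain t' where t': "t' \<le> b (size (g x))"
      "exec p (s(0 := Node (g x) r)) t' (s(0 := Node (f (g x)) r))"
      using f(4) by blast
    show "\<exists>t\<le>b' (size x) + b (b' (size x)).
        exec (Seq q p) (s(0 := Node x r)) t (s(0 := Node (f (g x)) r))"
      using exec.Seq[OF t(2) t'(2)] t(1) t'(1) le[of x] by (intro exI[of _ "t + t'"]) auto
  qed
qed

lemma ptime_left': "ptime left"
  by (rule ptimeI[of "\<lambda>n. n + 1" _ "Assign 0 (Pair (Left (Left (Var 0))) (Right (Var 0)))"])
    (auto intro!: polybd_intros exec_assign exI[of _ 1] intro: le_SucI size_left)

lemma ptime_right': "ptime right"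
  by (rule ptimeI[of "\<lambda>n. n + 1" _ "Assign 0 (Pair (Right (Left (Var 0))) (Right (Var 0)))"])
    (auto intro!: polybd_intros exec_assign exI[of _ 1] intro: le_SucI size_right)

lemmas ptime_left = ptime_comp[OF ptime_left']
lemmas ptime_right = ptime_comp[OF ptime_right']

lemma ptime_Node: assumes "ptime f" "ptime g" shows "ptime (\<lambda>x. Node (f x) (g x))"
proof -
  obtain p b where f: "polybd b" "mono b" "\<And>x. size (f x) \<le> b (size x)"
    "\<And>x s r. \<exists>t \<le> b (size x). exec p (s(0 := Node x r)) t (s(0 := Node (f x) r))"
    using assms(1) by (rule ptimeE) blast
  obtain q b' where g: "polybd b'" "mono b'" "\<And>x. size (g x) \<le> b' (size x)"
    "\<And>x s r. \<exists>t \<le> b' (size x). exec q (s(0 := Node x r)) t (s(0 := Node (g x) r))"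
    using assms(2) by (rule ptimeE) blast
  \<comment> \<open>\<open>dup\<close> keeps a second copy of x below the top while p runs,
    \<open>swp\<close> exchanges the result with that copy for q, and \<open>pck\<close> joins the
    two results.\<close>
  define dup swp pck where
    "dup = Assign 0 (Pair (Left (Var 0)) (Var 0))"
    and "swp = Assign 0 (Pair (Left (Right (Var 0))) (Pair (Left (Var 0)) (Right (Right (Var 0)))))"
    and "pck = Assign 0 (Pair (Pair (Left (Right (Var 0))) (Left (Var 0))) (Right (Right (Var 0))))"
  show ?thesis
  proof (rule ptimeI[of "\<lambda>n. b n + b' n + 3" _ "Seq dup (Seq p (Seq swp (Seq q pck)))"])
    show "polybd (\<lambda>n. b n + b' n + 3)"
      by (intro polybd_intros f g)
    show "size (Node (f x) (g x)) \<le> b (size x) + b' (size x) + 3" for x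
      using f(3)[of x] g(3)[of x] by simp
    fix x s r
    obtain t where t: "t \<le> b (size x)"
      "exec p (s(0 := Node x (Node x r))) t (s(0 := Node (f x) (Node x r)))"
      using f(4) by blast
    obtain t' where t': "t' \<le> b' (size x)"
      "exec q (s(0 := Node x (Node (f x) r))) t' (s(0 := Node (g x) (Node (f x) r)))"
      using g(4) by blast
    have 1: "exec dup (s(0 := Node x r)) 1 (s(0 := Node x (Node x r)))"
      "exec swp (s(0 := Node (f x) (Node x r))) 1 (s(0 := Node x (Node (f x) r)))"
      "exec pck (s(0 := Node (g x) (Node (f x) r))) 1 (s(0 := Node (Node (f x) (g x)) r))"
      unfolding dup_def swp_def pck_def by (auto intro!: exec_assign)
    show "\<exists>t\<le>b (size x) + b' (size x) + 3. exec (Seq dup (Seq p (Seq swp (Seq q pck))))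
        (s(0 := Node x r)) t (s(0 := Node (Node (f x) (g x)) r))"
      using t(1) t'(1)
      by (intro exI[of _ "1 + (t + (1 + (t' + 1)))"] conjI exec.Seq[OF 1(1)] exec.Seq[OF t(2)]
          exec.Seq[OF 1(2)] exec.Seq[OF t'(2)] 1(3)) auto
  qed
qed

lemma ptime_if_Leaf:
  assumes "ptime h" "ptime f" "ptime g"
  shows "ptime (\<lambda>x. if h x = Leaf then g x else f x)"
proof -
  obtain p b where f: "polybd b" "mono b" "\<And>x. size (f x) \<le> b (size x)"
    "\<And>x s r. \<exists>t \<le> b (size x). exec p (s(0 := Node x r)) t (s(0 := Node (f x) r))"
    using assms(2) by (rule ptimeE) blast
  obtain q b' where g: "polybd b'" "mono b'" "\<And>x. size (g x) \<le> b' (size x)"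
    "\<And>x s r. \<exists>t \<le> b' (size x). exec q (s(0 := Node x r)) t (s(0 := Node (g x) r))"
    using assms(3) by (rule ptimeE) blast
  \<comment> \<open>The test value would overwrite the input, so it is computed next to a copy; the
    branching program then drops it.\<close>
  have "ptime (\<lambda>x. Node (h x) x)"
    by (intro ptime_Node assms ptime_id)
  moreover have "ptime (\<lambda>y. if left y = Leaf then g (right y) else f (right y))"
  proof (rule ptimeI[of "\<lambda>n. b n + b' n + 2" _
      "If (Left (Left (Var 0))) (Seq (Assign 0 (Pair (Right (Left (Var 0))) (Right (Var 0)))) p)
         (Seq (Assign 0 (Pair (Right (Left (Var 0))) (Right (Var 0)))) q)"])
    show "polybd (\<lambda>n. b n + b' n + 2)"
      by (intro polybd_intros f g)
    have m: "b (size (right y)) \<le> b (size y)" "b' (size (right y)) \<le> b' (size y)" for y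
      using f(2) g(2) size_right[of y] by (auto dest: monoD)
    show "size (if left y = Leaf then g (right y) else f (right y)) \<le> b (size y) + b' (size y) + 2" for y
      using f(3)[of "right y"] g(3)[of "right y"] m[of y] by simp
    fix y s r
    have a: "exec (Assign 0 (Pair (Right (Left (Var 0))) (Right (Var 0))))
      (s(0 := Node y r)) 1 (s(0 := Node (right y) r))"
      by (auto intro!: exec_assign)
    show "\<exists>t\<le>b (size y) + b' (size y) + 2. exec
      (If (Left (Left (Var 0))) (Seq (Assign 0 (Pair (Right (Left (Var 0))) (Right (Var 0)))) p)
         (Seq (Assign 0 (Pair (Right (Left (Var 0))) (Right (Var 0)))) q)) (s(0 := Node y r)) t
      (s(0 := Node (if left y = Leaf then g (right y) else f (right y)) r))"
    proof (cases "left y = Leaf")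
      case True
      obtain t where t: "t \<le> b' (size (right y))"
        "exec q (s(0 := Node (right y) r)) t (s(0 := Node (g (right y)) r))"
        using g(4) by blast
      show ?thesis
        using exec.IfFalse[OF _ exec.Seq[OF a t(2)], of "Left (Left (Var 0))"] True t(1) m[of y]
        by (intro exI[of _ "1 + (1 + t)"]) auto
    next
      case False
      obtain t where t: "t \<le> b (size (right y))"
        "exec p (s(0 := Node (right y) r)) t (s(0 := Node (f (right y)) r))"
        using f(4) by blast
      show ?thesis
        using exec.IfTrue[OF _ exec.Seq[OF a t(2)], of "Left (Left (Var 0))"] False t(1) m[of y]
        by (intro exI[of _ "1 + (1 + t)"]) auto
    qed
  qed
  ultimately show ?thesis
    using ptime_comp[of "\<lambda>y. if left y = Leaf then g (right y) else f (right y)" "\<lambda>x. Node (h x) x"]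
    by (simp cong: if_cong)
qed

text \<open>B bounds the number of iterations and also the size of every intermediate state. The
  latter keeps the passes cheap: the size bound of f, composed with itself once per iteration, may
  grow exponentially.\<close>

lemma ptime_while:
  assumes step: "ptime f" and init: "ptime g" and "polybd B"
    and F: "\<And>x. \<exists>i \<le> B (size x). F x = (f ^^ i) (g x) \<and> left ((f ^^ i) (g x)) = Leaf \<and>
      (\<forall>j<i. left ((f ^^ j) (g x)) \<noteq> Leaf) \<and> (\<forall>j\<le>i. size ((f ^^ j) (g x)) \<le> B (size x))"
  shows "ptime F"
proof -
  obtain p b where f: "polybd b" "mono b" "\<And>x. size (f x) \<le> b (size x)"
    "\<And>x s r. \<exists>t \<le> b (size x). exec p (s(0 := Node x r)) t (s(0 := Node (f x) r))"
    using step by (rule ptimeE) blast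
  let ?w = "While (Left (Left (Var 0))) p"
  \<comment> \<open>The estimate is uniform: m bounds all states visited, so a pass together with
    its test costs at most \<open>b m + 1\<close>; the final failing test costs 1.\<close>
  have run: "\<exists>t \<le> i * (b m + 1) + 1. exec ?w (s(0 := Node x r)) t (s(0 := Node ((f ^^ i) x) r))"
    if "left ((f ^^ i) x) = Leaf" "\<forall>j<i. left ((f ^^ j) x) \<noteq> Leaf"
      "\<forall>j\<le>i. size ((f ^^ j) x) \<le> m" for i m x s r
    using that
  proof (induction i arbitrary: x)
    case 0
    then show ?case by (auto intro!: exec.WhileFalse exI[of _ 1])
  next
    case (Suc i)
    have x: "left x \<noteq> Leaf" "size x \<le> m"
      using Suc.prems by (force dest: spec[of _ 0])+
    have "\<exists>t \<le> i * (b m + 1) + 1.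
        exec ?w (s(0 := Node (f x) r)) t (s(0 := Node ((f ^^ i) (f x)) r))"
    proof (rule Suc.IH)
      show "left ((f ^^ i) (f x)) = Leaf"
        using Suc.prems(1) by (simp add: funpow_swap1)
      show "\<forall>j<i. left ((f ^^ j) (f x)) \<noteq> Leaf"
        using Suc.prems(2) by (auto simp: funpow_swap1 dest: spec[of _ "Suc _"])
      show "\<forall>j\<le>i. size ((f ^^ j) (f x)) \<le> m"
        using Suc.prems(3) by (auto simp: funpow_swap1 dest: spec[of _ "Suc _"])
    qed
    then obtain t where t: "t \<le> i * (b m + 1) + 1"
      "exec ?w (s(0 := Node (f x) r)) t (s(0 := Node ((f ^^ Suc i) x) r))"
      by (auto simp: funpow_swap1)
    obtain t' where t': "t' \<le> b (size x)" "exec p (s(0 := Node x r)) t' (s(0 := Node (f x) r))"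
      using f(4) by blast
    have "b (size x) \<le> b m"
      using f(2) x(2) by (auto dest: monoD)
    then have le: "1 + t' + t \<le> Suc i * (b m + 1) + 1"
      using t(1) t'(1) by simp
    have "exec ?w (s(0 := Node x r)) (1 + t' + t) (s(0 := Node ((f ^^ Suc i) x) r))"
      using x(1) by (intro exec.WhileTrue[OF _ t'(2) t(2)]) simp
    with le show ?case by blast
  qed
  obtain q b' where g: "polybd b'" "mono b'" "\<And>x. size (g x) \<le> b' (size x)"
    "\<And>x s r. \<exists>t \<le> b' (size x). exec q (s(0 := Node x r)) t (s(0 := Node (g x) r))"
    using init by (rule ptimeE) blast
  show ?thesis
  proof (rule ptimeI[of "\<lambda>n. b' n + (B n * (b (B n) + 1) + 1 + B n)" _ "Seq q ?w"])
    have "polybd (\<lambda>n. b (B n))"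
      by (rule polybd_comp[OF f(1,2) assms(3)])
    then show "polybd (\<lambda>n. b' n + (B n * (b (B n) + 1) + 1 + B n))"
      by (intro polybd_intros assms g)
    show "size (F x) \<le> b' (size x) + (B (size x) * (b (B (size x)) + 1) + 1 + B (size x))" for x
      using F[of x] by (metis le_refl trans_le_add2)
    fix x s r
    obtain i where i: "i \<le> B (size x)" "F x = (f ^^ i) (g x)" "left ((f ^^ i) (g x)) = Leaf"
      "\<forall>j<i. left ((f ^^ j) (g x)) \<noteq> Leaf" "\<forall>j\<le>i. size ((f ^^ j) (g x)) \<le> B (size x)"
      using F[of x] by blast
    obtain t where t: "t \<le> i * (b (B (size x)) + 1) + 1"
      "exec ?w (s(0 := Node (g x) r)) t (s(0 := Node (F x) r))"
      using run[OF i(3-5)] unfolding i(2) by blast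
    obtain t' where t': "t' \<le> b' (size x)" "exec q (s(0 := Node x r)) t' (s(0 := Node (g x) r))"
      using g(4) by blast
    have "i * (b (B (size x)) + 1) \<le> B (size x) * (b (B (size x)) + 1)"
      using i(1) by (rule mult_right_mono) simp
    then have "t' + t \<le> b' (size x) + (B (size x) * (b (B (size x)) + 1) + 1 + B (size x))"
      using t(1) t'(1) by linarith
    then show "\<exists>t\<le>b' (size x) + (B (size x) * (b (B (size x)) + 1) + 1 + B (size x)).
        exec (Seq q ?w) (s(0 := Node x r)) t (s(0 := Node (F x) r))"
      using exec.Seq[OF t'(2) t(2)] by blast
  qed
qed

section \<open>Lists of trees: reversal, folds, maps, suffixes and subtraction\<close>

fun dlist :: "data \<Rightarrow> data list" where
  "dlist Leaf = []"
| "dlist (Node x y) = x # dlist y"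

lemma enc_list_dlist [simp]: "enc_list (dlist x) = x"
  by (induction x) auto

lemma dlist_enc_list [simp]: "dlist (enc_list xs) = xs"
  by (induction xs) auto

lemma length_dlist: "length (dlist x) \<le> size x"
  by (induction x) auto

lemma size_enc_list: "size (enc_list xs) = (\<Sum>x\<leftarrow>xs. size x + 1)"
  by (induction xs) auto

lemma size_mem_dlist: "y \<in> set (dlist x) \<Longrightarrow> size y \<le> size x"
  by (induction x) auto

text \<open>Loops take lists apart from the front, whereas \<open>foldr\<close> starts at the end;
  reversing the list first reconciles the two.\<close>

definition drev :: "data \<Rightarrow> data" where
  "drev x = enc_list (rev (dlist x))"

lemma size_drev [simp]: "size (drev x) = size x"
proof -
  have "size (enc_list (rev xs)) = size (enc_list xs)" for xs
    unfolding size_enc_list rev_map[symmetric] by simp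
  from this[of "dlist x"] show ?thesis by (simp add: drev_def)
qed

lemma ptime_drev': "ptime drev"
proof -
  define f where "f x = Node (right (left x)) (Node (left (left x)) (right x))" for x
  have iter: "(f ^^ length xs) (Node (enc_list (xs @ ys)) (enc_list zs)) =
      Node (enc_list ys) (enc_list (rev xs @ zs))" for xs ys zs
  proof (induction xs arbitrary: zs)
    case (Cons x xs)
    show ?case
      using Cons.IH[of "x # zs"]
      by (simp add: f_def funpow_Suc_right del: funpow.simps(2))
  qed simp
  have "ptime (\<lambda>x. Node Leaf (drev x))"
  proof (rule ptime_while[where f = f and g = "\<lambda>x. Node x Leaf" and B = "\<lambda>n. n + 1"])
    show "ptime f"
      unfolding f_def by (intro ptime_Node ptime_left ptime_right ptime_id)
    show "ptime (\<lambda>x. Node x Leaf)" "polybd (\<lambda>n. n + 1)"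
      by (intro ptime_Node ptime_id ptime_const polybd_intros)+
    fix x
    define l where "l = dlist x"
    have it: "(f ^^ j) (Node x Leaf) = Node (enc_list (drop j l)) (enc_list (rev (take j l)))"
      if "j \<le> length l" for j
      using iter[of "take j l" "drop j l" "[]"] that by (simp add: l_def)
    have "size ((f ^^ j) (Node x Leaf)) \<le> size x + 1" if "j \<le> length l" for j
    proof -
      have "size (enc_list (drop j l)) + size (enc_list (rev (take j l))) =
          size (enc_list (take j l @ drop j l))"
        unfolding size_enc_list by (simp add: rev_map[symmetric] del: append_take_drop_id)
      then show ?thesis using it[OF that] by (simp add: l_def)
    qed
    moreover have "left ((f ^^ j) (Node x Leaf)) \<noteq> Leaf" if "j < length l" for j
      using it[OF less_imp_le[OF that]] that by (cases "drop j l") auto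
    ultimately show "\<exists>i \<le> size x + 1. Node Leaf (drev x) = (f ^^ i) (Node x Leaf) \<and>
      left ((f ^^ i) (Node x Leaf)) = Leaf \<and> (\<forall>j<i. left ((f ^^ j) (Node x Leaf)) \<noteq> Leaf) \<and>
      (\<forall>j\<le>i. size ((f ^^ j) (Node x Leaf)) \<le> size x + 1)"
      using it[of "length l"] length_dlist[of x]
      by (intro exI[of _ "length l"]) (auto simp: l_def drev_def)
  qed
  then have "ptime (\<lambda>x. right (Node Leaf (drev x)))"
    by (rule ptime_right)
  then show ?thesis by simp
qed

lemmas ptime_drev = ptime_comp[OF ptime_drev']

definition dfoldr :: "(data \<Rightarrow> data \<Rightarrow> data) \<Rightarrow> data \<Rightarrow> data \<Rightarrow> data" where
  "dfoldr f l a = foldr f (dlist l) a"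

text \<open>This is bounded recursion: a polynomial-time step may double the accumulator each time,
  so \<open>bound\<close> controls its size for all suffixes zs that a right fold meets. The
  parameter e travels through the loop state; this lets the step depend on it and makes nested
  comprehensions possible.\<close>

lemma ptime_dfoldr:
  assumes F: "ptime (\<lambda>p. F (left p) (left (right p)) (right (right p)))"
    and g: "ptime g" and a: "ptime a" and B: "polybd B"
    and bound: "\<And>e ys zs. dlist (g e) = ys @ zs \<Longrightarrow> size (foldr (F e) zs (a e)) \<le> B (size e)"
  shows "ptime (\<lambda>e. dfoldr (F e) (g e) (a e))"
proof -
  define f where "f x = Node (right (left x)) (Node (left (right x))
    (F (left (right x)) (left (left x)) (right (right x))))" for x
  let ?i = "\<lambda>e. Node (drev (g e)) (Node e (a e))"
  have iter: "(f ^^ length xs) (Node (enc_list (xs @ ys)) (Node e b)) =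
      Node (enc_list ys) (Node e (fold (F e) xs b))" for xs ys e b
    by (induction xs arbitrary: b)
      (simp_all add: f_def funpow_Suc_right del: funpow.simps(2))
  obtain bg where bg: "polybd bg" "size (g e) \<le> bg (size e)" for e
    using ptime_size[OF g] by blast
  have "ptime (\<lambda>e. Node Leaf (Node e (dfoldr (F e) (g e) (a e))))"
  proof (rule ptime_while[where f = f and g = ?i and B = "\<lambda>n. bg n + n + B n + 2"])
    have "ptime (\<lambda>x. F (left (right x)) (left (left x)) (right (right x)))"
      using ptime_comp[OF F, of "\<lambda>x. Node (left (right x)) (Node (left (left x)) (right (right x)))"]
      by (simp add: ptime_Node ptime_left ptime_right ptime_id)
    then show "ptime f"
      unfolding f_def by (intro ptime_Node ptime_left ptime_right ptime_id)
    show "ptime ?i" "polybd (\<lambda>n. bg n + n + B n + 2)"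
      by (intro ptime_Node ptime_drev ptime_id g a polybd_intros bg B)+
    fix e
    define l where "l = rev (dlist (g e))"
    have it: "(f ^^ j) (?i e) = Node (enc_list (drop j l)) (Node e (fold (F e) (take j l) (a e)))"
      if "j \<le> length l" for j
      using iter[of "take j l" "drop j l" e] that by (simp add: l_def drev_def)
    have "size ((f ^^ j) (?i e)) \<le> bg (size e) + size e + B (size e) + 2" if "j \<le> length l" for j
    proof -
      have "size (enc_list (drop j l)) \<le> size (enc_list (take j l @ drop j l))"
        unfolding size_enc_list by (simp del: append_take_drop_id)
      also have "\<dots> = size (drev (g e))"
        by (simp add: l_def drev_def)
      also have "\<dots> \<le> bg (size e)"
        using bg(2) by simp
      finally have 1: "size (enc_list (drop j l)) \<le> bg (size e)" .
      have "dlist (g e) = rev (drop j l) @ rev (take j l)"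
        by (simp add: l_def rev_append[symmetric])
      then have "size (fold (F e) (take j l) (a e)) \<le> B (size e)"
        using bound[of e "rev (drop j l)" "rev (take j l)"] by (simp add: foldr_conv_fold)
      with 1 it[OF that] show ?thesis by simp
    qed
    moreover have "left ((f ^^ j) (?i e)) \<noteq> Leaf" if "j < length l" for j
      using it[OF less_imp_le[OF that]] that by (cases "drop j l") auto
    moreover have "length l \<le> bg (size e)"
      using length_dlist[of "g e"] bg(2)[of e] by (simp add: l_def)
    ultimately show "\<exists>i \<le> bg (size e) + size e + B (size e) + 2.
      Node Leaf (Node e (dfoldr (F e) (g e) (a e))) = (f ^^ i) (?i e) \<and>
      left ((f ^^ i) (?i e)) = Leaf \<and> (\<forall>j<i. left ((f ^^ j) (?i e)) \<noteq> Leaf) \<and>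
      (\<forall>j\<le>i. size ((f ^^ j) (?i e)) \<le> bg (size e) + size e + B (size e) + 2)"
      using it[of "length l"]
      by (intro exI[of _ "length l"]) (auto simp: l_def dfoldr_def foldr_conv_fold)
  qed
  then have "ptime (\<lambda>e. right (right (Node Leaf (Node e (dfoldr (F e) (g e) (a e))))))"
    by (intro ptime_right)
  then show ?thesis by simp
qed

definition dappend :: "data \<Rightarrow> data \<Rightarrow> data" where
  "dappend x y = enc_list (dlist x @ dlist y)"

lemma size_dappend [simp]: "size (dappend x y) = size x + size y"
  using size_enc_list[of "dlist x"] size_enc_list[of "dlist y"]
  by (simp add: dappend_def size_enc_list)

lemma dlist_dappend [simp]: "dlist (dappend x y) = dlist x @ dlist y"
  by (simp add: dappend_def)

lemma ptime_dappend:
  assumes "ptime f" "ptime g"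
  shows "ptime (\<lambda>e. dappend (f e) (g e))"
proof -
  obtain bf where bf: "polybd bf" "size (f e) \<le> bf (size e)" for e
    using ptime_size[OF assms(1)] by blast
  obtain bg where bg: "polybd bg" "size (g e) \<le> bg (size e)" for e
    using ptime_size[OF assms(2)] by blast
  have fold: "foldr Node xs a = dappend (enc_list xs) a" for xs a
    by (induction xs) (auto simp: dappend_def)
  have "ptime (\<lambda>e. dfoldr Node (f e) (g e))"
  proof (rule ptime_dfoldr[where B = "\<lambda>n. bf n + bg n"])
    fix e ys zs
    assume *: "dlist (f e) = ys @ zs"
    have "size (f e) = size (enc_list (ys @ zs))"
      by (simp flip: *)
    then have "size (enc_list zs) \<le> size (f e)"
      by (simp add: size_enc_list)
    then show "size (foldr Node zs (g e)) \<le> bf (size e) + bg (size e)"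
      using bf(2)[of e] bg(2)[of e] by (simp add: fold)
  qed (intro ptime_Node ptime_left ptime_right ptime_id assms polybd_intros bf bg)+
  then show ?thesis by (simp add: dfoldr_def fold)
qed

definition dmaps :: "(data \<Rightarrow> data) \<Rightarrow> data \<Rightarrow> data" where
  "dmaps f l = enc_list (concat (map (\<lambda>x. dlist (f x)) (dlist l)))"

lemma dlist_dmaps: "dlist (dmaps f l) = concat (map (\<lambda>x. dlist (f x)) (dlist l))"
  by (simp add: dmaps_def)

text \<open>A piece \<open>F e h\<close> does not depend on the accumulator, so the size of the
  result is at most the number of elements times the largest piece.\<close>

lemma ptime_dmaps:
  assumes F: "ptime (\<lambda>p. F (left p) (right p))" and g: "ptime g"
  shows "ptime (\<lambda>e. dmaps (F e) (g e))"
proof -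
  obtain bg where bg: "polybd bg" "size (g e) \<le> bg (size e)" for e
    using ptime_size[OF g] by blast
  obtain c where c: "size (F (left p) (right p)) \<le> (size p + 2) ^ c" for p
    using F unfolding ptime_def by blast
  let ?B = "\<lambda>n. bg n * (n + bg n + 3) ^ c"
  have fold: "foldr (\<lambda>h. dappend (F e h)) xs Leaf = enc_list (concat (map (\<lambda>x. dlist (F e x)) xs))"
    for e xs
    by (induction xs) (auto simp: dappend_def)
  have "ptime (\<lambda>e. dfoldr (\<lambda>h. dappend (F e h)) (g e) Leaf)"
  proof (rule ptime_dfoldr[where B = ?B])
    have "ptime (\<lambda>p. F (left p) (left (right p)))"
      using ptime_comp[OF F, of "\<lambda>p. Node (left p) (left (right p))"]
      by (simp add: ptime_Node ptime_left ptime_right ptime_id)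
    then show "ptime (\<lambda>p. dappend (F (left p) (left (right p))) (right (right p)))"
      by (intro ptime_dappend ptime_right ptime_id)
    fix e ys zs
    assume *: "dlist (g e) = ys @ zs"
    have "size (foldr (\<lambda>h. dappend (F e h)) zs Leaf) \<le> length zs * (size e + bg (size e) + 3) ^ c"
      if "set zs \<subseteq> set (dlist (g e))" for zs
      using that
    proof (induction zs)
      case (Cons h zs)
      have "size h \<le> bg (size e)"
        using Cons.prems size_mem_dlist[of h "g e"] bg(2)[of e] by simp
      then have "(size (Node e h) + 2) ^ c \<le> (size e + bg (size e) + 3) ^ c"
        by (intro power_mono) auto
      then have "size (F e h) \<le> (size e + bg (size e) + 3) ^ c"
        using c[of "Node e h"] by simp
      then show ?case
        using Cons by simp
    qed simp
    from this[of zs]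
    have "size (foldr (\<lambda>h. dappend (F e h)) zs Leaf) \<le> length zs * (size e + bg (size e) + 3) ^ c"
      by (simp add: *)
    also have "length zs \<le> bg (size e)"
      using length_dlist[of "g e"] bg(2)[of e] * by simp
    finally show "size (foldr (\<lambda>h. dappend (F e h)) zs Leaf) \<le> ?B (size e)"
      by simp
  qed (intro ptime_const g polybd_intros bg)+
  then show ?thesis by (simp add: dfoldr_def fold dmaps_def)
qed

definition dmap :: "(data \<Rightarrow> data) \<Rightarrow> data \<Rightarrow> data" where
  "dmap f l = enc_list (map f (dlist l))"

lemma dlist_dmap [simp]: "dlist (dmap f l) = map f (dlist l)"
  by (simp add: dmap_def)

lemma ptime_dmap:
  assumes "ptime (\<lambda>p. F (left p) (right p))" and "ptime g"
  shows "ptime (\<lambda>e. dmap (F e) (g e))"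
proof -
  have "ptime (\<lambda>e. dmaps (\<lambda>x. Node (F e x) Leaf) (g e))"
    by (intro ptime_dmaps ptime_Node ptime_const assms)
  then show ?thesis by (simp add: dmaps_def dmap_def)
qed

text \<open>Suffixes serve as names of list positions: they are pairwise distinct even if entries
  repeat, and they still give access to the entry. This replaces counters.\<close>

fun tails :: "data \<Rightarrow> data list" where
  "tails Leaf = []"
| "tails (Node x y) = Node x y # tails y"

definition dtails :: "data \<Rightarrow> data" where
  "dtails x = enc_list (tails x)"

lemma dlist_dtails [simp]: "dlist (dtails x) = tails x"
  by (simp add: dtails_def)

lemma ptime_dtails: assumes "ptime g" shows "ptime (\<lambda>e. dtails (g e))"
proof -
  obtain bg where bg: "polybd bg" "size (g e) \<le> bg (size e)" for e
    using ptime_size[OF assms] by blast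
  \<comment> \<open>\<open>left a\<close> is the suffix that was collected last, or
    \<open>Leaf\<close> by the default of \<open>left\<close> if there is none yet.\<close>
  have fold: "foldr (\<lambda>h a. Node (Node h (left a)) a) xs Leaf = dtails (enc_list xs)" for xs
  proof (induction xs)
    case (Cons x xs)
    then show ?case by (cases xs) (auto simp: dtails_def)
  qed (simp add: dtails_def)
  have size: "size (dtails x) \<le> size x * (size x + 1)" for x
    by (induction x) (auto simp: dtails_def algebra_simps)
  have "ptime (\<lambda>e. dfoldr (\<lambda>h a. Node (Node h (left a)) a) (g e) Leaf)"
  proof (rule ptime_dfoldr[where B = "\<lambda>n. bg n * (bg n + 1)"])
    fix e ys zs
    assume *: "dlist (g e) = ys @ zs"
    have "size (g e) = size (enc_list (ys @ zs))"
      by (simp flip: *)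
    then have "size (enc_list zs) \<le> bg (size e)"
      using bg(2)[of e] by (simp add: size_enc_list)
    then have "size (enc_list zs) * (size (enc_list zs) + 1) \<le> bg (size e) * (bg (size e) + 1)"
      by (intro mult_mono) auto
    then show "size (foldr (\<lambda>h a. Node (Node h (left a)) a) zs Leaf) \<le> bg (size e) * (bg (size e) + 1)"
      using size[of "enc_list zs"] unfolding fold by linarith
  qed (intro ptime_Node ptime_left ptime_right ptime_const ptime_id assms polybd_intros bg)+
  then show ?thesis by (simp add: dfoldr_def fold)
qed

text \<open>Since \<open>right\<close> fixes \<open>Leaf\<close>, the difference is truncated at 0;
  its being \<open>Leaf\<close> will express that a number is within the budget.\<close>

definition dminus :: "data \<Rightarrow> data \<Rightarrow> data" where
  "dminus x y = dfoldr (\<lambda>_. right) y x"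

lemma dminus_enc_nat: "dminus (enc_nat m) (enc_nat n) = enc_nat (m - n)"
proof -
  have "foldr (\<lambda>_. right) (replicate n Leaf) (enc_list (replicate m Leaf)) =
      enc_list (replicate (m - n) Leaf)"
  proof (induction n)
    case (Suc n)
    have "right (enc_list (replicate k Leaf)) = enc_list (replicate (k - 1) Leaf)" for k
      by (cases k) auto
    with Suc show ?case by simp
  qed simp
  then show ?thesis by (simp add: dminus_def dfoldr_def enc_nat_def)
qed

lemma ptime_dminus: assumes "ptime f" "ptime g" shows "ptime (\<lambda>e. dminus (f e) (g e))"
proof -
  obtain bf where bf: "polybd bf" "size (f e) \<le> bf (size e)" for e
    using ptime_size[OF assms(1)] by blast
  have le: "size (foldr (\<lambda>_. right) xs a) \<le> size a" for xs and a :: data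
    by (induction xs) (auto intro: order_trans[OF size_right])
  have "ptime (\<lambda>e. dfoldr (\<lambda>_. right) (g e) (f e))"
    by (rule ptime_dfoldr[where B = bf])
      (auto intro!: ptime_right ptime_id assms bf order_trans[OF le])
  then show ?thesis by (simp add: dminus_def)
qed


section \<open>Predicates decidable in polynomial time\<close>

definition pbool :: "(data \<Rightarrow> bool) \<Rightarrow> bool" where
  "pbool P \<longleftrightarrow> ptime (\<lambda>x. enc_bool (P x))"

lemma enc_bool_eq_Leaf [simp]: "enc_bool b = Leaf \<longleftrightarrow> \<not> b"
  by (simp add: enc_bool_def)

lemma ptime_enc_bool: "pbool P \<Longrightarrow> ptime (\<lambda>x. enc_bool (P x))"
  by (simp add: pbool_def)

lemma ptime_if:
  assumes "pbool P" "ptime f" "ptime g"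
  shows "ptime (\<lambda>x. if P x then f x else g x)"
  using ptime_if_Leaf[OF assms[unfolded pbool_def]]
  by (rule back_subst[of ptime]) auto

lemma pbool_not_Leaf: assumes "ptime f" shows "pbool (\<lambda>x. f x \<noteq> Leaf)"
  using ptime_if_Leaf[OF assms ptime_const[of "enc_bool True"] ptime_const[of "enc_bool False"]]
  unfolding pbool_def by (rule back_subst[of ptime]) (auto simp: enc_bool_def)

lemma pbool_not: assumes "pbool P" shows "pbool (\<lambda>x. \<not> P x)"
  using ptime_if[OF assms ptime_const[of "enc_bool False"] ptime_const[of "enc_bool True"]]
  unfolding pbool_def by (rule back_subst[of ptime]) (auto simp: enc_bool_def)

lemma pbool_conj: assumes "pbool P" "pbool Q" shows "pbool (\<lambda>x. P x \<and> Q x)"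
  using ptime_if[OF assms(1) ptime_enc_bool[OF assms(2)] ptime_const[of "enc_bool False"]]
  unfolding pbool_def by (rule back_subst[of ptime]) (auto simp: enc_bool_def)

lemma pbool_disj: assumes "pbool P" "pbool Q" shows "pbool (\<lambda>x. P x \<or> Q x)"
  using pbool_not[OF pbool_conj[OF pbool_not pbool_not]] assms by simp

text \<open>Equality of trees: the left component lists the pairs that remain to be compared, the right
  one becomes a node at the first mismatch.\<close>

fun eqstep :: "data \<Rightarrow> data" where
  "eqstep (Node (Node (Node Leaf Leaf) todo) d) = Node todo d"
| "eqstep (Node (Node (Node (Node u v) (Node x y)) todo) d) =
    Node (Node (Node u x) (Node (Node v y) todo)) d"
| "eqstep _ = Node Leaf (Node Leaf Leaf)"

lemma ptime_eqstep: "ptime eqstep"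
proof -
  have eq: "eqstep = (\<lambda>x. if left x = Leaf then Node Leaf (Node Leaf Leaf)
      else if left (left x) = Leaf then Node Leaf (Node Leaf Leaf)
      else if left (left (left x)) = Leaf then
        (if right (left (left x)) = Leaf then Node (right (left x)) (right x)
         else Node Leaf (Node Leaf Leaf))
      else if right (left (left x)) = Leaf then Node Leaf (Node Leaf Leaf)
      else Node (Node (Node (left (left (left (left x)))) (left (right (left (left x)))))
        (Node (Node (right (left (left (left x)))) (right (right (left (left x)))))
          (right (left x)))) (right x))" (is "_ = ?f")
  proof
    fix x
    show "eqstep x = ?f x"
      by (cases x rule: eqstep.cases) simp_all
  qed
  show ?thesis
    unfolding eq
    by (intro ptime_if_Leaf ptime_Node ptime_left ptime_right ptime_const ptime_id)
qed

text \<open>A pair with left tree x has weight \<open>size x * 2 + 1\<close>: removing a pair of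
  leaves and splitting a pair of nodes both lower the total weight by exactly 1. Splitting leaves
  the size of the list unchanged, and a mismatch ends the loop at once.\<close>

lemma eqstep_iterate:
  assumes "\<forall>p\<in>set ps. \<exists>x y. p = Node x y"
  shows "\<exists>i \<le> (\<Sum>p\<leftarrow>ps. size (left p) * 2 + 1). left ((eqstep ^^ i) (Node (enc_list ps) Leaf)) = Leaf \<and>
    (right ((eqstep ^^ i) (Node (enc_list ps) Leaf)) = Leaf \<longleftrightarrow> (\<forall>p\<in>set ps. left p = right p)) \<and>
    (\<forall>j<i. left ((eqstep ^^ j) (Node (enc_list ps) Leaf)) \<noteq> Leaf) \<and>
    (\<forall>j\<le>i. size ((eqstep ^^ j) (Node (enc_list ps) Leaf)) \<le> size (enc_list ps) + 2)"
  using assms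
proof (induction "\<Sum>p\<leftarrow>ps. size (left p) * 2 + 1" arbitrary: ps rule: less_induct)
  case less
  show ?case
  proof (cases ps)
    case Nil
    then show ?thesis by (intro exI[of _ 0]) auto
  next
    case (Cons p qs)
    then obtain x y where p: "p = Node x y"
      using less.prems by auto
    let ?s = "Node (enc_list ps) Leaf"
    have lift: ?thesis
      if l: "eqstep ?s = Node (enc_list ps') Leaf" "\<forall>p\<in>set ps'. \<exists>x y. p = Node x y"
        "(\<Sum>p\<leftarrow>ps'. size (left p) * 2 + 1) < (\<Sum>p\<leftarrow>ps. size (left p) * 2 + 1)"
        "size (enc_list ps') \<le> size (enc_list ps)"
        "(\<forall>p\<in>set ps'. left p = right p) \<longleftrightarrow> (\<forall>p\<in>set ps. left p = right p)" for ps'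
    proof -
      obtain i where i: "i \<le> (\<Sum>p\<leftarrow>ps'. size (left p) * 2 + 1)"
        "left ((eqstep ^^ i) (eqstep ?s)) = Leaf"
        "right ((eqstep ^^ i) (eqstep ?s)) = Leaf \<longleftrightarrow> (\<forall>p\<in>set ps. left p = right p)"
        "\<forall>j<i. left ((eqstep ^^ j) (eqstep ?s)) \<noteq> Leaf"
        "\<forall>j\<le>i. size ((eqstep ^^ j) (eqstep ?s)) \<le> size (enc_list ps') + 2"
        using less.hyps[OF l(3,2)] unfolding l(1,5) by blast
      have *: "(eqstep ^^ Suc j) ?s = (eqstep ^^ j) (eqstep ?s)" for j
        by (simp add: funpow_Suc_right del: funpow.simps(2))
      have "left ((eqstep ^^ j) ?s) \<noteq> Leaf" if "j < Suc i" for j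
        using i(4) that * Cons by (cases j) auto
      moreover have "size ((eqstep ^^ j) ?s) \<le> size (enc_list ps) + 2" if "j \<le> Suc i" for j
      proof (cases j)
        case (Suc j')
        then have "size ((eqstep ^^ j) ?s) \<le> size (enc_list ps') + 2"
          using i(5) that * by simp
        then show ?thesis using l(4) by linarith
      qed simp
      ultimately show ?thesis
        using i l(3) * by (intro exI[of _ "Suc i"]) auto
    qed
    have fail: ?thesis if "eqstep ?s = Node Leaf (Node Leaf Leaf)" "x \<noteq> y"
    proof (intro exI[of _ 1] conjI)
      have "0 < size x + size y"
        using that(2) by (cases x; cases y) auto
      then show "\<forall>j\<le>1. size ((eqstep ^^ j) ?s) \<le> size (enc_list ps) + 2"
        using that(1) by (auto simp: Cons p le_Suc_eq)
    qed (use that in \<open>auto simp: Cons p\<close>)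
    consider "x = Leaf" "y = Leaf" | u v u' v' where "x = Node u v" "y = Node u' v'"
      | "x = Leaf \<longleftrightarrow> y \<noteq> Leaf"
      by (cases x; cases y) auto
    then show ?thesis
    proof cases
      case 1
      then show ?thesis
        using less.prems Cons p by (intro lift[of qs]) auto
    next
      case 2
      then show ?thesis
        using less.prems Cons p by (intro lift[of "Node u u' # Node v v' # qs"]) auto
    next
      case 3
      then have "eqstep ?s = Node Leaf (Node Leaf Leaf)"
        using Cons p by (cases x; cases y) auto
      then show ?thesis
        using 3 by (intro fail) auto
    qed
  qed
qed

lemma pbool_eq: assumes "ptime f" "ptime g" shows "pbool (\<lambda>x. f x = g x)"
proof -
  obtain bf where bf: "polybd bf" "size (f e) \<le> bf (size e)" for e
    using ptime_size[OF assms(1)] by blast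
  obtain bg where bg: "polybd bg" "size (g e) \<le> bg (size e)" for e
    using ptime_size[OF assms(2)] by blast
  let ?i = "\<lambda>x. Node (Node (Node (f x) (g x)) Leaf) Leaf"
  \<comment> \<open>\<open>LEAST\<close> turns the final state of the loop into a function of x, as
    \<open>ptime_while\<close> demands; \<open>key\<close> identifies the least index.\<close>
  define F where "F x = (eqstep ^^ (LEAST i. left ((eqstep ^^ i) (?i x)) = Leaf)) (?i x)" for x
  have key: "\<exists>i \<le> 2 * bf (size x) + bg (size x) + 4. F x = (eqstep ^^ i) (?i x) \<and>
      left ((eqstep ^^ i) (?i x)) = Leaf \<and>
      (\<forall>j<i. left ((eqstep ^^ j) (?i x)) \<noteq> Leaf) \<and>
      (\<forall>j\<le>i. size ((eqstep ^^ j) (?i x)) \<le> 2 * bf (size x) + bg (size x) + 4) \<and>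
      (right (F x) = Leaf \<longleftrightarrow> f x = g x)" for x
  proof -
    let ?ps = "[Node (f x) (g x)]"
    have "\<forall>p\<in>set ?ps. \<exists>x y. p = Node x y"
      by simp
    from eqstep_iterate[OF this] obtain i where i: "i \<le> (\<Sum>p\<leftarrow>?ps. size (left p) * 2 + 1)"
      "left ((eqstep ^^ i) (Node (enc_list ?ps) Leaf)) = Leaf"
      "right ((eqstep ^^ i) (Node (enc_list ?ps) Leaf)) = Leaf \<longleftrightarrow> (\<forall>p\<in>set ?ps. left p = right p)"
      "\<forall>j<i. left ((eqstep ^^ j) (Node (enc_list ?ps) Leaf)) \<noteq> Leaf"
      "\<forall>j\<le>i. size ((eqstep ^^ j) (Node (enc_list ?ps) Leaf)) \<le> size (enc_list ?ps) + 2"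
      by blast
    have e: "Node (enc_list ?ps) Leaf = ?i x" by simp
    note i = i[unfolded e]
    have "(LEAST i. left ((eqstep ^^ i) (?i x)) = Leaf) = i"
      using i(2,4) by (intro Least_equality) (blast intro: leI)+
    then have F: "F x = (eqstep ^^ i) (?i x)"
      by (simp only: F_def)
    have le: "size (enc_list ?ps) + 2 \<le> 2 * bf (size x) + bg (size x) + 4"
      using bf(2)[of x] bg(2)[of x] by simp
    show ?thesis
    proof (intro exI[of _ i] conjI)
      show "i \<le> 2 * bf (size x) + bg (size x) + 4"
        using i(1) bf(2)[of x] by simp
      show "\<forall>j\<le>i. size ((eqstep ^^ j) (?i x)) \<le> 2 * bf (size x) + bg (size x) + 4"
        using i(5) le order_trans by blast
      show "right (F x) = Leaf \<longleftrightarrow> f x = g x"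
        unfolding F using i(3) by simp
    qed (fact F i(2,4))+
  qed
  have "ptime F"
  proof (rule ptime_while[where f = eqstep and g = ?i and B = "\<lambda>n. 2 * bf n + bg n + 4"])
    show "ptime eqstep" by (rule ptime_eqstep)
    show "ptime ?i" "polybd (\<lambda>n. 2 * bf n + bg n + 4)"
      by (intro ptime_Node ptime_const assms polybd_intros bf bg)+
  qed (use key in blast)
  then have "pbool (\<lambda>x. \<not> right (F x) \<noteq> Leaf)"
    by (intro pbool_not pbool_not_Leaf ptime_right)
  moreover have "right (F x) = Leaf \<longleftrightarrow> f x = g x" for x
    using key[of x] by blast
  ultimately show ?thesis by (simp add: pbool_def)
qed

lemma pbool_const: "pbool (\<lambda>x. b)"
  by (simp add: pbool_def ptime_const)

text \<open>The fixed graph H enters the programs this way, as a finite table of constants.\<close>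

lemma pbool_finite_mem:
  assumes "finite S" "ptime f"
  shows "pbool (\<lambda>x. f x \<in> S)"
  using assms(1)
  by induction (simp_all add: pbool_const pbool_disj pbool_eq assms ptime_const)

lemmas ptime_intros = ptime_id ptime_const ptime_left ptime_right ptime_Node ptime_if
  ptime_dappend ptime_dmaps ptime_dmap ptime_dtails ptime_dminus ptime_enc_bool
  pbool_conj pbool_disj pbool_not pbool_not_Leaf pbool_eq pbool_const

section \<open>Three vertices none of which separates the other two\<close>

definition avoiding :: "'a graph \<Rightarrow> 'a \<Rightarrow> ('a \<times> 'a) set" where
  "avoiding H y = {(u, v). {u, v} \<in> edges H \<and> u \<noteq> y \<and> v \<noteq> y}"

text \<open>On a path the middle one of any three vertices separates the other two; a triple of this
  kind is the witness against being a path.\<close>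

definition nonseparating :: "'a graph \<Rightarrow> 'a \<Rightarrow> 'a \<Rightarrow> 'a \<Rightarrow> bool" where
  "nonseparating H a b c \<longleftrightarrow> a \<in> verts H \<and> b \<in> verts H \<and> c \<in> verts H \<and>
     a \<noteq> b \<and> a \<noteq> c \<and> b \<noteq> c \<and>
     (a, b) \<in> (avoiding H c)\<^sup>* \<and> (a, c) \<in> (avoiding H b)\<^sup>* \<and> (b, c) \<in> (avoiding H a)\<^sup>*"

lemma avoiding_sym: "(u, v) \<in> (avoiding H y)\<^sup>* \<Longrightarrow> (v, u) \<in> (avoiding H y)\<^sup>*"
proof -
  have "sym (avoiding H y)"
    by (auto simp: sym_def avoiding_def insert_commute)
  then show "(u, v) \<in> (avoiding H y)\<^sup>* \<Longrightarrow> (v, u) \<in> (avoiding H y)\<^sup>*"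
    by (meson sym_rtrancl symD)
qed

lemma path_avoiding:
  assumes "\<And>i. Suc i < length vs \<Longrightarrow> {vs ! i, vs ! Suc i} \<in> edges H" "y \<notin> set vs"
    and "i < length vs" "j < length vs"
  shows "(vs ! i, vs ! j) \<in> (avoiding H y)\<^sup>*"
proof -
  have up: "(vs ! i, vs ! (i + d)) \<in> (avoiding H y)\<^sup>*" if "i + d < length vs" for i d
    using that
  proof (induction d)
    case (Suc d)
    then have "(vs ! (i + d), vs ! (i + Suc d)) \<in> avoiding H y"
      using assms(1)[of "i + d"] assms(2) nth_mem[of "i + d" vs] nth_mem[of "Suc (i + d)" vs]
      by (auto simp: avoiding_def)
    with Suc show ?case by (auto intro: rtrancl_into_rtrancl)
  qed simp
  show ?thesis
  proof (cases "i \<le> j")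
    case True
    then show ?thesis using up[of i "j - i"] assms by simp
  next
    case False
    then show ?thesis using up[of j "i - j"] assms by (auto intro: avoiding_sym)
  qed
qed

lemma path_edges_Cons:
  assumes "distinct (w # vs)" "vs \<noteq> []"
    and "\<And>e. e \<in> E \<longleftrightarrow> (\<exists>i. Suc i < length vs \<and> e = {vs ! i, vs ! Suc i}) \<or> e = {w, hd vs}"
  shows "E = {{(w # vs) ! i, (w # vs) ! Suc i} | i. Suc i < length (w # vs)}"
proof -
  have "e \<in> E \<longleftrightarrow> (\<exists>i. Suc i < length (w # vs) \<and> e = {(w # vs) ! i, (w # vs) ! Suc i})" for e
  proof
    assume "e \<in> E"
    then consider i where "Suc i < length vs" "e = {vs ! i, vs ! Suc i}" | "e = {w, hd vs}"
      using assms(3) by blast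
    then show "\<exists>i. Suc i < length (w # vs) \<and> e = {(w # vs) ! i, (w # vs) ! Suc i}"
    proof cases
      case 1
      then show ?thesis by (intro exI[of _ "Suc i"]) simp
    next
      case 2
      then show ?thesis using assms(2) by (intro exI[of _ 0]) (simp add: hd_conv_nth)
    qed
  next
    assume "\<exists>i. Suc i < length (w # vs) \<and> e = {(w # vs) ! i, (w # vs) ! Suc i}"
    then obtain i where i: "Suc i < length (w # vs)" "e = {(w # vs) ! i, (w # vs) ! Suc i}"
      by blast
    then show "e \<in> E"
      unfolding assms(3) using assms(2) by (cases i) (auto simp: hd_conv_nth)
  qed
  then show ?thesis by blast
qed

definition induced_path :: "'a graph \<Rightarrow> 'a set \<Rightarrow> 'a list \<Rightarrow> bool" where
  "induced_path H S vs \<longleftrightarrow> vs \<noteq> [] \<and> distinct vs \<and> set vs \<subseteq> S \<and>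
     {e \<in> edges H. e \<subseteq> set vs} = {{vs ! i, vs ! Suc i} | i. Suc i < length vs}"

lemma induced_path_rev:
  assumes "induced_path H S vs"
  shows "induced_path H S (rev vs)"
proof -
  define E where "E us = {{us ! i, us ! Suc i} | i. Suc i < length us}" for us :: "'a list"
  have sub: "E (rev us) \<subseteq> E us" for us
  proof
    fix e
    assume "e \<in> E (rev us)"
    then obtain i where i: "Suc i < length us" "e = {rev us ! i, rev us ! Suc i}"
      by (auto simp: E_def)
    define j where "j = length us - Suc (Suc i)"
    have "rev us ! i = us ! Suc j" "rev us ! Suc i = us ! j" "Suc j < length us"
      using i(1) by (simp_all add: j_def rev_nth Suc_diff_Suc)
    then show "e \<in> E us"
      using i(2) by (auto simp: E_def insert_commute)
  qed
  have "E (rev vs) = E vs"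
    using sub[of vs] sub[of "rev vs"] by simp
  then show ?thesis
    using assms by (simp add: induced_path_def E_def)
qed

text \<open>A longest induced path exhausts the component: a further vertex adjacent to it either
  extends it or yields the triple.\<close>

lemma ex_nonseparating:
  assumes H: "simple_graph H" and K: "K \<in> components H" "\<not> path_graph K"
  shows "\<exists>a b c. nonseparating H a b c"
proof (rule ccontr)
  assume no: "\<nexists>a b c. nonseparating H a b c"
  obtain r where r: "r \<in> verts H" and
    K': "K = induced_subgraph H {v \<in> verts H. (r, v) \<in> (adjacency H)\<^sup>*}"
    using K(1) by (auto simp: components_def)
  define S where "S = {v \<in> verts H. (r, v) \<in> (adjacency H)\<^sup>*}"
  have "finite S" "S \<subseteq> verts H"
    using H by (auto simp: S_def simple_graph_def)
  have edge: "u \<in> verts H" "v \<in> verts H" "u \<noteq> v" if "{u, v} \<in> edges H" for u v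
  proof -
    have "{u, v} \<in> {{u, v} | u v. u \<in> verts H \<and> v \<in> verts H \<and> u \<noteq> v}"
      using H that by (auto simp: simple_graph_def)
    then show "u \<in> verts H" "v \<in> verts H" "u \<noteq> v"
      by (auto simp: doubleton_eq_iff)
  qed
  have "induced_path H S [r]"
  proof -
    have "{e \<in> edges H. e \<subseteq> {r}} = {}"
      using H by (auto simp: simple_graph_def)
    then show ?thesis
      using r by (auto simp: induced_path_def S_def)
  qed
  moreover have bound: "length vs \<le> card S" if "induced_path H S vs" for vs
    using that \<open>finite S\<close> unfolding induced_path_def
    by (metis card_mono distinct_card)
  ultimately obtain vs where vs: "induced_path H S vs"
    and max: "\<And>us. induced_path H S us \<Longrightarrow> length us \<le> length vs"
    using ex_has_greatest_nat[of "induced_path H S" "[r]" length "Suc (card S)"]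
    by (auto simp: less_Suc_eq_le)
  have cons: "{vs ! i, vs ! Suc i} \<in> edges H" if "induced_path H S vs" "Suc i < length vs" for i vs
    using that unfolding induced_path_def by blast
  \<comment> \<open>A vertex outside that sees only the head would give a longer induced
    path.\<close>
  have extend: False
    if us: "induced_path H S us" "length us = length vs" and w: "w \<in> S" "w \<notin> set us"
      "{w, hd us} \<in> edges H" "\<And>v. v \<in> set us \<Longrightarrow> {w, v} \<in> edges H \<Longrightarrow> v = hd us" for w us
  proof -
    have us': "us \<noteq> []" "distinct (w # us)" "set (w # us) \<subseteq> S"
      "{e \<in> edges H. e \<subseteq> set us} = {{us ! i, us ! Suc i} | i. Suc i < length us}"
      using us(1) w(1,2) by (auto simp: induced_path_def)
    have "e \<in> {e \<in> edges H. e \<subseteq> set (w # us)} \<longleftrightarrow>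
        e \<in> {e \<in> edges H. e \<subseteq> set us} \<or> e = {w, hd us}" for e
    proof
      assume e: "e \<in> {e \<in> edges H. e \<subseteq> set (w # us)}"
      then obtain x y where xy: "e = {x, y}" "x \<noteq> y"
        using H by (auto simp: simple_graph_def)
      then consider "x = w" "y \<in> set us" | "y = w" "x \<in> set us" | "e \<subseteq> set us"
        using e by auto
      then show "e \<in> {e \<in> edges H. e \<subseteq> set us} \<or> e = {w, hd us}"
        using e xy w(4) by cases (auto simp: insert_commute)
    qed (use w(3) us'(1) in auto)
    then have "{e \<in> edges H. e \<subseteq> set (w # us)} =
        {{(w # us) ! i, (w # us) ! Suc i} | i. Suc i < length (w # us)}"
      unfolding us'(4) using us'(1,2) by (intro path_edges_Cons) auto
    then have "induced_path H S (w # us)"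
      using us' unfolding induced_path_def by blast
    from max[OF this] us(2) show False by simp
  qed
  have vs': "vs \<noteq> []" "distinct vs" "set vs \<subseteq> S"
    using vs by (auto simp: induced_path_def)
  have "set vs \<noteq> S"
    using vs K(2) by (auto simp: K' path_graph_def induced_path_def induced_subgraph_def S_def[symmetric])
  then obtain x where x: "x \<in> S" "x \<notin> set vs"
    using vs'(3) by blast
  have "sym (adjacency H)"
    by (auto simp: sym_def adjacency_def insert_commute)
  moreover have "(r, hd vs) \<in> (adjacency H)\<^sup>*"
    using vs'(3) hd_in_set[OF vs'(1)] by (auto simp: S_def)
  ultimately have "(hd vs, r) \<in> (adjacency H)\<^sup>*"
    by (meson sym_rtrancl symD)
  then have "(hd vs, x) \<in> (adjacency H)\<^sup>*"
    using x(1) by (auto simp: S_def)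
  then have "\<exists>p q. p \<in> set vs \<and> q \<notin> set vs \<and> {p, q} \<in> edges H"
  proof (rule contrapos_pp)
    assume closed: "\<nexists>p q. p \<in> set vs \<and> q \<notin> set vs \<and> {p, q} \<in> edges H"
    have "y \<in> set vs" if "(hd vs, y) \<in> (adjacency H)\<^sup>*" for y
      using that by induction (use closed vs'(1) in \<open>auto simp: adjacency_def\<close>)
    then show "(hd vs, x) \<notin> (adjacency H)\<^sup>*"
      using x(2) by blast
  qed
  then obtain i w where i: "i < length vs" "w \<notin> set vs" "{vs ! i, w} \<in> edges H"
    by (metis in_set_conv_nth)
  have "(r, vs ! i) \<in> (adjacency H)\<^sup>*"
    using vs'(3) nth_mem[OF i(1)] by (auto simp: S_def)
  moreover have "(vs ! i, w) \<in> adjacency H"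
    using i(3) by (simp add: adjacency_def)
  ultimately have "(r, w) \<in> (adjacency H)\<^sup>*"
    by (rule rtrancl_into_rtrancl)
  then have "w \<in> S"
    using edge(2)[OF i(3)] by (simp add: S_def)
  have w: "w \<in> verts H" "{w, vs ! i} \<in> edges H"
    using edge(2)[OF i(3)] i(3) by (auto simp: insert_commute)
  have vsH: "vs ! j \<in> verts H" "vs ! j \<noteq> w" if "j < length vs" for j
  proof -
    have "vs ! j \<in> set vs"
      using that by simp
    then show "vs ! j \<in> verts H" "vs ! j \<noteq> w"
      using vs'(3) \<open>S \<subseteq> verts H\<close> i(2) by blast+
  qed
  have path: "(vs ! j, vs ! k) \<in> (avoiding H w)\<^sup>*" if "j < length vs" "k < length vs" for j k
    using that i(2) by (intro path_avoiding cons[OF vs])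
  \<comment> \<open>If w had two neighbors on the path, these would form a triple with w: the path
    joins them without w, and w is adjacent to both.\<close>
  have unique: "j = i" if j: "j < length vs" "{w, vs ! j} \<in> edges H" for j
  proof (rule ccontr)
    assume "j \<noteq> i"
    then have ne: "vs ! i \<noteq> vs ! j"
      using vs'(2) i(1) j(1) by (simp add: nth_eq_iff_index_eq)
    have "(w, vs ! i) \<in> avoiding H (vs ! j)" "(w, vs ! j) \<in> avoiding H (vs ! i)"
      using w j ne vsH[OF i(1)] vsH[OF j(1)] by (auto simp: avoiding_def)
    then have "nonseparating H w (vs ! i) (vs ! j)"
      unfolding nonseparating_def using path[OF i(1) j(1)] vsH[OF i(1)] vsH[OF j(1)] w(1) ne by auto
    with no show False by blast
  qed
  then have unique': "v = vs ! i" if "v \<in> set vs" "{w, v} \<in> edges H" for v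
    using that by (metis in_set_conv_nth)
  consider "i = 0" | "i = length vs - 1" | "0 < i" "Suc i < length vs"
    using i(1) by linarith
  then show False
  proof cases
    case 1
    have hd: "hd vs = vs ! i"
      using 1 vs'(1) by (simp add: hd_conv_nth)
    show False
    proof (rule extend[OF vs refl \<open>w \<in> S\<close> i(2)])
      show "{w, hd vs} \<in> edges H"
        unfolding hd by (rule w(2))
      show "v = hd vs" if "v \<in> set vs" "{w, v} \<in> edges H" for v
        unfolding hd using that by (rule unique')
    qed
  next
    case 2
    have hd: "hd (rev vs) = vs ! i"
      using 2 vs'(1) by (simp add: hd_rev last_conv_nth)
    show False
    proof (rule extend[OF induced_path_rev[OF vs] length_rev \<open>w \<in> S\<close>])
      show "w \<notin> set (rev vs)"
        using i(2) by simp
      show "{w, hd (rev vs)} \<in> edges H"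
        unfolding hd by (rule w(2))
      show "v = hd (rev vs)" if "v \<in> set (rev vs)" "{w, v} \<in> edges H" for v
        unfolding hd using that unfolding set_rev by (rule unique')
    qed
  next
    \<comment> \<open>The only neighbor is an inner vertex, so w and the two path neighbors of
      \<open>vs ! i\<close> are the leaves of a claw centered there. Through the center, w reaches
      each of the other leaves; these two are joined by the path.\<close>
    case 3
    have j: "i - 1 < length vs" "Suc (i - 1) = i"
      using 3 by auto
    have ne: "vs ! (i - 1) \<noteq> vs ! i" "vs ! Suc i \<noteq> vs ! i" "vs ! (i - 1) \<noteq> vs ! Suc i"
      using vs'(2) 3 by (auto simp: nth_eq_iff_index_eq)
    have e: "{vs ! (i - 1), vs ! i} \<in> edges H" "{vs ! i, vs ! Suc i} \<in> edges H"
      using cons[OF vs, of "i - 1"] cons[OF vs, of i] 3 by auto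
    have e': "{vs ! i, vs ! (i - 1)} \<in> edges H"
      using e(1) by (simp add: insert_commute)
    have steps: "(w, vs ! i) \<in> avoiding H (vs ! Suc i)" "(vs ! i, vs ! (i - 1)) \<in> avoiding H (vs ! Suc i)"
      "(w, vs ! i) \<in> avoiding H (vs ! (i - 1))" "(vs ! i, vs ! Suc i) \<in> avoiding H (vs ! (i - 1))"
      using w(2) e e' ne ne[symmetric] vsH[OF 3(2)] vsH[OF j(1)] by (simp_all add: avoiding_def)
    have "(w, vs ! (i - 1)) \<in> (avoiding H (vs ! Suc i))\<^sup>*"
      "(w, vs ! Suc i) \<in> (avoiding H (vs ! (i - 1)))\<^sup>*"
      by (rule converse_rtrancl_into_rtrancl[OF steps(1) r_into_rtrancl[OF steps(2)]],
          rule converse_rtrancl_into_rtrancl[OF steps(3) r_into_rtrancl[OF steps(4)]])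
    then have "nonseparating H w (vs ! (i - 1)) (vs ! Suc i)"
      unfolding nonseparating_def
      using path[OF j(1) 3(2)] vsH[OF 3(2)] vsH[OF j(1)] w(1) ne ne[symmetric] by simp
    with no show False by blast
  qed
qed

section \<open>Lines as decomposition trees\<close>

definition line_graph :: "nat \<Rightarrow> nat graph" where
  "line_graph m = \<lparr>verts = {..<m}, edges = {{i, Suc i} | i. Suc i < m}\<rparr>"

lemma line_graph_simps [simp]:
  "verts (line_graph m) = {..<m}"
  "{i, j} \<in> edges (line_graph m) \<longleftrightarrow> i < m \<and> j < m \<and> (j = Suc i \<or> i = Suc j)"
  by (auto simp: line_graph_def doubleton_eq_iff)

lemma connected_interval:
  assumes "S \<noteq> {}" "S \<subseteq> {..<m}"
    and convex: "\<And>i j k. i \<in> S \<Longrightarrow> k \<in> S \<Longrightarrow> i \<le> j \<Longrightarrow> j \<le> k \<Longrightarrow> j \<in> S"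
  shows "connected_graph (induced_subgraph (line_graph m) S)"
proof -
  let ?A = "adjacency (induced_subgraph (line_graph m) S)"
  have up: "(i, i + d) \<in> ?A\<^sup>*" if "i \<in> S" "i + d \<in> S" for i d
    using that
  proof (induction d)
    case (Suc d)
    then have "i + d \<in> S"
      using convex[of i "i + Suc d" "i + d"] by simp
    moreover from this Suc.prems have "(i + d, i + Suc d) \<in> ?A"
      using assms(2) by (auto simp: adjacency_def induced_subgraph_def)
    ultimately show ?case
      using Suc by (meson rtrancl_into_rtrancl)
  qed simp
  have "sym ?A"
    by (auto simp: sym_def adjacency_def insert_commute)
  then have "(i, j) \<in> ?A\<^sup>*" if "i \<in> S" "j \<in> S" for i j
    using up[of i "j - i"] up[of j "i - j"] that
    by (cases "i \<le> j") (auto intro: symD[OF sym_rtrancl])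
  then show ?thesis
    using assms(1) by (auto simp: connected_graph_def induced_subgraph_def)
qed

text \<open>Acyclicity: both neighbors of the largest vertex of a cycle would have to be its
  predecessor on the line, but they are distinct.\<close>

lemma tree_line_graph:
  assumes "0 < m"
  shows "tree (line_graph m)"
proof -
  have "simple_graph (line_graph m)"
    by (auto simp: simple_graph_def line_graph_def) (metis Suc_lessD n_not_Suc_n)
  moreover have "induced_subgraph (line_graph m) {..<m} = line_graph m"
    by (auto simp: induced_subgraph_def line_graph_def)
  then have "connected_graph (line_graph m)"
    using connected_interval[of "{..<m}" m] assms by fastforce
  moreover have False if "cycle_in (line_graph m) vs" for vs
  proof -
    let ?l = "length vs"
    have vs: "3 \<le> ?l" "distinct vs"
      and step: "\<And>i. i < ?l \<Longrightarrow> {vs ! i, vs ! (Suc i mod ?l)} \<in> edges (line_graph m)"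
      using that by (auto simp: cycle_in_def)
    have "Max (set vs) \<in> set vs"
      using vs(1) by (intro Max_in) auto
    then obtain i where i: "i < ?l" "vs ! i = Max (set vs)"
      by (metis in_set_conv_nth)
    have le: "vs ! j \<le> vs ! i" if "j < ?l" for j
      using that i(2) by simp
    define p where "p = (if i = 0 then ?l - 1 else i - 1)"
    define s where "s = (if Suc i = ?l then 0 else Suc i)"
    have ps: "p < ?l" "s < ?l" "Suc p mod ?l = i" "Suc i mod ?l = s" "p \<noteq> s"
      using i(1) vs(1) by (auto simp: p_def s_def)
    have "vs ! i = Suc (vs ! p)" "vs ! i = Suc (vs ! s)"
      using step[OF ps(1)] step[OF i(1)] le[OF ps(1)] le[OF ps(2)] unfolding ps(3,4) by auto
    then show False
      using vs(2) ps by (auto simp: nth_eq_iff_index_eq)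
  qed
  ultimately show ?thesis
    unfolding tree_def by blast
qed

text \<open>The blocks \<open>g j\<close> are consecutive and h tells them apart. With the clause as
  h, the bags that contain a given triangle become a contiguous part of the list of keys.\<close>

lemma concat_convex:
  assumes "distinct J" "\<And>j y. j \<in> set J \<Longrightarrow> y \<in> set (g j) \<Longrightarrow> h y = j"
    and "i \<le> k" "k \<le> l" "l < length (concat (map g J))"
    and "h (concat (map g J) ! i) = h (concat (map g J) ! l)"
  shows "h (concat (map g J) ! k) = h (concat (map g J) ! i)"
  using assms
proof (induction J arbitrary: i k l)
  case (Cons j J)
  let ?K = "concat (map g J)"
  have in_j: "h (g j ! i) = j" if "i < length (g j)" for i
    using Cons.prems(2)[of j "g j ! i"] that by simp
  have in_J: "h (?K ! i) \<noteq> j" if "i < length ?K" for i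
  proof -
    have "?K ! i \<in> set ?K"
      using that by (rule nth_mem)
    then obtain j' where "j' \<in> set J" "?K ! i \<in> set (g j')"
      unfolding set_concat set_map by blast
    then show ?thesis
      using Cons.prems(1,2) by auto
  qed
  show ?case
  proof (cases "l < length (g j)")
    case True
    then show ?thesis
      using Cons.prems(3-6) by (simp add: nth_append in_j)
  next
    case False
    then have "l - length (g j) < length ?K"
      using Cons.prems(5) by simp
    then have "\<not> i < length (g j)"
      using Cons.prems(6) False in_j[of i] in_J[of "l - length (g j)"] by (auto simp: nth_append)
    with False show ?thesis
      using Cons.prems Cons.IH[of "i - length (g j)" "k - length (g j)" "l - length (g j)"]
      by (auto simp: nth_append)
  qed
qed simp

text \<open>h reads off from an entry the block it comes from; for vertices and keys it is a
  projection of the name.\<close>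

lemma distinct_concat_map:
  assumes "distinct xs" "\<And>x. x \<in> set xs \<Longrightarrow> distinct (g x)"
    and "\<And>x y. x \<in> set xs \<Longrightarrow> y \<in> set (g x) \<Longrightarrow> h y = x"
  shows "distinct (concat (map g xs))"
  using assms
proof (induction xs)
  case (Cons x xs)
  have "set (g x) \<inter> set (concat (map g xs)) = {}"
  proof -
    have False if "y \<in> set (g x)" "z \<in> set xs" "y \<in> set (g z)" for y z
      using that Cons.prems(1) Cons.prems(3)[of x y] Cons.prems(3)[of z y] by simp
    then show ?thesis by auto
  qed
  then show ?case
    using Cons by simp
qed simp

section \<open>The reduction as a computable function\<close>

text \<open>A vertex is a tree \<open>Node (Node tag payload) color\<close>. A clause is represented by the suffix
  of the list of clauses that starts with it. The key of a private copy of \<open>H\<close> consists of the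
  clause whose bags contain it, the edge that it guards, and a serial number.\<close>

abbreviation (input) tag :: "data \<Rightarrow> data" where "tag v \<equiv> left (left v)"
abbreviation (input) payload :: "data \<Rightarrow> data" where "payload v \<equiv> right (left v)"

abbreviation (input) Lit :: "data \<Rightarrow> data \<Rightarrow> data" where
  "Lit l x \<equiv> Node (Node Leaf l) x"

abbreviation (input) Cls :: "data \<Rightarrow> data \<Rightarrow> data" where
  "Cls j x \<equiv> Node (Node (Node Leaf Leaf) j) x"

abbreviation (input) private_tag :: data where
  "private_tag \<equiv> Node Leaf (Node Leaf Leaf)"

abbreviation (input) Priv :: "data \<Rightarrow> data \<Rightarrow> data" where
  "Priv k x \<equiv> Node (Node private_tag k) x"

abbreviation (input) key :: "data \<Rightarrow> data \<Rightarrow> data \<Rightarrow> data \<Rightarrow> data" where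
  "key j u v r \<equiv> Node j (Node u (Node v r))"

abbreviation (input) fst_end :: "data \<Rightarrow> data" where "fst_end k \<equiv> left (right k)"
abbreviation (input) snd_end :: "data \<Rightarrow> data" where "snd_end k \<equiv> left (right (right k))"

definition dnat :: "data \<Rightarrow> nat" where
  "dnat x = length (dlist x)"

lemma dnat_enc_nat [simp]: "dnat (enc_nat n) = n"
  by (simp add: dnat_def enc_nat_def)

lemma enc_nat_inject [simp]: "enc_nat m = enc_nat n \<longleftrightarrow> m = n"
  by (metis dnat_enc_nat)

text \<open>The suffixes of the unary n are n, ..., 1; their tails n - 1, ..., 0 are the variables
  as they occur in literals.\<close>

definition dvars :: "data \<Rightarrow> data" where
  "dvars D = dmap right (dtails (left D))"

definition clauses :: "data \<Rightarrow> data" where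
  "clauses D = dtails (right D)"

definition dlits :: "data \<Rightarrow> data" where
  "dlits D = dmaps (\<lambda>i. enc_list [Node i (enc_bool False), Node i (enc_bool True)]) (dvars D)"

text \<open>A minimum cover takes 3 vertices of each 6-cycle and 2 of each triangle.\<close>

definition budget :: "data \<Rightarrow> data" where
  "budget D = dappend (dmaps (\<lambda>_. enc_nat 3) (dvars D)) (dmaps (\<lambda>_. enc_nat 2) (right D))"

text \<open>The additional \<open>Leaf\<close> makes the number of serial numbers exceed the budget
  by one.\<close>

definition reps :: "data \<Rightarrow> data" where
  "reps D = dtails (Node Leaf (budget D))"

locale reduction =
  fixes H :: "nat graph" and a b c :: nat
  assumes simple: "simple_graph H" and abc: "nonseparating H a b c"
begin

definition cols :: data where
  "cols = enc_list [enc_nat a, enc_nat b, enc_nat c]"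

definition all_cols :: data where
  "all_cols = enc_list (map enc_nat (sorted_list_of_set (verts H)))"

text \<open>Membership in a finite set of constants, so that \<open>pbool_finite_mem\<close>
  applies.\<close>

definition H_adj :: "data \<Rightarrow> data \<Rightarrow> bool" where
  "H_adj x y \<longleftrightarrow> Node x y \<in> {Node (enc_nat p) (enc_nat q) | p q. {p, q} \<in> edges H}"

text \<open>The literals of a clause go to the colors a, b, c in this order. The value is the suffix
  of the clause that starts at the literal, rather than the literal, so that \<open>Leaf\<close>
  says that the clause is too short.\<close>

definition slot :: "data \<Rightarrow> data \<Rightarrow> data" where
  "slot j x = (if x = enc_nat a then left j else if x = enc_nat b then right (left j)
     else right (right (left j)))"

text \<open>The edges of the vertex cover instance, clause--literal edges in this direction only. An
  empty slot is joined to all literals, both true and false ones, which forces its triangle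
  vertex into every cover within the budget.\<close>

definition conflict :: "data \<Rightarrow> data \<Rightarrow> bool" where
  "conflict u v \<longleftrightarrow> right u \<noteq> right v \<and>
     (tag u = Leaf \<and> tag v = Leaf \<and> left (payload u) = left (payload v) \<and> payload u \<noteq> payload v \<or>
      tag u = Node Leaf Leaf \<and> tag v = Node Leaf Leaf \<and> payload u = payload v \<or>
      tag u = Node Leaf Leaf \<and> tag v = Leaf \<and>
        (slot (payload u) (right u) = Leaf \<or> left (slot (payload u) (right u)) = payload v))"

definition lit_vertices :: "data \<Rightarrow> data" where
  "lit_vertices D = dmaps (\<lambda>l. dmap (\<lambda>x. Lit l x) cols) (dlits D)"

definition triangle :: "data \<Rightarrow> data" where
  "triangle j = dmap (\<lambda>x. Cls j x) cols"

definition interface :: "data \<Rightarrow> data \<Rightarrow> data" where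
  "interface D j = dappend (lit_vertices D) (triangle j)"

text \<open>Every clause guards the literal--literal edges anew. So both ends of a key k lie in
  \<open>interface D (left k)\<close>, and hence in the bag of k, whatever kind of edge it
  guards.\<close>

definition keys :: "data \<Rightarrow> data" where
  "keys D = dmaps (\<lambda>j. dmaps (\<lambda>u. dmaps (\<lambda>v. if conflict u v
     then dmap (\<lambda>r. key j u v r) (reps D) else Leaf) (interface D j)) (interface D j)) (clauses D)"

definition privates :: "data \<Rightarrow> data" where
  "privates k = dmaps (\<lambda>x. if x = right (fst_end k) \<or> x = right (snd_end k) then Leaf
     else Node (Priv k x) Leaf) all_cols"

definition vertices :: "data \<Rightarrow> data" where
  "vertices D = dappend (dappend (lit_vertices D) (dmaps triangle (clauses D)))
     (dmaps privates (keys D))"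

text \<open>Interface vertices are only joined if their colors are adjacent in \<open>H\<close>; otherwise the
  copies of \<open>H\<close> do not need the edge.\<close>

definition half_adj :: "data \<Rightarrow> data \<Rightarrow> bool" where
  "half_adj u v \<longleftrightarrow> H_adj (right u) (right v) \<and>
     (tag u = private_tag \<and> tag v = private_tag \<and> payload u = payload v \<or>
      tag u \<noteq> private_tag \<and> tag v = private_tag \<and>
        (u = fst_end (payload v) \<or> u = snd_end (payload v)) \<or>
      tag u \<noteq> private_tag \<and> tag v \<noteq> private_tag \<and> conflict u v)"

definition adj :: "data \<Rightarrow> data \<Rightarrow> bool" where
  "adj u v \<longleftrightarrow> half_adj u v \<or> half_adj v u"

text \<open>One bag per key, rather than per clause, leaves only a single private copy in each bag;
  this bounds the width.\<close>

definition in_bag :: "data \<Rightarrow> data \<Rightarrow> bool" where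
  "in_bag k v \<longleftrightarrow> tag v = Leaf \<or> tag v = Node Leaf Leaf \<and> payload v = left k \<or>
     tag v = private_tag \<and> payload v = k"

text \<open>The nodes of the path decomposition are represented by the nonempty suffixes of the list
  of keys, the neighbor of a suffix being its tail.\<close>

definition instance_data :: "data \<Rightarrow> data" where
  "instance_data D = enc_list
     [dmap (\<lambda>u. dmap (\<lambda>v. enc_bool (adj u v)) (vertices D)) (vertices D),
      dmap right (vertices D),
      dmap (\<lambda>s. dmap (\<lambda>t. enc_bool (right s = t \<or> right t = s)) (dtails (keys D))) (dtails (keys D)),
      dmap (\<lambda>k. dmap (\<lambda>v. enc_bool (in_bag k v)) (vertices D)) (keys D)]"

section \<open>Basic facts on H, its hitting sets and the colors\<close>

lemma finite_H: "finite (verts H)"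
  using simple by (simp add: simple_graph_def)

lemma H_edge: "{p, q} \<in> edges H \<Longrightarrow> p \<in> verts H \<and> q \<in> verts H \<and> p \<noteq> q"
  using simple unfolding simple_graph_def by (auto simp: doubleton_eq_iff)

lemma finite_H_adj: "finite {Node (enc_nat p) (enc_nat q) | p q. {p, q} \<in> edges H}"
proof (rule finite_subset)
  show "{Node (enc_nat p) (enc_nat q) | p q. {p, q} \<in> edges H}
    \<subseteq> (\<lambda>(p, q). Node (enc_nat p) (enc_nat q)) ` (verts H \<times> verts H)"
    using H_edge by fastforce
qed (simp add: finite_H)

lemma H_adj_enc [simp]: "H_adj (enc_nat p) (enc_nat q) \<longleftrightarrow> {p, q} \<in> edges H"
  by (auto simp: H_adj_def)

lemma H_adj_irrefl: "\<not> H_adj x x"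
  using H_edge by (fastforce simp: H_adj_def)

lemma abc_simps [simp]: "a \<in> verts H" "b \<in> verts H" "c \<in> verts H"
  "a \<noteq> b" "a \<noteq> c" "b \<noteq> c" "b \<noteq> a" "c \<noteq> a" "c \<noteq> b"
  using abc by (auto simp: nonseparating_def)

lemma hitting_set_verts: "hitting_set H G \<sigma> (verts G)"
  unfolding hitting_set_def
proof (intro conjI allI impI)
  fix \<pi>
  assume "colorful_subgraph H G \<sigma> \<pi>"
  \<comment> \<open>Every copy has at least the vertex \<open>\<pi> a\<close> to be hit; the empty
    copy of a graph without vertices could not be hit at all.\<close>
  then have "\<pi> a \<in> verts G \<inter> \<pi> ` verts H"
    using abc_simps(1) by (simp add: colorful_subgraph_def image_subset_iff)
  then show "verts G \<inter> \<pi> ` verts H \<noteq> {}"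
    by blast
qed simp

text \<open>Bounds the size of the output of the hitting algorithm, on which the comparison with the
  budget runs.\<close>

lemma min_hitting_le: "min_hitting H G \<sigma> \<le> card (verts G)"
  unfolding min_hitting_def using hitting_set_verts by (intro Least_le) blast

lemma dlist_cols: "dlist cols = [enc_nat a, enc_nat b, enc_nat c]"
  by (simp add: cols_def)

lemma dlist_all_cols [simp]: "dlist all_cols = map enc_nat (sorted_list_of_set (verts H))"
  by (simp add: all_cols_def)


section \<open>The reduction runs in polynomial time\<close>

lemma pbool_H_adj: "ptime f \<Longrightarrow> ptime g \<Longrightarrow> pbool (\<lambda>e. H_adj (f e) (g e))"
  unfolding H_adj_def by (intro pbool_finite_mem finite_H_adj ptime_Node)

lemma ptime_slot: "ptime f \<Longrightarrow> ptime g \<Longrightarrow> ptime (\<lambda>e. slot (f e) (g e))"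
  unfolding slot_def by (intro ptime_intros)

lemma pbool_conflict: "ptime f \<Longrightarrow> ptime g \<Longrightarrow> pbool (\<lambda>e. conflict (f e) (g e))"
  unfolding conflict_def by (intro ptime_intros ptime_slot)

lemma ptime_dvars: "ptime f \<Longrightarrow> ptime (\<lambda>e. dvars (f e))"
  unfolding dvars_def by (intro ptime_intros)

lemma ptime_clauses: "ptime f \<Longrightarrow> ptime (\<lambda>e. clauses (f e))"
  unfolding clauses_def by (intro ptime_intros)

lemma ptime_dlits: "ptime f \<Longrightarrow> ptime (\<lambda>e. dlits (f e))"
  unfolding dlits_def enc_list.simps by (intro ptime_intros ptime_dvars)

lemma ptime_budget: "ptime f \<Longrightarrow> ptime (\<lambda>e. budget (f e))"
  unfolding budget_def by (intro ptime_intros ptime_dvars)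

lemma ptime_reps: "ptime f \<Longrightarrow> ptime (\<lambda>e. reps (f e))"
  unfolding reps_def by (intro ptime_intros ptime_budget)

lemma ptime_lit_vertices: "ptime f \<Longrightarrow> ptime (\<lambda>e. lit_vertices (f e))"
  unfolding lit_vertices_def by (intro ptime_intros ptime_dlits)

lemma ptime_triangle: "ptime f \<Longrightarrow> ptime (\<lambda>e. triangle (f e))"
  \<comment> \<open>Inside a \<open>dmap\<close> the argument appears as \<open>f (left p)\<close>;
    such goals remain and are compositions of f with a projection.\<close>
  unfolding triangle_def by (intro ptime_intros)
    (erule ptime_comp, intro ptime_intros)+

lemma ptime_interface: "ptime f \<Longrightarrow> ptime g \<Longrightarrow> ptime (\<lambda>e. interface (f e) (g e))"
  unfolding interface_def by (intro ptime_intros ptime_lit_vertices ptime_triangle)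

lemma ptime_keys: "ptime f \<Longrightarrow> ptime (\<lambda>e. keys (f e))"
  unfolding keys_def
  by (intro ptime_intros ptime_clauses ptime_interface ptime_reps pbool_conflict)
    (erule ptime_comp, intro ptime_intros)+

lemma ptime_privates: "ptime f \<Longrightarrow> ptime (\<lambda>e. privates (f e))"
  unfolding privates_def by (intro ptime_intros)
    (erule ptime_comp, intro ptime_intros)+

lemma ptime_vertices: "ptime f \<Longrightarrow> ptime (\<lambda>e. vertices (f e))"
  unfolding vertices_def
  by (intro ptime_intros ptime_lit_vertices ptime_triangle ptime_clauses ptime_keys ptime_privates)

lemma pbool_half_adj: "ptime f \<Longrightarrow> ptime g \<Longrightarrow> pbool (\<lambda>e. half_adj (f e) (g e))"
  unfolding half_adj_def by (intro ptime_intros pbool_H_adj pbool_conflict)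

lemma pbool_adj: "ptime f \<Longrightarrow> ptime g \<Longrightarrow> pbool (\<lambda>e. adj (f e) (g e))"
  unfolding adj_def by (intro ptime_intros pbool_half_adj)

lemma pbool_in_bag: "ptime f \<Longrightarrow> ptime g \<Longrightarrow> pbool (\<lambda>e. in_bag (f e) (g e))"
  unfolding in_bag_def by (intro ptime_intros)

lemma ptime_instance_data: "ptime f \<Longrightarrow> ptime (\<lambda>e. instance_data (f e))"
  unfolding instance_data_def enc_list.simps
  by (intro ptime_intros ptime_vertices ptime_keys pbool_adj pbool_in_bag)
    (erule ptime_comp, intro ptime_intros)+

end

section \<open>Correctness of the reduction\<close>

lemma size_tails: "s \<in> set (tails x) \<Longrightarrow> size s \<le> size x \<and> size (right s) < size x"
  by (induction x rule: tails.induct) auto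

lemma distinct_tails: "distinct (tails x)" "distinct (map right (tails x))"
proof -
  show "distinct (tails x)"
    by (induction x) (auto dest: size_tails)
  show "distinct (map right (tails x))"
    by (induction x) (auto dest!: size_tails)
qed

lemma length_tails [simp]: "length (tails x) = length (dlist x)"
  by (induction x) auto

lemma tails_eq_Nil [simp]: "tails x = [] \<longleftrightarrow> x = Leaf"
  by (cases x) auto

lemma dlist_enc_nat [simp]: "dlist (enc_nat n) = replicate n Leaf"
  by (simp add: enc_nat_def)

lemma concat_map_replicate: "concat (map (\<lambda>_. replicate k x) ys) = replicate (k * length ys) x"
  by (induction ys) (auto simp: replicate_add)

lemma budget_eq: "budget D = enc_nat (3 * length (dlist (dvars D)) + 2 * length (dlist (clauses D)))"
  by (simp add: budget_def dappend_def dlist_dmaps concat_map_replicate enc_nat_def clauses_def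
      replicate_add)

lemma enc_bool_inject [simp]: "enc_bool s = enc_bool t \<longleftrightarrow> s = t"
  by (auto simp: enc_bool_def)

text \<open>Forces equality in every 6-cycle and in every triangle once a cover stays within the
  budget.\<close>

lemma sum_tight:
  fixes f :: "'b \<Rightarrow> nat"
  assumes "finite I" "\<And>i. i \<in> I \<Longrightarrow> k \<le> f i" "sum f I \<le> k * card I" "i \<in> I"
  shows "f i = k"
proof (rule ccontr)
  assume "f i \<noteq> k"
  then have "sum (\<lambda>_. k) I < sum f I"
    using assms by (intro sum_strict_mono_ex1) (auto simp: order_less_le intro!: bexI[of _ i])
  then show False
    using assms(3) by (simp add: mult.commute)
qed

text \<open>The cycle is p, q', r, p', q, r'. A perfect matching of it forces 3 vertices. With
  exactly 3, every edge of either perfect matching has exactly one end in the cover, so the cover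
  alternates around the cycle and is a side.\<close>

lemma six_cycle_cover:
  assumes "p \<or> q'" "p \<or> r'" "q \<or> p'" "q \<or> r'" "r \<or> p'" "r \<or> q'"
  defines "n \<equiv> of_bool p + of_bool q + of_bool r + of_bool p' + of_bool q' + of_bool r' :: nat"
  shows "3 \<le> n"
    and "n = 3 \<Longrightarrow> (q \<longleftrightarrow> p) \<and> (r \<longleftrightarrow> p) \<and> (p' \<longleftrightarrow> \<not> p) \<and> (q' \<longleftrightarrow> \<not> p) \<and> (r' \<longleftrightarrow> \<not> p)"
  using assms by (cases p; cases q; cases r; cases p'; cases q'; cases r'; simp)+

lemma triangle_cover:
  assumes "p \<or> q" "p \<or> r" "q \<or> r"
  defines "n \<equiv> of_bool p + of_bool q + of_bool r :: nat"
  shows "2 \<le> n" and "n = 2 \<Longrightarrow> \<not> p \<or> \<not> q \<or> \<not> r"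
  using assms by (cases p; cases q; cases r; simp)+

text \<open>Correctness refers to a formula only through these properties of its tree; the syntax of
  formulas comes in with \<open>reduction_instance_enc_cnf\<close>.\<close>

locale reduction_instance = reduction +
  fixes D :: data
  assumes vars_nonempty: "left D \<noteq> Leaf" and clauses_nonempty: "right D \<noteq> Leaf"
    and slots: "\<And>j x. j \<in> set (tails (right D)) \<Longrightarrow> x \<in> set (dlist cols) \<Longrightarrow> slot j x \<noteq> Leaf \<Longrightarrow>
      left (slot j x) \<in> set (dlist (dlits D))"
begin

abbreviation "V \<equiv> dlist (vertices D)"
abbreviation "K \<equiv> dlist (keys D)"
abbreviation "J \<equiv> dlist (clauses D)"
abbreviation "X \<equiv> dlist (dvars D)"
abbreviation "I j \<equiv> set (dlist (interface D j))"
abbreviation "C \<equiv> set (dlist cols)"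
abbreviation "B \<equiv> 3 * length X + 2 * length J"

section \<open>The members of the lists of the reduction, and their conflicts\<close>

lemma C_eq: "C = {enc_nat a, enc_nat b, enc_nat c}"
  by (simp add: dlist_cols)

lemma card_C: "card C = 3"
  by (simp add: C_eq)

lemma J_def: "J = tails (right D)"
  by (simp add: clauses_def)

lemma distinct_J: "distinct J"
  by (simp add: J_def distinct_tails)

lemma distinct_X: "distinct X"
  by (simp add: dvars_def distinct_tails)

lemma distinct_reps: "distinct (dlist (reps D))"
  by (simp add: reps_def distinct_tails del: tails.simps)

lemma length_reps: "length (dlist (reps D)) = Suc B"
  by (simp add: reps_def budget_eq)

lemma lits_iff: "l \<in> set (dlist (dlits D)) \<longleftrightarrow> (\<exists>i\<in>set X. \<exists>s. l = Node i (enc_bool s))"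
  by (auto simp: dlits_def dlist_dmaps)

lemma lit_vertices_iff:
  "v \<in> set (dlist (lit_vertices D)) \<longleftrightarrow> (\<exists>i\<in>set X. \<exists>s. \<exists>x\<in>C. v = Lit (Node i (enc_bool s)) x)"
proof -
  have "v \<in> set (dlist (lit_vertices D)) \<longleftrightarrow> (\<exists>l\<in>set (dlist (dlits D)). \<exists>x\<in>C. v = Lit l x)"
    by (auto simp: lit_vertices_def dlist_dmaps)
  then show ?thesis by (simp add: Bex_def lits_iff) blast
qed

lemma triangle_iff: "v \<in> set (dlist (triangle j)) \<longleftrightarrow> (\<exists>x\<in>C. v = Cls j x)"
  by (auto simp: triangle_def)

lemma interface_iff: "v \<in> I j \<longleftrightarrow>
    (\<exists>i\<in>set X. \<exists>s. \<exists>x\<in>C. v = Lit (Node i (enc_bool s)) x) \<or> (\<exists>x\<in>C. v = Cls j x)"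
  by (simp add: interface_def lit_vertices_iff triangle_iff)

lemma keys_iff: "k \<in> set K \<longleftrightarrow>
    (\<exists>j\<in>set J. \<exists>u\<in>I j. \<exists>v\<in>I j. \<exists>r\<in>set (dlist (reps D)). conflict u v \<and> k = key j u v r)"
  by (simp add: keys_def dlist_dmaps if_distrib cong: if_cong) blast

lemma privates_iff: "v \<in> set (dlist (privates k)) \<longleftrightarrow>
    (\<exists>z\<in>verts H. enc_nat z \<noteq> right (fst_end k) \<and> enc_nat z \<noteq> right (snd_end k) \<and>
      v = Priv k (enc_nat z))"
  by (auto simp: privates_def dlist_dmaps finite_H if_distrib cong: if_cong)

lemma vertices_iff: "v \<in> set V \<longleftrightarrow>
    (\<exists>i\<in>set X. \<exists>s. \<exists>x\<in>C. v = Lit (Node i (enc_bool s)) x) \<or>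
    (\<exists>j\<in>set J. \<exists>x\<in>C. v = Cls j x) \<or>
    (\<exists>k\<in>set K. \<exists>z\<in>verts H. enc_nat z \<noteq> right (fst_end k) \<and> enc_nat z \<noteq> right (snd_end k) \<and>
      v = Priv k (enc_nat z))"
proof -
  have "v \<in> set V \<longleftrightarrow> v \<in> set (dlist (lit_vertices D)) \<or>
      (\<exists>j\<in>set J. v \<in> set (dlist (triangle j))) \<or> (\<exists>k\<in>set K. v \<in> set (dlist (privates k)))"
    by (auto simp: vertices_def dlist_dmaps)
  then show ?thesis
    unfolding lit_vertices_iff triangle_iff privates_iff by blast
qed

lemma interface_vertices: "j \<in> set J \<Longrightarrow> v \<in> I j \<Longrightarrow> v \<in> set V"
  unfolding interface_iff vertices_iff by blast

lemma J_nonempty: "J \<noteq> []"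
  using clauses_nonempty by (simp add: J_def)

lemma X_nonempty: "X \<noteq> []"
  using vars_nonempty by (simp add: dvars_def)

lemma conflict_lits [simp]: "conflict (Lit (Node i (enc_bool s)) x) (Lit (Node i' (enc_bool s')) y) \<longleftrightarrow>
    x \<noteq> y \<and> i = i' \<and> s \<noteq> s'"
  by (auto simp: conflict_def)

text \<open>Clause--literal edges are oriented away from the clause, so only the opposite side of
  the same 6-cycle remains.\<close>

lemma conflict_lit_left:
  assumes "conflict (Lit (Node i (enc_bool s)) x) v" "v \<in> I j"
  shows "\<exists>y\<in>C. v = Lit (Node i (enc_bool (\<not> s))) y"
  using assms(2) unfolding interface_iff
proof (elim disjE bexE exE)
  fix i' s' y
  assume "y \<in> C" "v = Lit (Node i' (enc_bool s')) y"
  then show ?thesis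
    using assms(1) by (cases s) auto
qed (use assms(1) in \<open>simp add: conflict_def\<close>)

lemma conflict_clauses [simp]: "conflict (Cls j x) (Cls j' y) \<longleftrightarrow> x \<noteq> y \<and> j = j'"
  by (auto simp: conflict_def)

lemma conflict_clause_lit [simp]:
  "conflict (Cls j x) (Lit l y) \<longleftrightarrow> x \<noteq> y \<and> (slot j x = Leaf \<or> left (slot j x) = l)"
  by (auto simp: conflict_def)

lemma conflict_lit_clause [simp]: "\<not> conflict (Lit l y) (Cls j x)"
  by (auto simp: conflict_def)


subsection \<open>Vertex covers and satisfying assignments\<close>

definition covers :: "data set \<Rightarrow> bool" where
  "covers S \<longleftrightarrow> (\<forall>j\<in>set J. \<forall>u\<in>I j. \<forall>v\<in>I j. conflict u v \<longrightarrow> u \<in> S \<or> v \<in> S)"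

definition slots_satisfiable :: bool where
  "slots_satisfiable \<longleftrightarrow> (\<exists>\<alpha>. \<forall>j\<in>set J. \<exists>x\<in>C. slot j x \<noteq> Leaf \<and>
     (\<exists>i s. left (slot j x) = Node i (enc_bool s) \<and> \<alpha> i = s))"

text \<open>Take the true side of each 6-cycle and, of each triangle, all but the vertex whose color
  \<open>ch j\<close> has a true literal in its slot. The literal ends of the edges at the omitted
  vertex are copies of that literal, which are in the cover.\<close>

lemma cover_of_assignment:
  assumes slots_satisfiable
  shows "\<exists>S. S \<subseteq> set V \<and> card S \<le> B \<and> covers S"
proof -
  obtain \<alpha> ch where ch: "\<And>j. j \<in> set J \<Longrightarrow> ch j \<in> C \<and> slot j (ch j) \<noteq> Leaf \<and>
      (\<exists>i s. left (slot j (ch j)) = Node i (enc_bool s) \<and> \<alpha> i = s)"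
    using assms unfolding slots_satisfiable_def by metis
  define S1 where "S1 = (\<lambda>(i, x). Lit (Node i (enc_bool (\<alpha> i))) x) ` (set X \<times> C)"
  define S2 where "S2 = (\<lambda>(j, x). Cls j x) ` (SIGMA j:set J. C - {ch j})"
  have "card S1 \<le> card (set X \<times> C)"
    unfolding S1_def by (intro card_image_le) auto
  also have "\<dots> = 3 * length X"
    using distinct_X by (simp add: card_cartesian_product distinct_card card_C)
  finally have "card S1 \<le> 3 * length X" .
  moreover have "card S2 \<le> card (SIGMA j:set J. C - {ch j})"
    unfolding S2_def by (intro card_image_le) auto
  then have "card S2 \<le> (\<Sum>j\<in>set J. card (C - {ch j}))"
    by simp
  then have "card S2 \<le> 2 * length J"
    using ch distinct_J by (simp add: card_Diff_singleton distinct_card card_C)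
  moreover have "card (S1 \<union> S2) \<le> card S1 + card S2"
    by (rule card_Un_le)
  ultimately have "card (S1 \<union> S2) \<le> B"
    by linarith
  moreover have "S1 \<union> S2 \<subseteq> set V"
    unfolding S1_def S2_def by (auto simp: vertices_iff)
  moreover have "covers (S1 \<union> S2)"
    unfolding covers_def
  proof (intro ballI impI)
    fix j u v
    assume j: "j \<in> set J" and u: "u \<in> I j" and v: "v \<in> I j" and uv: "conflict u v"
    have S1: "Lit (Node i (enc_bool (\<alpha> i))) x \<in> S1" if "i \<in> set X" "x \<in> C" for i x
      using that by (force simp: S1_def)
    have S2: "Cls j x \<in> S2" if "x \<in> C" "x \<noteq> ch j" for x
      using that j by (force simp: S2_def)
    from u show "u \<in> S1 \<union> S2 \<or> v \<in> S1 \<union> S2"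
      unfolding interface_iff
    proof (elim disjE bexE exE)
      fix i s x
      assume u: "i \<in> set X" "x \<in> C" "u = Lit (Node i (enc_bool s)) x"
      from v uv u obtain y where "y \<in> C" "v = Lit (Node i (enc_bool (\<not> s))) y"
        using conflict_lit_left by blast
      then show ?thesis
        using S1[of i x] S1[of i y] u by (cases "\<alpha> i = s") auto
    next
      fix x
      assume u: "x \<in> C" "u = Cls j x"
      show ?thesis
      proof (cases "x = ch j")
        case True
        from v show ?thesis
          unfolding interface_iff
        proof (elim disjE bexE exE)
          fix i s y
          assume v: "i \<in> set X" "y \<in> C" "v = Lit (Node i (enc_bool s)) y"
          then have "left (slot j x) = Node i (enc_bool s)"
            using uv u True ch[OF j] by simp
          moreover obtain i' s' where "left (slot j (ch j)) = Node i' (enc_bool s')" "\<alpha> i' = s'"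
            using ch[OF j] by blast
          ultimately have "\<alpha> i = s"
            using True by simp
          then show ?thesis using S1 v by blast
        next
          fix y
          assume "y \<in> C" "v = Cls j y"
          then show ?thesis using uv u True S2 by auto
        qed
      qed (use S2 u in blast)
    qed
  qed
  ultimately show ?thesis by blast
qed

text \<open>The budget is the sum of the lower bounds 3 and 2, so every 6-cycle is covered by a
  side, which gives the assignment, and every triangle omits a vertex. The neighbors of this vertex
  must be in the cover, so its literal is true.\<close>

lemma assignment_of_cover:
  assumes S: "finite S" "card S \<le> B" "covers S"
  shows slots_satisfiable
proof -
  define P where "P i s x \<longleftrightarrow> Lit (Node i (enc_bool s)) x \<in> S" for i s x
  define Q where "Q j x \<longleftrightarrow> Cls j x \<in> S" for j x
  define A where "A i = set (filter (\<lambda>v. v \<in> S)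
    (concat (map (\<lambda>x. [Lit (Node i (enc_bool True)) x, Lit (Node i (enc_bool False)) x]) (dlist cols))))" for i
  define T where "T j = set (filter (\<lambda>v. v \<in> S) (map (Cls j) (dlist cols)))" for j
  have cardA: "card (A i) =
      of_bool (P i True (enc_nat a)) + of_bool (P i True (enc_nat b)) + of_bool (P i True (enc_nat c)) +
      of_bool (P i False (enc_nat a)) + of_bool (P i False (enc_nat b)) + of_bool (P i False (enc_nat c))" for i
    unfolding A_def by (subst distinct_card) (simp_all add: P_def dlist_cols)
  have cardT: "card (T j) = of_bool (Q j (enc_nat a)) + of_bool (Q j (enc_nat b)) + of_bool (Q j (enc_nat c))" for j
    unfolding T_def by (subst distinct_card) (simp_all add: Q_def dlist_cols)
  obtain j0 where j0: "j0 \<in> set J"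
    using J_nonempty by fastforce
  have PP: "P i True x \<or> P i False y" if "i \<in> set X" "x \<in> C" "y \<in> C" "x \<noteq> y" for i x y
  proof -
    have "Lit (Node i (enc_bool True)) x \<in> I j0" "Lit (Node i (enc_bool False)) y \<in> I j0"
      using that(1-3) unfolding interface_iff by blast+
    then show ?thesis
      using S(3) j0 that(4) unfolding covers_def P_def by fastforce
  qed
  have QQ: "Q j x \<or> Q j y" if "j \<in> set J" "x \<in> C" "y \<in> C" "x \<noteq> y" for j x y
  proof -
    have "Cls j x \<in> I j" "Cls j y \<in> I j"
      using that(2,3) unfolding interface_iff by blast+
    then show ?thesis
      using S(3) that(1,4) unfolding covers_def Q_def by fastforce
  qed
  have PP': "P i True (enc_nat x) \<or> P i False (enc_nat y)"
    if "i \<in> set X" "x \<in> {a, b, c}" "y \<in> {a, b, c}" "x \<noteq> y" for i x y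
    using PP[of i "enc_nat x" "enc_nat y"] that by (auto simp: C_eq)
  have QQ': "Q j (enc_nat x) \<or> Q j (enc_nat y)"
    if "j \<in> set J" "x \<in> {a, b, c}" "y \<in> {a, b, c}" "x \<noteq> y" for j x y
    using QQ[of j "enc_nat x" "enc_nat y"] that by (auto simp: C_eq)
  have A3: "3 \<le> card (A i)" if "i \<in> set X" for i
    unfolding cardA by (rule six_cycle_cover; rule PP'[OF that]; simp)
  have T2: "2 \<le> card (T j)" if "j \<in> set J" for j
    unfolding cardT by (rule triangle_cover; rule QQ'[OF that]; simp)
  have "(\<Sum>i\<in>set X. card (A i)) + (\<Sum>j\<in>set J. card (T j)) =
      card (\<Union>i\<in>set X. A i) + card (\<Union>j\<in>set J. T j)"
    by (subst (1 2) card_UN_disjoint) (auto simp: A_def T_def)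
  also have "\<dots> = card ((\<Union>i\<in>set X. A i) \<union> (\<Union>j\<in>set J. T j))"
    by (subst card_Un_disjoint) (auto simp: A_def T_def)
  also have "\<dots> \<le> card S"
    using S(1) by (intro card_mono) (auto simp: A_def T_def)
  finally have total: "(\<Sum>i\<in>set X. card (A i)) + (\<Sum>j\<in>set J. card (T j)) \<le> B"
    using S(2) by simp
  have sums: "3 * card (set X) \<le> (\<Sum>i\<in>set X. card (A i))" "2 * card (set J) \<le> (\<Sum>j\<in>set J. card (T j))"
    using sum_bounded_below[of "set X" 3 "\<lambda>i. card (A i)"] A3
      sum_bounded_below[of "set J" 2 "\<lambda>j. card (T j)"] T2 by (simp_all add: mult.commute)
  have cards: "card (set X) = length X" "card (set J) = length J"
    using distinct_X distinct_J by (simp_all add: distinct_card)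
  have A_eq: "card (A i) = 3" if "i \<in> set X" for i
    using A3 total sums cards that by (intro sum_tight[of "set X"]) auto
  have T_eq: "card (T j) = 2" if "j \<in> set J" for j
    using T2 total sums cards that by (intro sum_tight[of "set J"]) auto
  have side: "P i s x \<longleftrightarrow> (s \<longleftrightarrow> P i True (enc_nat a))" if "i \<in> set X" "x \<in> C" for i s x
  proof -
    have "(P i True (enc_nat b) \<longleftrightarrow> P i True (enc_nat a)) \<and> (P i True (enc_nat c) \<longleftrightarrow> P i True (enc_nat a)) \<and>
        (P i False (enc_nat a) \<longleftrightarrow> \<not> P i True (enc_nat a)) \<and>
        (P i False (enc_nat b) \<longleftrightarrow> \<not> P i True (enc_nat a)) \<and>
        (P i False (enc_nat c) \<longleftrightarrow> \<not> P i True (enc_nat a))"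
      by (rule six_cycle_cover(2)[OF _ _ _ _ _ _ A_eq[OF that(1), unfolded cardA]];
          rule PP'[OF that(1)]; simp)
    then show ?thesis
      using that(2) by (cases s) (auto simp: C_eq)
  qed
  have "\<exists>x\<in>C. slot j x \<noteq> Leaf \<and>
      (\<exists>i s. left (slot j x) = Node i (enc_bool s) \<and> P i True (enc_nat a) = s)" if j: "j \<in> set J" for j
  proof -
    obtain x where x: "x \<in> C" "\<not> Q j x"
    proof -
      have "\<not> Q j (enc_nat a) \<or> \<not> Q j (enc_nat b) \<or> \<not> Q j (enc_nat c)"
        by (rule triangle_cover(2)[OF _ _ _ T_eq[OF j, unfolded cardT]]; rule QQ'[OF j]; simp)
      then show thesis
        using that by (auto simp: C_eq)
    qed
    have nbr: "Lit (Node i (enc_bool s)) y \<in> S"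
      if "slot j x = Leaf \<or> left (slot j x) = Node i (enc_bool s)" "i \<in> set X" "y \<in> C" "x \<noteq> y" for i s y
    proof -
      have "Cls j x \<in> I j" "Lit (Node i (enc_bool s)) y \<in> I j"
        using that x(1) unfolding interface_iff by blast+
      then show ?thesis
        using S(3) j x(2) that unfolding covers_def Q_def by fastforce
    qed
    \<comment> \<open>One color y other than x is enough: literal vertices of color y can be
      neighbors of the omitted vertex, and by \<open>side\<close> a single color shows the state of
      the whole 6-cycle.\<close>
    have "enc_nat a \<in> C" "enc_nat b \<in> C" "enc_nat a \<noteq> enc_nat b"
      by (simp_all add: C_eq)
    then obtain y where y: "y \<in> C" "x \<noteq> y"
      by metis
    \<comment> \<open>An empty slot is joined to literals of both signs, and a cover within the
      budget cannot contain both.\<close>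
    have "slot j x \<noteq> Leaf"
    proof
      assume "slot j x = Leaf"
      moreover obtain i where i: "i \<in> set X"
        using X_nonempty by fastforce
      ultimately have "P i True y" "P i False y"
        using nbr y unfolding P_def by blast+
      then show False
        using side[OF i y(1)] by simp
    qed
    moreover from this have "left (slot j x) \<in> set (dlist (dlits D))"
      using j x(1) by (intro slots) (simp_all add: J_def)
    then obtain i s where l: "i \<in> set X" "left (slot j x) = Node i (enc_bool s)"
      unfolding lits_iff by blast
    moreover have "P i s y"
      using nbr l y unfolding P_def by blast
    then have "P i True (enc_nat a) = s"
      using side[OF l(1) y(1)] by blast
    ultimately show ?thesis
      using x(1) by blast
  qed
  then show ?thesis
    unfolding slots_satisfiable_def by (intro exI[of _ "\<lambda>i. P i True (enc_nat a)"] ballI)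
qed


subsection \<open>Colorful copies contain a conflict\<close>

lemma abc_path:
  assumes "x \<in> {a, b, c}" "y \<in> {a, b, c}" "z \<in> {a, b, c}" "x \<noteq> y" "x \<noteq> z" "y \<noteq> z"
  shows "(z, x) \<in> (avoiding H y)\<^sup>*"
proof -
  have p: "(a, b) \<in> (avoiding H c)\<^sup>*" "(a, c) \<in> (avoiding H b)\<^sup>*" "(b, c) \<in> (avoiding H a)\<^sup>*"
    using abc by (auto simp: nonseparating_def)
  then show ?thesis
    using assms p[THEN avoiding_sym] by auto
qed

lemma C_iff: "enc_nat z \<in> C \<longleftrightarrow> z \<in> {a, b, c}"
  by (auto simp: C_eq)

lemma in_C: "x \<in> C \<Longrightarrow> \<exists>z\<in>{a, b, c}. x = enc_nat z"
  by (auto simp: C_eq)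

lemma nonprivate_color: "v \<in> set V \<Longrightarrow> tag v \<noteq> private_tag \<Longrightarrow> right v \<in> C"
  by (auto simp: vertices_iff)

lemma interface_tag: "v \<in> I j \<Longrightarrow> tag v \<noteq> private_tag \<and> right v \<in> C"
  by (auto simp: interface_iff)

lemma private_vertex:
  assumes "v \<in> set V" "tag v = private_tag"
  shows "payload v \<in> set K" "right v \<noteq> right (fst_end (payload v))" "right v \<noteq> right (snd_end (payload v))"
  using assms by (auto simp: vertices_iff)

lemma key_ends:
  assumes "k \<in> set K"
  shows "conflict (fst_end k) (snd_end k)" "right (fst_end k) \<in> C" "right (snd_end k) \<in> C"
    "right (fst_end k) \<noteq> right (snd_end k)"
proof -
  obtain j u v r where "u \<in> I j" "v \<in> I j" "conflict u v" "k = key j u v r"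
    using assms unfolding keys_iff by blast
  then show "conflict (fst_end k) (snd_end k)" "right (fst_end k) \<in> C" "right (snd_end k) \<in> C"
    "right (fst_end k) \<noteq> right (snd_end k)"
    using interface_tag by (auto simp: conflict_def)
qed

lemma adj_sym: "adj u v \<longleftrightarrow> adj v u"
  by (auto simp: adj_def)

lemma adj_cases:
  assumes "adj u v"
  obtains "tag u = private_tag" "tag v = private_tag" "payload u = payload v"
  | "tag u \<noteq> private_tag" "tag v = private_tag" "u = fst_end (payload v) \<or> u = snd_end (payload v)"
  | "tag u = private_tag" "tag v \<noteq> private_tag" "v = fst_end (payload u) \<or> v = snd_end (payload u)"
  | "tag u \<noteq> private_tag" "tag v \<noteq> private_tag" "conflict u v \<or> conflict v u"
  using assms unfolding adj_def half_adj_def by metis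

text \<open>Suppose that a vertex with a color z of the triple is private, with key k. Then the ends
  of k have the other two colors x and y. The walk in H from z to x that avoids y can leave the
  private part of k only at an end of k, and not at the one of color y; so the end of color x lies
  in the copy, and by symmetry so does the other. Otherwise \<open>f a\<close>, \<open>f b\<close>
  and \<open>f c\<close> are the only interface vertices of the copy. Follow the walk from a to b
  that avoids c: either it uses an edge between interface vertices, which is a conflict, or it
  passes from \<open>f a\<close> to \<open>f b\<close> through a private part that has both as its
  ends.\<close>

lemma colorful_conflict:
  assumes f: "\<And>z. z \<in> verts H \<Longrightarrow> f z \<in> set V" "\<And>z. z \<in> verts H \<Longrightarrow> right (f z) = enc_nat z"
    and edge: "\<And>z w. {z, w} \<in> edges H \<Longrightarrow> adj (f z) (f w)"
  shows "\<exists>z\<in>verts H. \<exists>w\<in>verts H. conflict (f z) (f w) \<and> tag (f z) \<noteq> private_tag \<and> tag (f w) \<noteq> private_tag"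
    (is ?found)
proof (cases "\<exists>z\<in>{a, b, c}. tag (f z) = private_tag")
  case True
  then obtain z where z: "z \<in> {a, b, c}" "tag (f z) = private_tag"
    by blast
  define k where "k = payload (f z)"
  have zH: "z \<in> verts H"
    using z(1) by auto
  note pv = private_vertex[OF f(1)[OF zH] z(2), folded k_def, unfolded f(2)[OF zH]]
  note ke = key_ends[OF pv(1)]
  obtain x y where x: "x \<in> {a, b, c}" "right (fst_end k) = enc_nat x"
    and y: "y \<in> {a, b, c}" "right (snd_end k) = enc_nat y"
    using in_C[OF ke(2)] in_C[OF ke(3)] by blast
  have ne: "x \<noteq> y" "x \<noteq> z" "y \<noteq> z"
    using ke(4) pv(2,3) x(2) y(2) by auto
  \<comment> \<open>p is the color of the end to be reached and q the color to be avoided; which of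
    the two ends \<open>f p\<close> is will be decided by its color.\<close>
  have walk: "f p = fst_end k \<or> f p = snd_end k"
    if pq: "{p, q} = {x, y}" for p q
  proof -
    have "(f p = fst_end k \<or> f p = snd_end k) \<or> tag (f w) = private_tag \<and> payload (f w) = k"
      if "(z, w) \<in> (avoiding H q)\<^sup>*" for w
      using that
    proof induction
      case base
      then show ?case using z(2) by (simp add: k_def)
    next
      case (step w w')
      then have e: "{w, w'} \<in> edges H" "w' \<noteq> q"
        by (auto simp: avoiding_def)
      have w': "w' \<in> verts H"
        using H_edge[OF e(1)] by simp
      show ?case
      proof (rule disjE[OF step.IH])
        assume w: "tag (f w) = private_tag \<and> payload (f w) = k"
        from edge[OF e(1)] show ?thesis
        proof (cases rule: adj_cases)
          case 1
          then show ?thesis using w by simp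
        next
          case 3
          then have end_w': "f w' = fst_end k \<or> f w' = snd_end k"
            using w by simp
          then have "w' = x \<or> w' = y"
            using x(2) y(2) f(2)[OF w'] by auto
          then have "w' = p"
            using e(2) pq by (auto simp: doubleton_eq_iff)
          then show ?thesis using end_w' by simp
        qed (use w in auto)
      qed simp
    qed
    moreover have "(z, p) \<in> (avoiding H q)\<^sup>*"
      using pq ne x(1) y(1) z(1) by (intro abc_path) (auto simp: doubleton_eq_iff)
    moreover have "\<not> (tag (f p) = private_tag \<and> payload (f p) = k)"
    proof
      assume p: "tag (f p) = private_tag \<and> payload (f p) = k"
      have pH: "p \<in> verts H" "p = x \<or> p = y"
        using pq x(1) y(1) by (auto simp: doubleton_eq_iff)
      show False
        using private_vertex(2,3)[OF f(1)[OF pH(1)]] p pH(2) x(2) y(2) f(2)[OF pH(1)] by auto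
    qed
    ultimately show ?thesis by blast
  qed
  have xyH: "x \<in> verts H" "y \<in> verts H"
    using x(1) y(1) by auto
  have "f x = fst_end k"
    using walk[of x y] f(2)[OF xyH(1)] y(2) ne(1) by auto
  moreover have "f y = snd_end k"
    using walk[of y x] f(2)[OF xyH(2)] x(2) ne(1) by (auto simp: insert_commute)
  moreover have "tag (fst_end k) \<noteq> private_tag" "tag (snd_end k) \<noteq> private_tag"
    using pv(1) interface_tag unfolding keys_iff by auto
  ultimately show ?found
    using ke(1) xyH by metis
next
  case False
  then have np: "tag (f a) \<noteq> private_tag" "tag (f b) \<noteq> private_tag"
    by auto
  have "?found \<or> w = a \<or> tag (f w) = private_tag \<and>
      (f a = fst_end (payload (f w)) \<or> f a = snd_end (payload (f w)))"
    if "(a, w) \<in> (avoiding H c)\<^sup>*" for w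
    using that
  proof induction
    case (step w w')
    then have e: "{w, w'} \<in> edges H" "w' \<noteq> c"
      by (auto simp: avoiding_def)
    have wH: "w \<in> verts H" "w' \<in> verts H"
      using H_edge[OF e(1)] by auto
    show ?case
    proof (rule disjE[OF step.IH])
      assume "w = a \<or> tag (f w) = private_tag \<and>
        (f a = fst_end (payload (f w)) \<or> f a = snd_end (payload (f w)))"
      then show ?thesis
      proof
        assume w: "w = a"
        from edge[OF e(1)] show ?thesis
        proof (cases rule: adj_cases)
          case 4
          then show ?thesis using wH by blast
        qed (use w np in auto)
      next
        assume w: "tag (f w) = private_tag \<and> (f a = fst_end (payload (f w)) \<or> f a = snd_end (payload (f w)))"
        from edge[OF e(1)] show ?thesis
        proof (cases rule: adj_cases)
          case 1
          then show ?thesis using w by simp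
        next
          case 3
          \<comment> \<open>Interface vertices carry only colors of the triple, and the walk avoids
            c.\<close>
          have "w' = a \<or> w' = b"
            using nonprivate_color[OF f(1)[OF wH(2)] 3(2)] e(2) unfolding f(2)[OF wH(2)] C_iff by auto
          then show ?thesis
          proof
            assume w': "w' = b"
            let ?k = "payload (f w)"
            have "payload (f w) \<in> set K"
              using private_vertex(1)[OF f(1)[OF wH(1)]] w by blast
            note ke = key_ends[OF this]
            have "f a \<noteq> f b"
              using f(2)[of a] f(2)[of b] by auto
            then have "conflict (f a) (f b) \<or> conflict (f b) (f a)"
              using w 3(3) ke(1) unfolding w' by auto
            then show ?thesis
              using np abc_simps(1,2) by blast
          qed simp
        qed (use w in auto)
      qed
    qed simp
  qed simp
  moreover have "(a, b) \<in> (avoiding H c)\<^sup>*"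
    using abc by (simp add: nonseparating_def)
  ultimately show ?found
    using np abc_simps(4) by blast
qed

text \<open>The private vertices of k and its two ends form a copy of H. If the colors of the ends
  are adjacent in H, that edge of the copy is there because the ends are in conflict.\<close>

lemma colorful_copy:
  assumes k: "k \<in> set K"
  shows "\<exists>f. (\<forall>z\<in>verts H. f z \<in> set V \<and> right (f z) = enc_nat z \<and>
      (f z = fst_end k \<or> f z = snd_end k \<or> tag (f z) = private_tag \<and> payload (f z) = k)) \<and>
    (\<forall>z w. {z, w} \<in> edges H \<longrightarrow> adj (f z) (f w))"
proof -
  obtain j u v r where j: "j \<in> set J" and u: "u \<in> I j" and v: "v \<in> I j" and uv: "conflict u v"
    and k_eq: "k = key j u v r"
    using k unfolding keys_iff by blast
  define f where "f z = (if enc_nat z = right u then u else if enc_nat z = right v then v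
    else Priv k (enc_nat z))" for z
  have right: "right (f z) = enc_nat z" for z
    by (simp add: f_def)
  have tags: "tag u \<noteq> private_tag" "tag v \<noteq> private_tag"
    using interface_tag u v by blast+
  have "f z \<in> set V" if "z \<in> verts H" for z
  proof -
    have "Priv k (enc_nat z) \<in> set V" if "enc_nat z \<noteq> right u" "enc_nat z \<noteq> right v"
      unfolding vertices_iff using k that \<open>z \<in> verts H\<close> k_eq by auto
    then show ?thesis
      using interface_vertices[OF j] u v by (simp add: f_def)
  qed
  moreover have "adj (f z) (f w)" if "{z, w} \<in> edges H" for z w
  proof -
    have zw: "z \<noteq> w" "{w, z} \<in> edges H"
      using H_edge[OF that] that by (auto simp: insert_commute)
    have "H_adj (right (f z)) (right (f w))" "H_adj (right (f w)) (right (f z))"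
      unfolding right using that zw(2) by simp_all
    moreover have "f z \<noteq> f w"
      using right[of z] right[of w] zw(1) by auto
    ultimately show ?thesis
      unfolding adj_def half_adj_def using tags uv by (auto simp: f_def k_eq split: if_splits)
  qed
  ultimately show ?thesis
    using right by (intro exI[of _ f]) (auto simp: f_def k_eq)
qed


subsection \<open>The instance\<close>

definition graph :: "nat graph" where
  "graph = \<lparr>verts = {..<length V},
     edges = {{i, j} | i j. i < length V \<and> j < length V \<and> adj (V ! i) (V ! j)}\<rparr>"

definition color :: "nat \<Rightarrow> nat" where
  "color i = dnat (right (V ! i))"

definition bag :: "nat \<Rightarrow> nat set" where
  "bag x = {i. i < length V \<and> in_bag (K ! x) (V ! i)}"

lemma verts_graph [simp]: "verts graph = {..<length V}"
  by (simp add: graph_def)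

lemma edges_graph: "{i, j} \<in> edges graph \<longleftrightarrow> i < length V \<and> j < length V \<and> adj (V ! i) (V ! j)"
  using adj_sym by (auto simp: graph_def doubleton_eq_iff)

lemma color_vertex: "v \<in> set V \<Longrightarrow> \<exists>z\<in>verts H. right v = enc_nat z"
proof -
  have "x \<in> C \<Longrightarrow> \<exists>z\<in>verts H. x = enc_nat z" for x
    using in_C abc_simps(1-3) by blast
  then show "v \<in> set V \<Longrightarrow> \<exists>z\<in>verts H. right v = enc_nat z"
    unfolding vertices_iff by auto
qed

lemma right_vertex: "i < length V \<Longrightarrow> right (V ! i) = enc_nat (color i)"
  using color_vertex[of "V ! i"] by (auto simp: color_def)

lemma distinct_interface: "distinct (dlist (lit_vertices D))" "distinct (dlist (triangle j))"
  "distinct (dlist (interface D j))"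
proof -
  have L: "distinct (dlist (dlits D))"
    unfolding dlits_def dlist_dmaps
    by (rule distinct_concat_map[where h = left]) (use distinct_X in auto)
  show 1: "distinct (dlist (lit_vertices D))"
    unfolding lit_vertices_def dlist_dmaps
    by (rule distinct_concat_map[where h = "\<lambda>v. payload v"])
      (use L in \<open>auto simp: distinct_map inj_on_def dlist_cols\<close>)
  show 2: "distinct (dlist (triangle j))"
    by (simp add: triangle_def dlist_cols)
  show "distinct (dlist (interface D j))"
    using 1 2 by (auto simp: interface_def lit_vertices_iff triangle_iff)
qed

lemma distinct_keys: "distinct K"
  unfolding keys_def dlist_dmaps
proof (rule distinct_concat_map[where h = left])
  fix j
  assume "j \<in> set J"
  show "distinct (concat (map (\<lambda>u. concat (map (\<lambda>v. dlist (if conflict u v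
      then dmap (\<lambda>r. key j u v r) (reps D) else Leaf)) (dlist (interface D j)))) (dlist (interface D j))))"
  proof (rule distinct_concat_map[where h = "\<lambda>k. fst_end k"])
    fix u
    assume "u \<in> I j"
    show "distinct (concat (map (\<lambda>v. dlist (if conflict u v then dmap (\<lambda>r. key j u v r) (reps D)
        else Leaf)) (dlist (interface D j))))"
      by (rule distinct_concat_map[where h = "\<lambda>k. snd_end k"])
        (use distinct_interface distinct_reps in \<open>auto simp: distinct_map inj_on_def split: if_splits\<close>)
  qed (use distinct_interface in \<open>auto split: if_splits\<close>)
qed (use distinct_J in \<open>auto simp: dlist_dmaps split: if_splits\<close>)

lemma distinct_vertices: "distinct V"
proof -
  have "distinct (dlist (privates k))" for k
    unfolding privates_def dlist_dmaps
    by (rule distinct_concat_map[where h = right]) (auto simp: distinct_map inj_on_def split: if_splits)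
  then have "distinct (dlist (dmaps privates (keys D)))"
    unfolding dlist_dmaps
    by (intro distinct_concat_map[where h = "\<lambda>v. payload v"] distinct_keys) (auto simp: privates_iff)
  moreover have "distinct (dlist (dmaps triangle (clauses D)))"
    unfolding dlist_dmaps
    by (intro distinct_concat_map[where h = "\<lambda>v. payload v"] distinct_J distinct_interface)
      (auto simp: triangle_iff)
  ultimately show ?thesis
    unfolding vertices_def using distinct_interface(1)
    by (auto simp: lit_vertices_iff triangle_iff privates_iff dlist_dmaps)
qed

end

section \<open>Positions in lists and in lists of suffixes\<close>

lemma map_conv_nth: "map f xs = map (\<lambda>i. f (xs ! i)) [0..<length xs]"
  by (rule nth_equalityI) auto

lemma right_nth_tails:
  "i < length (dlist x) \<Longrightarrow>
    right (tails x ! i) = (if Suc i < length (dlist x) then tails x ! Suc i else Leaf)"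
proof (induction x arbitrary: i)
  case (Node y z)
  show ?case
  proof (cases i)
    case 0
    then show ?thesis by (cases z) auto
  next
    case (Suc i')
    then show ?thesis using Node by simp
  qed
qed simp

lemma Leaf_notin_tails: "Leaf \<notin> set (tails x)"
  by (induction x) auto

text \<open>Adjacency on the decomposition path can thus be tested on suffixes, without computing
  positions.\<close>

lemma right_tails_eq_iff:
  assumes "i < length (dlist x)" "j < length (dlist x)"
  shows "right (tails x ! i) = tails x ! j \<longleftrightarrow> j = Suc i"
proof -
  have "tails x ! j \<noteq> Leaf"
    using Leaf_notin_tails[of x] nth_mem[of j "tails x"] assms by (metis length_tails)
  then show ?thesis
    using assms distinct_tails(1)[of x] by (auto simp: right_nth_tails nth_eq_iff_index_eq)
qed

lemma length_le_concat_map: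
  "(\<And>x. x \<in> set xs \<Longrightarrow> f x \<noteq> []) \<Longrightarrow> length xs \<le> length (concat (map f xs))"
proof (induction xs)
  case (Cons x xs)
  then have "0 < length (f x)" "length xs \<le> length (concat (map f xs))"
    by auto
  then show ?case
    by (simp del: length_greater_0_conv)
qed simp

section \<open>Hitting sets versus vertex covers\<close>

context reduction_instance
begin

text \<open>An edge at a triangle belongs to the clause of that triangle, a literal--literal edge to
  every clause, and there is one. So each edge is guarded by keys and fits into a bag.\<close>

lemma conflict_interface:
  assumes "u \<in> set V" "v \<in> set V" "tag u \<noteq> private_tag" "tag v \<noteq> private_tag" "conflict u v"
  shows "\<exists>j\<in>set J. u \<in> I j \<and> v \<in> I j"
proof -
  obtain j0 where j0: "j0 \<in> set J"
    using J_nonempty by fastforce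
  have cases: "w \<in> set V \<Longrightarrow> tag w \<noteq> private_tag \<Longrightarrow>
      (\<exists>i\<in>set X. \<exists>s. \<exists>x\<in>C. w = Lit (Node i (enc_bool s)) x) \<or> (\<exists>j\<in>set J. \<exists>x\<in>C. w = Cls j x)" for w
    unfolding vertices_iff by auto
  have "\<exists>j\<in>set J. u \<in> I j \<and> v \<in> I j" if "j \<in> set J" "x \<in> C" "u = Cls j x" for j x
  proof -
    have "u \<in> I j"
      using that unfolding interface_iff by blast
    moreover have "v \<in> I j"
      using cases[OF assms(2,4)]
    proof
      assume "\<exists>j\<in>set J. \<exists>x\<in>C. v = Cls j x"
      then show ?thesis
        using assms(5) that unfolding interface_iff by auto
    qed (auto simp: interface_iff)
    ultimately show ?thesis using that(1) by blast
  qed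
  moreover have "\<exists>j\<in>set J. u \<in> I j \<and> v \<in> I j" if "i \<in> set X" "x \<in> C" "u = Lit (Node i (enc_bool s)) x" for i s x
  proof -
    have "u \<in> I j0"
      using that unfolding interface_iff by blast
    moreover have "v \<in> I j0"
      using cases[OF assms(2,4)]
    proof
      assume "\<exists>j\<in>set J. \<exists>x\<in>C. v = Cls j x"
      then show ?thesis
        using assms(5) that by auto
    qed (auto simp: interface_iff)
    ultimately show ?thesis using j0 by blast
  qed
  ultimately show ?thesis
    using cases[OF assms(1,3)] by blast
qed

text \<open>A triangle already has edges to guard, so every clause has a bag that contains its
  interface.\<close>

lemma key_of_clause:
  assumes "j \<in> set J"
  shows "\<exists>k\<in>set K. left k = j"
proof -
  obtain r where "r \<in> set (dlist (reps D))"
    using length_reps by (cases "dlist (reps D)") auto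
  moreover have "Cls j (enc_nat a) \<in> I j" "Cls j (enc_nat b) \<in> I j"
    unfolding interface_iff by (auto simp: C_eq)
  moreover have "conflict (Cls j (enc_nat a)) (Cls j (enc_nat b))"
    by simp
  ultimately have "key j (Cls j (enc_nat a)) (Cls j (enc_nat b)) r \<in> set K"
    unfolding keys_iff using assms by blast
  then show ?thesis
    by (rule bexI[rotated]) simp
qed

lemma K_nonempty: "K \<noteq> []"
  using key_of_clause J_nonempty by (metis list.set_intros(1) list.exhaust empty_iff empty_set)

lemma inj_on_V: "inj_on (\<lambda>i. V ! i) {..<length V}"
  using distinct_vertices by (auto simp: inj_on_def nth_eq_iff_index_eq)

text \<open>By \<open>colorful_conflict\<close> every copy contains both ends of an edge, and a
  cover contains one of them.\<close>

lemma hitting_of_cover: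
  assumes S: "S \<subseteq> set V" "card S \<le> B" "covers S"
  shows "\<exists>Y. hitting_set H graph color Y \<and> card Y \<le> B"
proof -
  define Y where "Y = {i. i < length V \<and> V ! i \<in> S}"
  have "card Y \<le> card S"
    using S(1) by (intro card_inj_on_le[where f = "\<lambda>i. V ! i"])
      (auto simp: Y_def intro: inj_on_subset[OF inj_on_V] finite_subset)
  moreover have "hitting_set H graph color Y"
    unfolding hitting_set_def
  proof (intro conjI allI impI)
    show "Y \<subseteq> verts graph"
      by (auto simp: Y_def)
    fix \<pi>
    assume \<pi>: "colorful_subgraph H graph color \<pi>"
    then have lt: "\<pi> z < length V" "color (\<pi> z) = z" if "z \<in> verts H" for z
      using that by (auto simp: colorful_subgraph_def)
    have "\<exists>z\<in>verts H. \<exists>w\<in>verts H. conflict (V ! \<pi> z) (V ! \<pi> w) \<and>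
        tag (V ! \<pi> z) \<noteq> private_tag \<and> tag (V ! \<pi> w) \<noteq> private_tag"
    proof (rule colorful_conflict)
      show "V ! \<pi> z \<in> set V" "right (V ! \<pi> z) = enc_nat z" if "z \<in> verts H" for z
        using lt[OF that] right_vertex[of "\<pi> z"] by auto
      show "adj (V ! \<pi> z) (V ! \<pi> w)" if "{z, w} \<in> edges H" for z w
        using \<pi> that edges_graph by (auto simp: colorful_subgraph_def)
    qed
    then obtain z w where zw: "z \<in> verts H" "w \<in> verts H" "conflict (V ! \<pi> z) (V ! \<pi> w)"
      "tag (V ! \<pi> z) \<noteq> private_tag" "tag (V ! \<pi> w) \<noteq> private_tag"
      by blast
    have "V ! \<pi> z \<in> set V" "V ! \<pi> w \<in> set V"
      using lt zw(1,2) by auto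
    then obtain j where "j \<in> set J" "V ! \<pi> z \<in> I j" "V ! \<pi> w \<in> I j"
      using conflict_interface zw(3-5) by blast
    then have "V ! \<pi> z \<in> S \<or> V ! \<pi> w \<in> S"
      using S(3) zw(3) unfolding covers_def by blast
    then show "Y \<inter> \<pi> ` verts H \<noteq> {}"
      using lt zw(1,2) by (auto simp: Y_def)
  qed
  ultimately show ?thesis
    using S(2) by (intro exI[of _ Y]) auto
qed

text \<open>There are more copies of every gadget than vertices in the hitting set, so some copy
  is only hit in its two ends.\<close>

lemma cover_of_hitting:
  assumes Y: "hitting_set H graph color Y" "card Y \<le> B"
  shows "covers ((\<lambda>i. V ! i) ` Y)"
  unfolding covers_def
proof (intro ballI impI, rule ccontr)
  fix j u v
  assume j: "j \<in> set J" and u: "u \<in> I j" and v: "v \<in> I j" and uv: "conflict u v"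
    and "\<not> (u \<in> (\<lambda>i. V ! i) ` Y \<or> v \<in> (\<lambda>i. V ! i) ` Y)"
  then have notin: "V ! i \<noteq> u" "V ! i \<noteq> v" if "i \<in> Y" for i
    using that by auto
  have Yv: "Y \<subseteq> {..<length V}"
    using Y(1) by (simp add: hitting_set_def)
  have "\<exists>i\<in>Y. payload (V ! i) = key j u v r" if r: "r \<in> set (dlist (reps D))" for r
  proof -
    let ?k = "key j u v r"
    have "?k \<in> set K"
      unfolding keys_iff using j u v uv r by blast
    then obtain f where f: "\<And>z. z \<in> verts H \<Longrightarrow> f z \<in> set V" "\<And>z. z \<in> verts H \<Longrightarrow> right (f z) = enc_nat z"
      "\<And>z. z \<in> verts H \<Longrightarrow> f z = u \<or> f z = v \<or> payload (f z) = ?k"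
      "\<And>z w. {z, w} \<in> edges H \<Longrightarrow> adj (f z) (f w)"
      using colorful_copy[of ?k] by fastforce
    have "\<exists>\<pi>. \<forall>z\<in>verts H. \<pi> z < length V \<and> V ! \<pi> z = f z"
      using f(1) by (intro bchoice) (auto simp: in_set_conv_nth)
    then obtain \<pi> where \<pi>: "\<And>z. z \<in> verts H \<Longrightarrow> \<pi> z < length V" "\<And>z. z \<in> verts H \<Longrightarrow> V ! \<pi> z = f z"
      by blast
    have col: "color (\<pi> z) = z" if "z \<in> verts H" for z
      using \<pi>[OF that] f(2)[OF that] by (simp add: color_def)
    have "colorful_subgraph H graph color \<pi>"
      unfolding colorful_subgraph_def
    proof (intro conjI allI impI ballI)
      show "inj_on \<pi> (verts H)"
        using col by (metis inj_onI)
      show "{\<pi> z, \<pi> w} \<in> edges graph" if "{z, w} \<in> edges H" for z w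
        using H_edge[OF that] \<pi> f(4)[OF that] unfolding edges_graph by simp
    qed (use \<pi> col in auto)
    then obtain z where "z \<in> verts H" "\<pi> z \<in> Y"
      using Y(1) unfolding hitting_set_def by blast
    \<comment> \<open>The vertex that is hit is neither u nor v, so it is private to this
      key.\<close>
    then show ?thesis
      using f(3) \<pi>(2) notin by metis
  qed
  \<comment> \<open>The last component of a key is its serial number: copies with different numbers
    need different elements of Y, but there are more numbers than elements.\<close>
  then have "set (dlist (reps D)) \<subseteq> (\<lambda>i. right (right (right (payload (V ! i))))) ` Y"
    by (force simp: image_iff)
  moreover have "finite Y"
    using Yv finite_subset by blast
  ultimately have "card (set (dlist (reps D))) \<le> card Y"
    by (meson card_image_le card_mono finite_imageI order_trans)
  then show False
    using Y(2) distinct_card[OF distinct_reps] length_reps by simp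
qed

lemma satisfiable_iff_min_hitting: "slots_satisfiable \<longleftrightarrow> min_hitting H graph color \<le> B"
proof
  assume slots_satisfiable
  then obtain Y where Y: "hitting_set H graph color Y" "card Y \<le> B"
    using cover_of_assignment hitting_of_cover by blast
  then have "min_hitting H graph color \<le> card Y"
    unfolding min_hitting_def by (intro Least_le) blast
  then show "min_hitting H graph color \<le> B"
    using Y(2) by simp
next
  assume le: "min_hitting H graph color \<le> B"
  have "\<exists>k Y. hitting_set H graph color Y \<and> card Y = k"
    using hitting_set_verts by blast
  from LeastI_ex[OF this] have "\<exists>Y. hitting_set H graph color Y \<and> card Y = min_hitting H graph color"
    unfolding min_hitting_def .
  then obtain Y where Y: "hitting_set H graph color Y" "card Y \<le> B"
    using le by auto
  have "finite Y"
    by (rule finite_subset[of _ "verts graph"]) (use Y(1) in \<open>simp_all add: hitting_set_def\<close>)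
  then have "card ((\<lambda>i. V ! i) ` Y) \<le> B"
    using Y(2) card_image_le order_trans by blast
  then show slots_satisfiable
    using assignment_of_cover cover_of_hitting[OF Y] \<open>finite Y\<close> by blast
qed


subsection \<open>The path decomposition\<close>

abbreviation "path \<equiv> line_graph (length K)"

lemma in_bag_interface:
  assumes "v \<in> I (left k)"
  shows "in_bag k v"
  using assms by (auto simp: interface_iff in_bag_def)

lemma bag_edge:
  assumes u: "u \<in> set V" and v: "v \<in> set V" and "adj u v"
  shows "\<exists>k\<in>set K. in_bag k u \<and> in_bag k v"
proof -
  have ends: "fst_end k \<in> I (left k) \<and> snd_end k \<in> I (left k)" if "k \<in> set K" for k
    using that unfolding keys_iff by auto
  show ?thesis
    using assms(3)
  proof (cases rule: adj_cases)
    case 1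
    then show ?thesis
      using private_vertex(1)[OF u] by (intro bexI[of _ "payload u"]) (auto simp: in_bag_def)
  next
    case 2
    then show ?thesis
      using private_vertex(1)[OF v 2(2)] ends[of "payload v"] in_bag_interface
      by (intro bexI[of _ "payload v"]) (auto simp: in_bag_def)
  next
    case 3
    then show ?thesis
      using private_vertex(1)[OF u 3(1)] ends[of "payload u"] in_bag_interface
      by (intro bexI[of _ "payload u"]) (auto simp: in_bag_def)
  next
    case 4
    then obtain j where j: "j \<in> set J" "u \<in> I j" "v \<in> I j"
      using conflict_interface[OF u v] conflict_interface[OF v u] by blast
    obtain k where "k \<in> set K" "left k = j"
      using key_of_clause[OF j(1)] by blast
    then show ?thesis
      using j in_bag_interface by blast
  qed
qed

text \<open>A literal vertex lies in all bags, a private vertex in one, and a triangle in the bags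
  of its clause, which are consecutive because the keys are listed clause by clause.\<close>

lemma bag_connected:
  assumes "i < length V"
  shows "connected_graph (induced_subgraph path {x \<in> verts path. i \<in> bag x})"
proof (rule connected_interval)
  let ?S = "{x \<in> verts path. i \<in> bag x}"
  let ?v = "V ! i"
  have S: "?S = {x. x < length K \<and> in_bag (K ! x) ?v}"
    using assms by (auto simp: bag_def)
  have v: "?v \<in> set V"
    using assms by simp
  then consider (lit) "tag ?v = Leaf"
    | (clause) j where "j \<in> set J" "tag ?v = Node Leaf Leaf" "payload ?v = j"
    | (priv) "tag ?v = private_tag"
    by (auto simp: vertices_iff)
  note cases = this
  obtain k0 where k0: "k0 \<in> set K"
    using K_nonempty by fastforce
  have "\<exists>k\<in>set K. in_bag k ?v"
    using cases
  proof cases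
    case lit
    then show ?thesis using k0 by (auto simp: in_bag_def)
  next
    case clause
    moreover obtain k where "k \<in> set K" "left k = j"
      using key_of_clause[OF clause(1)] by blast
    ultimately show ?thesis by (intro bexI[of _ k]) (simp_all add: in_bag_def)
  next
    case priv
    then show ?thesis using private_vertex(1)[OF v] by (auto simp: in_bag_def)
  qed
  then show "?S \<noteq> {}"
    unfolding S by (auto simp: in_set_conv_nth)
  show "?S \<subseteq> {..<length K}"
    by auto
  fix x y z
  assume xz: "x \<in> ?S" "z \<in> ?S" "x \<le> y" "y \<le> z"
  then have lt: "x < length K" "y < length K" "z < length K"
    unfolding S by auto
  have "in_bag (K ! y) ?v"
    using cases
  proof cases
    case lit
    then show ?thesis by (simp add: in_bag_def)
  next
    case (clause j)
    then have "left (K ! x) = left (K ! z)" "left (K ! x) = j"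
      using xz unfolding S by (auto simp: in_bag_def)
    moreover define g where "g = (\<lambda>j. dlist (dmaps (\<lambda>u. dmaps (\<lambda>v. if conflict u v
      then dmap (\<lambda>r. key j u v r) (reps D) else Leaf) (interface D j)) (interface D j)))"
    have K: "K = concat (map g J)"
      by (simp only: keys_def dlist_dmaps g_def)
    have "left k = j" if "k \<in> set (g j)" for j k
      using that by (auto simp: g_def dlist_dmaps split: if_splits)
    then have "left (K ! x) = left (K ! z) \<Longrightarrow> left (K ! y) = left (K ! x)"
      using concat_convex[OF distinct_J, of g left x y z] lt(3) xz(3,4) unfolding K by blast
    ultimately have "left (K ! y) = j"
      by simp
    then show ?thesis
      using clause by (simp add: in_bag_def)
  next
    case priv
    then have "K ! x = K ! z"
      using xz unfolding S by (auto simp: in_bag_def)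
    then have "x = z"
      using distinct_keys lt by (simp add: nth_eq_iff_index_eq)
    then show ?thesis
      using xz unfolding S by auto
  qed
  then show "y \<in> ?S"
    unfolding S using lt by simp
qed

text \<open>Each gadget has a private vertex of the third color of the triple. This yields the
  required bound on the number of nodes of the decomposition.\<close>

lemma length_keys_le: "length K \<le> length V"
proof -
  have "dlist (privates k) \<noteq> []" if k: "k \<in> set K" for k
  proof -
    obtain x y where "x \<in> {a, b, c}" "right (fst_end k) = enc_nat x"
      "y \<in> {a, b, c}" "right (snd_end k) = enc_nat y"
      using in_C[OF key_ends(2)[OF k]] in_C[OF key_ends(3)[OF k]] by blast
    moreover obtain z where "z \<in> {a, b, c}" "z \<noteq> x" "z \<noteq> y"
      using abc_simps(4-9) by blast
    ultimately have "Priv k (enc_nat z) \<in> set (dlist (privates k))"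
      unfolding privates_iff by auto
    then show ?thesis by auto
  qed
  then have "length K \<le> length (concat (map (\<lambda>k. dlist (privates k)) K))"
    by (rule length_le_concat_map)
  then show ?thesis
    by (simp add: vertices_def dlist_dmaps)
qed

lemma hitting_input: "hitting_input H graph color path bag"
proof -
  have "\<not> adj v v" for v
    using H_adj_irrefl by (auto simp: adj_def half_adj_def)
  then have "simple_graph graph"
    unfolding simple_graph_def graph_def by auto metis
  moreover have "V \<noteq> []"
    using length_keys_le K_nonempty by auto
  moreover have "coloring H graph color"
    using color_vertex[OF nth_mem] by (force simp: coloring_def color_def)
  moreover have "tree_decomposition graph path bag"
    unfolding tree_decomposition_def
  proof (intro conjI ballI)
    show "tree path"
      using K_nonempty by (intro tree_line_graph) simp
    show "bag x \<subseteq> verts graph" for x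
      by (auto simp: bag_def)
    show "\<exists>x\<in>verts path. e \<subseteq> bag x" if e: "e \<in> edges graph" for e
    proof -
      obtain i j where ij: "e = {i, j}" "i < length V" "j < length V" "adj (V ! i) (V ! j)"
        using e by (auto simp: graph_def)
      then obtain k where "k \<in> set K" "in_bag k (V ! i)" "in_bag k (V ! j)"
        using bag_edge[of "V ! i" "V ! j"] by auto
      then obtain x where "x < length K" "in_bag (K ! x) (V ! i)" "in_bag (K ! x) (V ! j)"
        by (auto simp: in_set_conv_nth)
      then show ?thesis
        using ij by (intro bexI[of _ x]) (auto simp: bag_def)
    qed
    show "connected_graph (induced_subgraph path {x \<in> verts path. i \<in> bag x})"
      if "i \<in> verts graph" for i
      using that bag_connected by simp
  qed
  ultimately show ?thesis
    using length_keys_le by (simp add: hitting_input_def lessThan_empty_iff)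
qed

lemma length_lit_vertices: "length (dlist (lit_vertices D)) = 6 * length X"
  by (simp add: lit_vertices_def dlits_def dlist_dmaps length_concat comp_def dlist_cols
      sum_list_triv)

text \<open>The constant accounts for the triangle of one clause and for one private copy of
  H.\<close>

lemma width_le: "width path bag \<le> 6 * length X + 3 + card (verts H)"
proof -
  have "card (bag x) \<le> 6 * length X + 3 + card (verts H)" if "x < length K" for x
  proof -
    let ?k = "K ! x"
    let ?P = "(\<lambda>z. Priv ?k (enc_nat z)) ` verts H"
    let ?W = "set (dlist (lit_vertices D)) \<union> set (dlist (triangle (left ?k))) \<union> ?P"
    have in_W: "v \<in> ?W" if "v \<in> set V" "in_bag ?k v" for v
    proof -
      have "v \<in> ?P" if "k \<in> set K" "z \<in> verts H" "v = Priv k (enc_nat z)" for k z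
        using that \<open>in_bag ?k v\<close> by (auto simp: in_bag_def)
      moreover have "v \<in> set (dlist (triangle (left ?k)))" if "j \<in> set J" "y \<in> C" "v = Cls j y" for j y
        using that \<open>in_bag ?k v\<close> unfolding triangle_iff by (auto simp: in_bag_def)
      ultimately show ?thesis
        using \<open>v \<in> set V\<close> unfolding vertices_iff Un_iff lit_vertices_iff by blast
    qed
    have "card (bag x) \<le> card ?W"
    proof (intro card_inj_on_le[where f = "\<lambda>i. V ! i"])
      show "inj_on (\<lambda>i. V ! i) (bag x)"
        by (rule inj_on_subset[OF inj_on_V]) (auto simp: bag_def)
      show "(\<lambda>i. V ! i) ` bag x \<subseteq> ?W"
        using in_W by (simp add: bag_def image_subset_iff)
    qed (simp add: finite_H)
    also have "\<dots> \<le> card (set (dlist (lit_vertices D))) + card (set (dlist (triangle (left ?k)))) + card ?P"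
      by (meson add_le_mono1 card_Un_le order_trans)
    also have "\<dots> \<le> 6 * length X + 3 + card (verts H)"
    proof (intro add_mono)
      show "card (set (dlist (lit_vertices D))) \<le> 6 * length X"
        using card_length[of "dlist (lit_vertices D)"] by (simp add: length_lit_vertices)
      show "card (set (dlist (triangle (left ?k)))) \<le> 3"
        using card_length[of "dlist (triangle (left ?k))"] by (simp add: triangle_def dlist_cols)
    qed (simp add: card_image_le finite_H)
    finally show ?thesis .
  qed
  then have "Max ((\<lambda>x. card (bag x)) ` verts path) \<le> 6 * length X + 3 + card (verts H)"
    using K_nonempty by (subst Max_le_iff) auto
  then show ?thesis
    by (simp add: width_def)
qed

text \<open>Vertices and nodes are numbered in the order of \<open>vertices D\<close> and
  \<open>keys D\<close>, so nested maps over these lists produce the matrices entry by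
  entry.\<close>

lemma enc_instance_eq: "enc_instance graph color path bag = instance_data D"
proof -
  have "enc_graph graph = dmap (\<lambda>u. dmap (\<lambda>v. enc_bool (adj u v)) (vertices D)) (vertices D)"
    unfolding enc_graph_def enc_set_def dmap_def
    by (simp add: Let_def map_conv_nth[of _ V] edges_graph)
      (intro arg_cong[of _ _ enc_list] map_cong refl; simp)+
  moreover have "enc_list (map (\<lambda>v. enc_nat (color v)) [0..<length V]) = dmap right (vertices D)"
    unfolding dmap_def map_conv_nth[of right V]
    by (intro arg_cong[of _ _ enc_list] map_cong) (simp_all add: right_vertex)
  moreover have "enc_graph path =
      dmap (\<lambda>s. dmap (\<lambda>t. enc_bool (right s = t \<or> right t = s)) (dtails (keys D))) (dtails (keys D))"
    unfolding enc_graph_def enc_set_def dmap_def dlist_dtails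
    by (simp add: Let_def map_conv_nth[of _ "tails (keys D)"])
      (intro arg_cong[of _ _ enc_list] map_cong refl; simp add: right_tails_eq_iff)+
  moreover have "enc_list (map (\<lambda>x. enc_set (length V) (bag x)) [0..<length K]) =
      dmap (\<lambda>k. dmap (\<lambda>v. enc_bool (in_bag k v)) (vertices D)) (keys D)"
    unfolding enc_set_def dmap_def
    by (simp add: map_conv_nth[of _ V] map_conv_nth[of _ K] bag_def)
      (intro arg_cong[of _ _ enc_list] map_cong refl; simp)+
  ultimately show ?thesis
    by (simp add: enc_instance_def instance_data_def)
qed

end

section \<open>From formulas to running times\<close>

lemma enc_nat_Suc: "enc_nat (Suc n) = Node Leaf (enc_nat n)"
  by (simp add: enc_nat_def)

lemma size_enc_nat [simp]: "size (enc_nat n) = n"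
  by (induction n) (simp_all add: enc_nat_Suc, simp add: enc_nat_def)

lemma set_right_tails_enc_nat: "right ` set (tails (enc_nat n)) = enc_nat ` {..<n}"
proof (induction n)
  case (Suc n)
  then show ?case by (simp add: enc_nat_Suc lessThan_Suc)
qed (simp add: enc_nat_def)

lemma left_tails: "left ` set (tails x) = set (dlist x)"
  by (induction x) auto

text \<open>The unit clause on a new variable makes sure that there is a variable and a clause; without
  clauses the decomposition would have no nodes.\<close>

definition add_unit :: "data \<Rightarrow> data" where
  "add_unit D = Node (Node Leaf (left D)) (Node (Node (Node (left D) (enc_bool True)) Leaf) (right D))"

lemma add_unit_enc_cnf: "add_unit (enc_cnf n \<phi>) = enc_cnf (Suc n) ([(n, True)] # \<phi>)"
  by (simp add: add_unit_def enc_cnf_def enc_literal_def enc_nat_Suc)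

lemma ptime_add_unit: "ptime f \<Longrightarrow> ptime (\<lambda>e. add_unit (f e))"
  unfolding add_unit_def by (intro ptime_intros)

lemma satisfiable_add_unit:
  assumes "cnf3 n \<phi>"
  shows "satisfiable ([(n, True)] # \<phi>) \<longleftrightarrow> satisfiable \<phi>"
proof
  assume "satisfiable \<phi>"
  then obtain \<alpha> where \<alpha>: "\<forall>C\<in>set \<phi>. \<exists>(i, b)\<in>set C. \<alpha> i = b"
    unfolding satisfiable_def by blast
  have "\<exists>l\<in>set C. (\<alpha>(n := True)) (fst l) = snd l" if C: "C \<in> set \<phi>" for C
  proof -
    obtain l where l: "l \<in> set C" "\<alpha> (fst l) = snd l"
      using \<alpha> C by (auto simp: case_prod_unfold)
    then have "fst l < n"
      using assms C by (auto simp: cnf3_def case_prod_unfold)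
    then show ?thesis
      using l by (intro bexI[of _ l]) auto
  qed
  then have "\<forall>C\<in>set ([(n, True)] # \<phi>). \<exists>(i, b)\<in>set C. (\<alpha>(n := True)) i = b"
    by (simp add: case_prod_unfold)
  then show "satisfiable ([(n, True)] # \<phi>)"
    unfolding satisfiable_def by blast
qed (auto simp: satisfiable_def)

context reduction
begin

text \<open>Three slots exhaust a clause of length at most 3. P is left abstract to serve twice: for
  tracing the content of a slot back to a literal of the clause, and for truth under an
  assignment.\<close>

lemma ex_slot:
  assumes "left j = enc_list (map f cl)" "length cl \<le> 3"
  shows "(\<exists>x\<in>set (dlist cols). slot j x \<noteq> Leaf \<and> P (left (slot j x))) \<longleftrightarrow> (\<exists>l\<in>set cl. P (f l))"
proof -
  consider "cl = []" | p where "cl = [p]" | p q where "cl = [p, q]" | p q r where "cl = [p, q, r]"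
    using assms(2) by (auto simp: numeral_3_eq_3 le_Suc_eq length_Suc_conv)
  then show ?thesis
    by cases (use assms(1) in \<open>auto simp: slot_def dlist_cols\<close>)
qed

lemma reduction_instance_enc_cnf:
  assumes "cnf3 n \<phi>" "\<phi> \<noteq> []" "0 < n"
  shows "reduction_instance H a b c (enc_cnf n \<phi>)"
    and "length (dlist (dvars (enc_cnf n \<phi>))) = n"
    and "reduction_instance.slots_satisfiable a b c (enc_cnf n \<phi>) \<longleftrightarrow> satisfiable \<phi>"
proof -
  let ?D = "enc_cnf n \<phi>"
  have vars: "set (dlist (dvars ?D)) = enc_nat ` {..<n}"
    by (simp add: dvars_def enc_cnf_def set_right_tails_enc_nat)
  have lits: "set (dlist (dlits ?D)) = {Node (enc_nat i) (enc_bool s) | i s. i < n}"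
    unfolding dlits_def dlist_dmaps using vars by (auto simp: enc_bool_def) (metis+)?
  have clause: "\<exists>cl\<in>set \<phi>. left j = enc_list (map enc_literal cl)" if "j \<in> set (tails (right ?D))" for j
  proof -
    have "left j \<in> left ` set (tails (right ?D))"
      using that by blast
    then show ?thesis
      unfolding left_tails by (auto simp: enc_cnf_def)
  qed
  have clause': "\<exists>j\<in>set (tails (right ?D)). left j = enc_list (map enc_literal cl)" if "cl \<in> set \<phi>" for cl
  proof -
    have "enc_list (map enc_literal cl) \<in> left ` set (tails (right ?D))"
      unfolding left_tails using that by (auto simp: enc_cnf_def)
    then show ?thesis by auto
  qed
  have cl3: "length cl \<le> 3" if "cl \<in> set \<phi>" for cl
    using assms(1) that by (auto simp: cnf3_def)
  show inst: "reduction_instance H a b c ?D"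
  proof
    show "left ?D \<noteq> Leaf" "right ?D \<noteq> Leaf"
      using assms(2,3) by (cases n; cases \<phi>; simp add: enc_cnf_def enc_nat_Suc)+
    show "left (slot j x) \<in> set (dlist (dlits ?D))"
      if j: "j \<in> set (tails (right ?D))" "x \<in> set (dlist cols)" "slot j x \<noteq> Leaf" for j x
    proof -
      obtain cl where cl: "cl \<in> set \<phi>" "left j = enc_list (map enc_literal cl)"
        using clause[OF j(1)] by blast
      obtain l where l: "l \<in> set cl" "left (slot j x) = enc_literal l"
        using ex_slot[OF cl(2) cl3[OF cl(1)], of "\<lambda>y. y = left (slot j x)"] j(2,3) by auto
      have "fst l < n"
        using assms(1) cl(1) l(1) by (fastforce simp: cnf3_def)
      then show ?thesis
        unfolding l(2) lits enc_literal_def by blast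
    qed
  qed
  interpret reduction_instance H a b c ?D
    by (rule inst)
  show "length X = n"
    by (simp add: dvars_def enc_cnf_def)
  have "slots_satisfiable \<longleftrightarrow> (\<exists>\<alpha>. \<forall>cl\<in>set \<phi>. \<exists>l\<in>set cl. \<alpha> (enc_nat (fst l)) = snd l)"
  proof -
    have "(\<forall>j\<in>set J. \<exists>x\<in>C. slot j x \<noteq> Leaf \<and> (\<exists>i s. left (slot j x) = Node i (enc_bool s) \<and> \<alpha> i = s)) \<longleftrightarrow>
        (\<forall>cl\<in>set \<phi>. \<exists>l\<in>set cl. \<alpha> (enc_nat (fst l)) = snd l)" for \<alpha>
    proof -
      define P where "P y \<longleftrightarrow> (\<exists>i s. y = Node i (enc_bool s) \<and> \<alpha> i = s)" for y
      have P: "P (enc_literal l) \<longleftrightarrow> \<alpha> (enc_nat (fst l)) = snd l" for l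
        by (auto simp: P_def enc_literal_def)
      have slot_P: "(\<exists>x\<in>C. slot j x \<noteq> Leaf \<and> P (left (slot j x))) \<longleftrightarrow>
          (\<exists>l\<in>set cl. \<alpha> (enc_nat (fst l)) = snd l)"
        if "cl \<in> set \<phi>" "left j = enc_list (map enc_literal cl)" for cl j
        using ex_slot[OF that(2) cl3[OF that(1)], of P] unfolding P .
      show ?thesis
        unfolding J_def P_def[symmetric]
      proof (intro iffI ballI)
        fix cl
        assume *: "\<forall>j\<in>set (tails (right ?D)). \<exists>x\<in>C. slot j x \<noteq> Leaf \<and> P (left (slot j x))"
          and cl: "cl \<in> set \<phi>"
        obtain j where "j \<in> set (tails (right ?D))" "left j = enc_list (map enc_literal cl)"
          using clause'[OF cl] by blast
        with * show "\<exists>l\<in>set cl. \<alpha> (enc_nat (fst l)) = snd l"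
          using slot_P[OF cl, of j] by blast
      next
        fix j
        assume *: "\<forall>cl\<in>set \<phi>. \<exists>l\<in>set cl. \<alpha> (enc_nat (fst l)) = snd l"
          and j: "j \<in> set (tails (right ?D))"
        obtain cl where "cl \<in> set \<phi>" "left j = enc_list (map enc_literal cl)"
          using clause[OF j] by blast
        with * show "\<exists>x\<in>C. slot j x \<noteq> Leaf \<and> P (left (slot j x))"
          using slot_P[of cl j] by blast
      qed
    qed
    then show ?thesis
      unfolding slots_satisfiable_def by simp
  qed
  also have "\<dots> \<longleftrightarrow> (\<exists>\<alpha>. \<forall>cl\<in>set \<phi>. \<exists>l\<in>set cl. \<alpha> (fst l) = snd l)"
  proof
    assume "\<exists>\<alpha>. \<forall>cl\<in>set \<phi>. \<exists>l\<in>set cl. \<alpha> (enc_nat (fst l)) = snd l"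
    then obtain \<alpha> where "\<forall>cl\<in>set \<phi>. \<exists>l\<in>set cl. \<alpha> (enc_nat (fst l)) = snd l" ..
    then show "\<exists>\<alpha>. \<forall>cl\<in>set \<phi>. \<exists>l\<in>set cl. \<alpha> (fst l) = snd l"
      by (rule exI[of _ "\<lambda>i. \<alpha> (enc_nat i)"])
  next
    assume "\<exists>\<alpha>. \<forall>cl\<in>set \<phi>. \<exists>l\<in>set cl. \<alpha> (fst l) = snd l"
    then obtain \<alpha> where "\<forall>cl\<in>set \<phi>. \<exists>l\<in>set cl. \<alpha> (fst l) = snd l" ..
    then show "\<exists>\<alpha>. \<forall>cl\<in>set \<phi>. \<exists>l\<in>set cl. \<alpha> (enc_nat (fst l)) = snd l"
      by (intro exI[of _ "\<lambda>d. \<alpha> (dnat d)"]) simp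
  qed
  also have "\<dots> \<longleftrightarrow> satisfiable \<phi>"
    by (simp add: satisfiable_def case_prod_unfold)
  finally show "slots_satisfiable \<longleftrightarrow> satisfiable \<phi>" .
qed

end

text \<open>Clauses are not repeated, so there are at most as many as lists of length at most 3 over
  \<open>2 * n\<close> literals; the last factor of the bound covers a single clause.\<close>

lemma size_enc_cnf_le: "\<exists>b. polybd b \<and> (\<forall>n \<phi>. cnf3 n \<phi> \<longrightarrow> size (enc_cnf n \<phi>) \<le> b n)"
proof (intro exI conjI allI impI)
  show "polybd (\<lambda>n. n + 1 + (1 + 2 * n + (2 * n) ^ 2 + (2 * n) ^ 3) * (3 * (n + 3) + 1))"
    by (intro polybd_intros)
  fix n \<phi>
  assume \<phi>: "cnf3 n \<phi>"
  let ?A = "{..<n} \<times> (UNIV :: bool set)"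
  have lit: "size (enc_literal l) \<le> n + 2" if "fst l < n" for l
    using that by (auto simp: enc_literal_def enc_bool_def)
  have clause: "size (enc_list (map enc_literal cl)) + 1 \<le> 3 * (n + 3) + 1" if "cl \<in> set \<phi>" for cl
  proof -
    have cl: "length cl \<le> 3" "\<And>l. l \<in> set cl \<Longrightarrow> fst l < n"
      using \<phi> that by (fastforce simp: cnf3_def)+
    have "size (enc_list (map enc_literal cl)) = (\<Sum>l\<leftarrow>cl. size (enc_literal l) + 1)"
      by (simp add: size_enc_list comp_def)
    also have "\<dots> \<le> (\<Sum>l\<leftarrow>cl. n + 3)"
      using lit cl(2) by (intro sum_list_mono) fastforce
    also have "\<dots> \<le> 3 * (n + 3)"
      using mult_right_mono[OF cl(1), of "n + 3"] by (simp add: sum_list_triv)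
    finally show ?thesis by simp
  qed
  have "size (enc_list (map (\<lambda>C. enc_list (map enc_literal C)) \<phi>)) =
      (\<Sum>cl\<leftarrow>\<phi>. size (enc_list (map enc_literal cl)) + 1)"
    by (simp add: size_enc_list comp_def)
  also have "\<dots> \<le> (\<Sum>cl\<leftarrow>\<phi>. 3 * (n + 3) + 1)"
    using clause by (intro sum_list_mono) blast
  also have "\<dots> = length \<phi> * (3 * (n + 3) + 1)"
    by (simp add: sum_list_triv)
  also have "length \<phi> = card (set \<phi>)"
    using \<phi> by (simp add: cnf3_def distinct_card)
  also have "\<dots> \<le> card {cl. set cl \<subseteq> ?A \<and> length cl \<le> 3}"
    using \<phi> by (intro card_mono finite_lists_length_le) (fastforce simp: cnf3_def)+
  also have "\<dots> = 1 + 2 * n + (2 * n) ^ 2 + (2 * n) ^ 3"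
    by (subst card_lists_length_le) (simp_all add: numeral_3_eq_3 numeral_2_eq_2 mult.commute)
  finally show "size (enc_cnf n \<phi>) \<le> n + 1 + (1 + 2 * n + (2 * n) ^ 2 + (2 * n) ^ 3) * (3 * (n + 3) + 1)"
    by (simp add: enc_cnf_def)
qed


subsection \<open>Calling a given program\<close>

fun expr_bound :: "expr \<Rightarrow> nat" where
  "expr_bound (Var i) = Suc i"
| "expr_bound (Const d) = 0"
| "expr_bound (Pair e f) = max (expr_bound e) (expr_bound f)"
| "expr_bound (Left e) = expr_bound e"
| "expr_bound (Right e) = expr_bound e"

fun prog_bound :: "prog \<Rightarrow> nat" where
  "prog_bound Skip = 0"
| "prog_bound (Assign i e) = max (Suc i) (expr_bound e)"
| "prog_bound (Seq p q) = max (prog_bound p) (prog_bound q)"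
| "prog_bound (If e p q) = max (expr_bound e) (max (prog_bound p) (prog_bound q))"
| "prog_bound (While e p) = max (expr_bound e) (prog_bound p)"

lemma eval_expr_fresh: "expr_bound e \<le> v \<Longrightarrow> eval_expr e (s(v := d)) = eval_expr e s"
  by (induction e) auto

text \<open>The given program does not follow the stack discipline, so a value that has to survive
  its run is kept in a variable beyond all those it mentions.\<close>

lemma exec_fresh: "exec p s n s' \<Longrightarrow> prog_bound p \<le> v \<Longrightarrow> exec p (s(v := d)) n (s'(v := d))"
proof (induction rule: exec.induct)
  case (Assign i e s)
  then have "i \<noteq> v" and ev: "eval_expr e (s(v := d)) = eval_expr e s"
    by (auto intro: eval_expr_fresh)
  then have "s(v := d, i := eval_expr e s) = s(i := eval_expr e s, v := d)"
    by (intro fun_upd_twist) simp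
  then show ?case
    using exec.Assign[of i e "s(v := d)"] unfolding ev by (simp only:)
next
  case (IfTrue e s p n s' q)
  have "eval_expr e (s(v := d)) = eval_expr e s"
    using IfTrue.prems by (intro eval_expr_fresh) simp
  then show ?case
    using IfTrue.hyps(1) IfTrue.prems by (intro exec.IfTrue IfTrue.IH) (simp_all del: fun_upd_apply)
next
  case (IfFalse e s q n s' p)
  have "eval_expr e (s(v := d)) = eval_expr e s"
    using IfFalse.prems by (intro eval_expr_fresh) simp
  then show ?case
    using IfFalse.hyps(1) IfFalse.prems by (intro exec.IfFalse IfFalse.IH) (simp_all del: fun_upd_apply)
next
  case (WhileFalse e s p)
  have "eval_expr e (s(v := d)) = eval_expr e s"
    using WhileFalse.prems by (intro eval_expr_fresh) simp
  then show ?case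
    using WhileFalse.hyps(1) by (intro exec.WhileFalse) (simp del: fun_upd_apply)
next
  case (WhileTrue e s p m s' n s'')
  have "eval_expr e (s(v := d)) = eval_expr e s"
    using WhileTrue.prems by (intro eval_expr_fresh) simp
  then show ?case
    using WhileTrue.hyps(1) WhileTrue.prems
    by (intro exec.WhileTrue[where s' = "s'(v := d)"] WhileTrue.IH) (simp_all del: fun_upd_apply)
next
  case (Seq p s m s' q n s'')
  then show ?case
    using Seq.prems by (intro exec.Seq[where s' = "s'(v := d)"] Seq.IH) (simp_all del: fun_upd_apply)
qed (rule exec.Skip)

text \<open>The time for g depends also on the output y of p, whose size is not controlled at this
  point.\<close>

lemma ex_calling_prog:
  assumes f: "ptime f" and g: "ptime g"
  shows "\<exists>q b. polybd b \<and> mono b \<and> (\<forall>x y m. computes_in p (left (f x)) y m \<longrightarrow>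
    (\<exists>m' \<le> m + b (size x + size y). computes_in q x (g (Node y (right (f x)))) m'))"
proof -
  obtain pf bf where f: "polybd bf" "mono bf" "\<And>x. size (f x) \<le> bf (size x)"
    "\<And>x s r. \<exists>t \<le> bf (size x). exec pf (s(0 := Node x r)) t (s(0 := Node (f x) r))"
    using f by (rule ptimeE) blast
  obtain pg bg where g: "polybd bg" "mono bg" "\<And>x. size (g x) \<le> bg (size x)"
    "\<And>x s r. \<exists>t \<le> bg (size x). exec pg (s(0 := Node x r)) t (s(0 := Node (g x) r))"
    using g by (rule ptimeE) blast
  \<comment> \<open>\<open>Suc\<close> keeps v apart from 0, the variable for input and
    output.\<close>
  define v where "v = Suc (prog_bound p)"
  define q where "q = Seq (Assign 0 (Pair (Var 0) (Const Leaf))) (Seq pf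
    (Seq (Assign v (Right (Left (Var 0)))) (Seq (Assign 0 (Left (Left (Var 0)))) (Seq p
    (Seq (Assign 0 (Pair (Pair (Var 0) (Var v)) (Const Leaf))) (Seq pg (Assign 0 (Left (Var 0)))))))))"
  \<comment> \<open>The first two summands are for \<open>pf\<close> and \<open>pg\<close>, where
    \<open>n + bf n + 1\<close> bounds the size of \<open>Node y (right (f x))\<close>; the 5 counts
    the assignments.\<close>
  define b where "b n = bf n + bg (n + bf n + 1) + 5" for n
  have "polybd (\<lambda>n. bg (n + bf n + 1))"
    by (rule polybd_comp[OF g(1,2)]) (intro polybd_intros f)
  then have "polybd b"
    unfolding b_def by (intro polybd_intros f)
  moreover have "mono b"
  proof (rule monoI)
    fix n n' :: nat
    assume "n \<le> n'"
    then have "bf n \<le> bf n'"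
      by (rule monoD[OF f(2)])
    with \<open>n \<le> n'\<close> show "b n \<le> b n'"
      unfolding b_def by (intro add_mono monoD[OF g(2)]) auto
  qed
  moreover have "\<exists>m' \<le> m + b (size x + size y). computes_in q x (g (Node y (right (f x)))) m'"
    if p: "computes_in p (left (f x)) y m" for x y m
  proof -
    let ?s = "(\<lambda>_. Leaf) :: state"
    let ?k = "right (f x)"
    obtain s' where s': "exec p (?s(0 := left (f x))) m s'" "s' 0 = y"
      using p unfolding computes_in_def by blast
    obtain t where t: "t \<le> bf (size x)" "exec pf (?s(0 := Node x Leaf)) t (?s(0 := Node (f x) Leaf))"
      using f(4) by blast
    define u where "u = s'(v := ?k)"
    have v: "v \<noteq> 0" by (simp add: v_def)
    have u: "u 0 = y" "u v = ?k"
      using s'(2) v by (auto simp: u_def)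
    obtain t' where t': "t' \<le> bg (size (Node y ?k))"
      "exec pg (u(0 := Node (Node y ?k) Leaf)) t' (u(0 := Node (g (Node y ?k)) Leaf))"
      using g(4) by blast
    have 1: "exec (Assign 0 (Pair (Var 0) (Const Leaf))) (?s(0 := x)) (Suc 0) (?s(0 := Node x Leaf))"
      by (rule exec_assign) simp
    have 2: "exec (Assign v (Right (Left (Var 0)))) (?s(0 := Node (f x) Leaf)) (Suc 0)
        (?s(0 := Node (f x) Leaf, v := ?k))"
      by (rule exec_assign) simp
    have 3: "exec (Assign 0 (Left (Left (Var 0)))) (?s(0 := Node (f x) Leaf, v := ?k)) (Suc 0)
        (?s(0 := left (f x), v := ?k))"
      using v by (intro exec_assign) (simp add: fun_upd_twist[of v 0])
    \<comment> \<open>\<open>pf\<close> has left all other variables at \<open>Leaf\<close>, so p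
      starts in its proper initial state up to v.\<close>
    have 4: "exec p (?s(0 := left (f x), v := ?k)) m u"
      unfolding u_def using s'(1) by (rule exec_fresh) (simp add: v_def)
    have 5: "exec (Assign 0 (Pair (Pair (Var 0) (Var v)) (Const Leaf))) u (Suc 0)
        (u(0 := Node (Node y ?k) Leaf))"
      by (rule exec_assign) (simp add: u)
    have 6: "exec (Assign 0 (Left (Var 0))) (u(0 := Node (g (Node y ?k)) Leaf)) (Suc 0)
        (u(0 := g (Node y ?k)))"
      by (rule exec_assign) simp
    have "exec q (?s(0 := x))
        (Suc 0 + (t + (Suc 0 + (Suc 0 + (m + (Suc 0 + (t' + Suc 0))))))) (u(0 := g (Node y ?k)))"
      unfolding q_def
      by (rule exec.Seq[OF 1] exec.Seq[OF t(2)] exec.Seq[OF 2] exec.Seq[OF 3] exec.Seq[OF 4]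
          exec.Seq[OF 5] exec.Seq[OF t'(2) 6])+
    then have "computes_in q x (g (Node y ?k)) (Suc 0 + (t + (Suc 0 + (Suc 0 + (m + (Suc 0 + (t' + Suc 0)))))))"
      unfolding computes_in_def by fastforce
    moreover have "t \<le> bf (size x + size y)"
      using t(1) f(2) by (meson le_add1 monoD order_trans)
    moreover have "t' \<le> bg (size x + size y + bf (size x + size y) + 1)"
    proof -
      have "size ?k \<le> bf (size x)"
        using f(3) size_right order_trans by blast
      also have "\<dots> \<le> bf (size x + size y)"
        using f(2) by (simp add: monoD)
      finally have "size (Node y ?k) \<le> size x + size y + bf (size x + size y) + 1"
        by simp
      then show ?thesis
        using t'(1) g(2) by (meson monoD order_trans)
    qed
    ultimately show ?thesis
      by (intro exI[of _ "Suc 0 + (t + (Suc 0 + (Suc 0 + (m + (Suc 0 + (t' + Suc 0))))))"])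
        (simp add: b_def)
  qed
  ultimately show ?thesis by blast
qed


subsection \<open>The lower bound\<close>

text \<open>The width takes half of the exponent, as
  \<open>\<delta> / 12 * 6 = \<delta> / 2\<close>; the other half absorbs the polynomial
  factor.\<close>

lemma subexponential_bound:
  fixes \<delta> M C :: real and d e :: nat
  assumes "0 < \<delta>"
  shows "(\<lambda>n. 2 powr (\<delta> / 12 * (6 * real n + C) + M) * (real n + 2) ^ d + (real n + 2) ^ e)
    \<in> O(\<lambda>n. 2 powr (\<delta> * real n))"
proof (rule sum_in_bigo)
  have "(\<lambda>n. 2 powr (\<delta> / 12 * (6 * real n + C) + M)) \<in> O(\<lambda>n. 2 powr (\<delta> / 2 * real n))"
    using assms by real_asymp
  moreover have "(\<lambda>n. (real n + 2) ^ d) \<in> O(\<lambda>n. 2 powr (\<delta> / 2 * real n))"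
    using assms by real_asymp
  ultimately have "(\<lambda>n. 2 powr (\<delta> / 12 * (6 * real n + C) + M) * (real n + 2) ^ d)
      \<in> O(\<lambda>n. 2 powr (\<delta> / 2 * real n) * 2 powr (\<delta> / 2 * real n))"
    by (rule landau_o.big.mult)
  then show "(\<lambda>n. 2 powr (\<delta> / 12 * (6 * real n + C) + M) * (real n + 2) ^ d)
      \<in> O(\<lambda>n. 2 powr (\<delta> * real n))"
    by (simp flip: powr_add)
  show "(\<lambda>n. (real n + 2) ^ e) \<in> O(\<lambda>n. 2 powr (\<delta> * real n))"
    using assms by real_asymp
qed

text \<open>g may fail to be monotone, so an upper bound on the width says nothing about g there
  directly. A linear majorant repairs this; M takes care of the finitely many small t.\<close>

lemma smallo_linear_bound:
  fixes g :: "nat \<Rightarrow> real"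
  assumes "g \<in> o(\<lambda>t. real t)" "0 < \<epsilon>"
  shows "\<exists>M. \<forall>t. g t \<le> \<epsilon> * real t + M"
proof -
  obtain t0 where t0: "\<And>t. t0 \<le> t \<Longrightarrow> norm (g t) \<le> \<epsilon> * norm (real t)"
    using landau_o.smallD[OF assms] unfolding eventually_sequentially by blast
  have "g t \<le> \<epsilon> * real t + (\<Sum>s<t0. \<bar>g s\<bar>)" for t
  proof (cases "t < t0")
    case True
    then have "\<bar>g t\<bar> \<le> (\<Sum>s<t0. \<bar>g s\<bar>)"
      by (intro member_le_sum) auto
    moreover have "0 \<le> \<epsilon> * real t"
      using assms(2) by simp
    ultimately show ?thesis by linarith
  next
    case False
    then have "g t \<le> \<epsilon> * real t"
      using t0[of t] by auto
    then show ?thesis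
      by (simp add: add_increasing2 sum_nonneg)
  qed
  then show ?thesis by blast
qed

context reduction
begin

lemma hitting_imp_3SAT:
  assumes p: "solves_hitting_in H p (\<lambda>t n. 2 powr g t * real n ^ e)"
    and g: "g \<in> o(\<lambda>t. real t)" and \<delta>: "0 < \<delta>"
  shows "\<exists>q f. f \<in> O(\<lambda>n. 2 powr (\<delta> * real n)) \<and> solves_3SAT_in q f"
proof -
  \<comment> \<open>The budget is passed along for the comparison with the output of p.\<close>
  define f where "f x = Node (instance_data (add_unit x)) (budget (add_unit x))" for x
  define cmp where "cmp x = enc_bool (dminus (left x) (right x) = Leaf)" for x
  have f: "ptime f"
    unfolding f_def by (intro ptime_Node ptime_instance_data ptime_budget ptime_add_unit ptime_id)
  have cmp: "ptime cmp"
    unfolding cmp_def by (intro ptime_intros)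
  obtain q bq where bq: "polybd bq" "mono bq" and q: "\<And>x y m. computes_in p (left (f x)) y m \<Longrightarrow>
      \<exists>m' \<le> m + bq (size x + size y). computes_in q x (cmp (Node y (right (f x)))) m'"
    using ex_calling_prog[OF f cmp] by blast
  obtain bv where bv: "polybd bv" "mono bv" "\<And>x. size (vertices (add_unit x)) \<le> bv (size x)"
    using ptime_size[OF ptime_vertices[OF ptime_add_unit[OF ptime_id]]] by blast
  obtain bs where bs: "polybd bs" "\<And>n \<phi>. cnf3 n \<phi> \<Longrightarrow> size (enc_cnf n \<phi>) \<le> bs n"
    using size_enc_cnf_le by blast
  have bvs: "polybd (\<lambda>n. bv (bs n))"
    by (rule polybd_comp[OF bv(1,2) bs(1)])
  moreover have "polybd (\<lambda>n. bq (bs n + bv (bs n)))"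
    by (rule polybd_comp[OF bq polybd_add[OF bs(1) bvs]])
  ultimately obtain d d' where d: "\<And>n. bv (bs n) \<le> (n + 2) ^ d" "\<And>n. bq (bs n + bv (bs n)) \<le> (n + 2) ^ d'"
    unfolding polybd_def by blast
  obtain M where M: "\<And>t. g t \<le> \<delta> / 12 * real t + M"
    using smallo_linear_bound[OF g, of "\<delta> / 12"] \<delta> by auto
  \<comment> \<open>\<open>width_le\<close> is applied to n + 1 variables, because of the added unit
    clause: \<open>6 * (n + 1) + 3 = 6 * n + 9\<close>.\<close>
  define W where "W = 9 + real (card (verts H))"
  \<comment> \<open>The first summand is the time of p, with \<open>(n + 2) ^ d\<close> bounding the
    number of vertices; the second pays for the reduction and the comparison.\<close>
  define F where "F n = 2 powr (\<delta> / 12 * (6 * real n + W) + M) * (real n + 2) ^ (d * e) + (real n + 2) ^ d'" for n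
  have "F \<in> O(\<lambda>n. 2 powr (\<delta> * real n))"
    unfolding F_def by (rule subexponential_bound[OF \<delta>])
  moreover have "solves_3SAT_in q F"
    unfolding solves_3SAT_in_def
  proof (intro allI impI)
    fix n \<phi>
    assume \<phi>: "cnf3 n \<phi>"
    let ?x = "enc_cnf n \<phi>"
    let ?\<psi> = "[(n, True)] # \<phi>"
    let ?D = "enc_cnf (Suc n) ?\<psi>"
    have D: "add_unit ?x = ?D"
      by (rule add_unit_enc_cnf)
    have "cnf3 (Suc n) ?\<psi>"
      using \<phi> by (fastforce simp: cnf3_def)
    note inst = reduction_instance_enc_cnf[OF this list.distinct(2) zero_less_Suc]
    interpret reduction_instance H a b c ?D
      by (rule inst(1))
    let ?y = "enc_nat (min_hitting H graph color)"
    have "\<exists>m. computes_in p (enc_instance graph color path bag) ?y m \<and>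
        real m \<le> 2 powr g (width path bag) * real (card (verts graph)) ^ e"
      using p hitting_input unfolding solves_hitting_in_def by blast
    then obtain m where m: "computes_in p (instance_data ?D) ?y m"
      "real m \<le> 2 powr g (width path bag) * real (length V) ^ e"
      unfolding enc_instance_eq by auto
    then obtain m' where m': "m' \<le> m + bq (size ?x + size ?y)"
      "computes_in q ?x (cmp (Node ?y (budget ?D))) m'"
      using q[of ?x ?y m] by (auto simp: f_def D)
    have "enc_nat k = Leaf \<longleftrightarrow> k = 0" for k
      by (cases k) (simp_all add: enc_nat_Suc, simp add: enc_nat_def)
    then have "cmp (Node ?y (budget ?D)) = enc_bool (min_hitting H graph color \<le> B)"
      by (simp add: cmp_def budget_eq dminus_enc_nat)
    also have "\<dots> = enc_bool (satisfiable \<phi>)"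
      using satisfiable_iff_min_hitting inst(3) satisfiable_add_unit[OF \<phi>] by simp
    finally have "computes_in q ?x (enc_bool (satisfiable \<phi>)) m'"
      using m'(2) by simp
    moreover have "real m' \<le> F n"
    proof -
      have N: "length V \<le> bv (bs n)"
        using length_dlist[of "vertices ?D"] bv(3)[of ?x] monoD[OF bv(2) bs(2)[OF \<phi>]]
        unfolding D by linarith
      have "size ?x + size ?y \<le> bs n + bv (bs n)"
        using bs(2)[OF \<phi>] min_hitting_le[of graph color] N by simp
      then have "bq (size ?x + size ?y) \<le> (n + 2) ^ d'"
        using monoD[OF bq(2)] d(2)[of n] order_trans by blast
      then have 1: "real (bq (size ?x + size ?y)) \<le> (real n + 2) ^ d'"
        by (metis of_nat_add of_nat_le_iff of_nat_numeral of_nat_power)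
      have "length V \<le> (n + 2) ^ d"
        using N d(1)[of n] by simp
      then have "real (length V) \<le> (real n + 2) ^ d"
        by (metis of_nat_add of_nat_le_iff of_nat_numeral of_nat_power)
      then have 2: "real (length V) ^ e \<le> (real n + 2) ^ (d * e)"
        unfolding power_mult by (intro power_mono) auto
      have "real (width path bag) \<le> 6 * real n + W"
        using width_le inst(2) by (simp add: W_def)
      then have "\<delta> / 12 * real (width path bag) \<le> \<delta> / 12 * (6 * real n + W)"
        using \<delta> by (intro mult_left_mono) auto
      then have "g (width path bag) \<le> \<delta> / 12 * (6 * real n + W) + M"
        using M[of "width path bag"] by linarith
      then have "2 powr g (width path bag) * real (length V) ^ e \<le>
          2 powr (\<delta> / 12 * (6 * real n + W) + M) * (real n + 2) ^ (d * e)"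
        using 2 by (intro mult_mono) auto
      then show ?thesis
        using m(2) m'(1) 1 by (simp add: F_def)
    qed
    ultimately show "\<exists>m. computes_in q ?x (enc_bool (satisfiable \<phi>)) m \<and> real m \<le> F n"
      by blast
  qed
  ultimately show ?thesis by blast
qed

end

theorem theorem17:
  fixes H :: "nat graph"
  assumes "simple_graph H"
    and "\<exists>K\<in>components H. \<not> path_graph K"
    and "ETH"
  shows "\<not> (\<exists>(p :: prog) (g :: nat \<Rightarrow> real) (c :: nat).
    g \<in> o(\<lambda>t. real t) \<and>
    solves_hitting_in H p (\<lambda>t n. 2 powr g t * real n ^ c))"
proof
  assume "\<exists>(p :: prog) (g :: nat \<Rightarrow> real) (c :: nat). g \<in> o(\<lambda>t. real t) \<and>
    solves_hitting_in H p (\<lambda>t n. 2 powr g t * real n ^ c)"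
  then obtain p g c where p: "solves_hitting_in H p (\<lambda>t n. 2 powr g t * real n ^ c)"
    and g: "g \<in> o(\<lambda>t. real t)"
    by blast
  obtain x y z where "nonseparating H x y z"
    using ex_nonseparating[OF assms(1)] assms(2) by blast
  then interpret reduction H x y z
    using assms(1) by unfold_locales
  obtain \<delta> :: real where "0 < \<delta>"
    "\<nexists>q f. f \<in> O(\<lambda>n. 2 powr (\<delta> * real n)) \<and> solves_3SAT_in q f"
    using assms(3) unfolding ETH_def by blast
  then show False
    using hitting_imp_3SAT[OF p g] by blast
qed

end
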